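(* Let $k$ be an algebraically closed field of characteristic $p>0$. Let $\zeta$ and $\xi$ be Newton polygons of height $h$ with $\zeta\prec\xi$, and set $c=c(\zeta,\xi)$, $M_0:=N_\zeta$ and $M_c:=N_\xi$. Then there exist $\mathrm{DM}_1$'s $M_1,\dots,M_{c-1}$ over $k$ of height $h$ such that $$A^{(0)}<A^{(1)}<\cdots<A^{(c-1)}<A^{(c)},$$ where $A^{(i)}\in\{0,1\}^h$ is the sequence corresponding to $M_i$ for $0\le i\le c$.
   Context: **Newton polygons.** A Newton polygon $\xi$ is a finite multiset of pairs $(m_i,n_i)$, $i=1,\dots,t$, of coprime non-negative integers (so $(1,0)$ and $(0,1)$ are allowed), written $\xi=\sum_{i=1}^t(m_i,n_i)$. Its dimension is $d=\sum n_i$, its height is $h=\sum(m_i+n_i)$. Put $\lambda_i=n_i/(m_i+n_i)$ and order the pairs so that $\lambda_i\ge\lambda_j$ for $i<j$. One regards $\xi$ as the downward-convex line graph from $(0,0)$ to $(h,d)$ with breaking points $\sum_{i>j}(m_i+n_i,n_i)$, $j=0,\dots,t$, hence as a function $x\mapsto\xi(x)$ on $[0,h]$. For Newton polygons $\zeta,\xi$ with the same end point, $\zeta\prec\xi$ means that every point of $\zeta$ is above or on $\xi$ (equality allowed). For $\zeta\prec\xi$ of height $h$ put $c(\zeta,\xi)=2\sum_{i=1}^h(\zeta(i)-\xi(i))$. **$\mathrm{DM}_1$'s.** A $\mathrm{DM}_1$ (truncated Dieudonné module of level one) over $k$ of height $h$ is a triple $(N,F,V)$ where $N$ is a $k$-vector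 space of dimension $h$, $F:N\to N$ is $\sigma$-linear, $V:N\to N$ is $\sigma^{-1}$-linear ($\sigma$ = Frobenius of $k$), with $\operatorname{Ker}F=\operatorname{Im}V$ and $\operatorname{Im}F=\operatorname{Ker}V$. **Classification.** There is a bijection (known) between $\{0,1\}^h$ and isomorphism classes of $\mathrm{DM}_1$'s over $k$ of height $h$: to $A=\delta_1\delta_2\cdots\delta_h$ one associates $N=ke_1\oplus\cdots\oplus ke_h$ with $Fe_i=e_j$, $j=\#\{t\mid 1\le t\le i,\ \delta_t=0\}$, if $\delta_i=0$, and $Fe_i=0$ if $\delta_i=1$; and, if $v$ is the number of $0$'s in $A$ and $i_1<\cdots<i_u$ are the indices with $\delta_i=1$, $Ve_j=e_{i_{j-v}}$ for $j>v$ and $Ve_j=0$ for $j\le v$. **Direct sums.** For sequences $A,B$ corresponding to $\mathrm{DM}_1$'s $N_1,N_2$, $A\oplus B$ denotes the sequence corresponding to $N_1\oplus N_2$. **Minimal $\mathrm{DM}_1$'s.** For coprime non-negative $(m,n)$, $N_{m,n}$ is the $\mathrm{DM}_1$ corresponding to the sequence $A_{m,n}=1\cdots1\,0\cdots0$ ($m$ ones followed by $n$ zeros). For $\xi=\sum(m_i,n_i)$, $N_\xi=\bigoplus_i N_{m_i,n_i}$. **The relation $<$.** For $A,B\in\{0,1\}^h$, $B<A$ means that there are an integer $\ell\ge1$ and sequences $B=A^{(0)},A^{(1)},\dots,A^{(\ell)}=A$ in $\{0,1\}^h$ such that for every $i=1,\dots,\ell$ one can write $A^{(i)}=P\oplus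 Q$ and $A^{(i-1)}=P\oplus Q'$ for some sequences $P,Q,Q'$ of $0$'s and $1$'s ($P$ possibly empty, and all depending on $i$), where $Q'$ is obtained from $Q$ by exchanging an adjacent subsequence "$0\ 1$" of $Q$ for "$1\ 0$". *)

theory Defs
  imports
    "HOL-Analysis.Analysis"
    "HOL-Library.Function_Algebras"
    "HOL-Library.Multiset"
    "HOL-Computational_Algebra.Computational_Algebra"
begin

section \<open>Newton polygons\<close>

definition newton_polygon :: "(nat \<times> nat) multiset \<Rightarrow> bool" where
  "newton_polygon \<xi> \<longleftrightarrow> (\<forall>(m, n) \<in># \<xi>. coprime m n)"

definition np_dim :: "(nat \<times> nat) multiset \<Rightarrow> nat" where
  "np_dim \<xi> = (\<Sum>(m, n) \<in># \<xi>. n)"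

definition np_height :: "(nat \<times> nat) multiset \<Rightarrow> nat" where
  "np_height \<xi> = (\<Sum>(m, n) \<in># \<xi>. m + n)"

definition np_slope :: "nat \<times> nat \<Rightarrow> real" where
  "np_slope = (\<lambda>(m, n). real n / real (m + n))"

text \<open>
  The segments in order of non-increasing slope. For a Newton polygon the choice is unique, because
  coprime pairs of equal slope are equal.
\<close>

definition np_list :: "(nat \<times> nat) multiset \<Rightarrow> (nat \<times> nat) list" where
  "np_list \<xi> = (SOME xs. mset xs = \<xi> \<and> sorted_wrt (\<lambda>p q. np_slope p \<ge> np_slope q) xs)"

text \<open>
  With 1-based indices, dropping the first \<open>j\<close> entries leaves exactly the pairs with index \<open>i > j\<close>.
\<close>

definition np_break :: "(nat \<times> nat) multiset \<Rightarrow> nat \<Rightarrow> real \<times> real" where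
  "np_break \<xi> j =
    ((\<Sum>(m, n) \<leftarrow> drop j (np_list \<xi>). real (m + n)), (\<Sum>(m, n) \<leftarrow> drop j (np_list \<xi>). real n))"

text \<open>The point \<open>(0, 0)\<close> is inserted only to cover the empty multiset.\<close>

definition np_graph :: "(nat \<times> nat) multiset \<Rightarrow> (real \<times> real) set" where
  "np_graph \<xi> =
    insert (0, 0) (\<Union>j < size \<xi>. closed_segment (np_break \<xi> (Suc j)) (np_break \<xi> j))"

definition np_fun :: "(nat \<times> nat) multiset \<Rightarrow> real \<Rightarrow> real" where
  "np_fun \<xi> x = (THE y. (x, y) \<in> np_graph \<xi>)"

definition np_prec :: "(nat \<times> nat) multiset \<Rightarrow> (nat \<times> nat) multiset \<Rightarrow> bool" where
  "np_prec \<zeta> \<xi> \<longleftrightarrow>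
    np_height \<zeta> = np_height \<xi> \<and> np_dim \<zeta> = np_dim \<xi> \<and>
    (\<forall>x \<in> {0..real (np_height \<xi>)}. np_fun \<zeta> x \<ge> np_fun \<xi> x)"

definition np_c :: "(nat \<times> nat) multiset \<Rightarrow> (nat \<times> nat) multiset \<Rightarrow> real" where
  "np_c \<zeta> \<xi> = 2 * (\<Sum>i = 1..np_height \<xi>. np_fun \<zeta> (real i) - np_fun \<xi> (real i))"


section \<open>Truncated Dieudonn\'e modules of level one\<close>

text \<open>The Frobenius \<open>\<sigma>\<close>; its inverse below is meaningful because it is bijective on a perfect field.\<close>

definition frob :: "'k::field \<Rightarrow> 'k" where
  "frob x = x ^ CHAR('k)"

definition frob_inv :: "'k::field \<Rightarrow> 'k" where
  "frob_inv = inv frob"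

definition fscale :: "'k::field \<Rightarrow> ('i \<Rightarrow> 'k) \<Rightarrow> 'i \<Rightarrow> 'k" where
  "fscale c x = (\<lambda>i. c * x i)"

interpretation fun_vs: vector_space "fscale :: 'k::field \<Rightarrow> ('i \<Rightarrow> 'k) \<Rightarrow> 'i \<Rightarrow> 'k"
  by unfold_locales (auto simp: fscale_def fun_eq_iff algebra_simps)

text \<open>
  The underlying vector spaces are subspaces of function spaces \<open>'i \<Rightarrow> 'k\<close>. Up to isomorphism this
  is no restriction: choosing a basis embeds any space into such a function space. The values of
  \<open>F\<close> and \<open>V\<close> outside the carrier are irrelevant.
\<close>

record ('k, 'i) dm1 =
  dm1_carrier :: "('i \<Rightarrow> 'k) set"
  dm1_F :: "('i \<Rightarrow> 'k) \<Rightarrow> 'i \<Rightarrow> 'k"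
  dm1_V :: "('i \<Rightarrow> 'k) \<Rightarrow> 'i \<Rightarrow> 'k"

definition semilinear_on ::
  "('k::field \<Rightarrow> 'k) \<Rightarrow> ('i \<Rightarrow> 'k) set \<Rightarrow> (('i \<Rightarrow> 'k) \<Rightarrow> 'j \<Rightarrow> 'k) \<Rightarrow> bool" where
  "semilinear_on s N f \<longleftrightarrow>
    (\<forall>x \<in> N. \<forall>y \<in> N. f (x + y) = f x + f y) \<and>
    (\<forall>c. \<forall>x \<in> N. f (fscale c x) = fscale (s c) (f x))"

definition is_dm1 :: "nat \<Rightarrow> ('k::field, 'i) dm1 \<Rightarrow> bool" where
  "is_dm1 h N \<longleftrightarrow>
    fun_vs.subspace (dm1_carrier N) \<and>
    (\<exists>B. finite B \<and> card B = h \<and> fun_vs.independent B \<and> fun_vs.span B = dm1_carrier N) \<and>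
    dm1_F N ` dm1_carrier N \<subseteq> dm1_carrier N \<and>
    dm1_V N ` dm1_carrier N \<subseteq> dm1_carrier N \<and>
    semilinear_on frob (dm1_carrier N) (dm1_F N) \<and>
    semilinear_on frob_inv (dm1_carrier N) (dm1_V N) \<and>
    {x \<in> dm1_carrier N. dm1_F N x = 0} = dm1_V N ` dm1_carrier N \<and>
    dm1_F N ` dm1_carrier N = {x \<in> dm1_carrier N. dm1_V N x = 0}"

definition dm1_iso :: "('k::field, 'i) dm1 \<Rightarrow> ('k, 'j) dm1 \<Rightarrow> bool" where
  "dm1_iso N M \<longleftrightarrow>
    (\<exists>\<phi>. bij_betw \<phi> (dm1_carrier N) (dm1_carrier M) \<and>
      semilinear_on id (dm1_carrier N) \<phi> \<and>
      (\<forall>x \<in> dm1_carrier N. \<phi> (dm1_F N x) = dm1_F M (\<phi> x)) \<and>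
      (\<forall>x \<in> dm1_carrier N. \<phi> (dm1_V N x) = dm1_V M (\<phi> x)))"

text \<open>
  External direct sum: for \<open>x\<close> in the carrier, \<open>\<lambda>i. x (j, i)\<close> is the component of \<open>x\<close> in the
  \<open>j\<close>-th summand (counted from 0).
\<close>

definition dm1_sum :: "('k::field, 'i) dm1 list \<Rightarrow> ('k, nat \<times> 'i) dm1" where
  "dm1_sum Ns =
    \<lparr> dm1_carrier = {x. (\<forall>j < length Ns. (\<lambda>i. x (j, i)) \<in> dm1_carrier (Ns ! j)) \<and>
                        (\<forall>j \<ge> length Ns. \<forall>i. x (j, i) = 0)},
      dm1_F = (\<lambda>x (j, i). if j < length Ns then dm1_F (Ns ! j) (\<lambda>i. x (j, i)) i else 0),
      dm1_V = (\<lambda>x (j, i). if j < length Ns then dm1_V (Ns ! j) (\<lambda>i. x (j, i)) i else 0) \<rparr>"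


section \<open>Classification by sequences of zeros and ones\<close>

text \<open>
  A sequence \<open>\<delta>\<^sub>1 \<dots> \<delta>\<^sub>h\<close> of zeros and ones is a list of truth values, with \<open>True\<close> for 1 and \<open>False\<close>
  for 0. Indices run from 1 to \<open>h\<close>.
\<close>

definition delta :: "bool list \<Rightarrow> nat \<Rightarrow> bool" where
  "delta A i = A ! (i - 1)"

definition unit_fun :: "nat \<Rightarrow> nat \<Rightarrow> 'k::field" where
  "unit_fun i = (\<lambda>j. if j = i then 1 else 0)"

definition zeros_upto :: "bool list \<Rightarrow> nat \<Rightarrow> nat" where
  "zeros_upto A i = card {t \<in> {1..i}. \<not> delta A t}"

text \<open>\<open>one_index A s\<close> is the \<open>s\<close>-th index \<open>i\<^sub>s\<close> (from 1) at which \<open>A\<close> has the entry 1.\<close>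

definition one_index :: "bool list \<Rightarrow> nat \<Rightarrow> nat" where
  "one_index A s = filter (delta A) [1..<length A + 1] ! (s - 1)"

text \<open>
  The module with basis \<open>e\<^sub>1, \<dots>, e\<^sub>h\<close>, where \<open>e\<^sub>i = unit_fun i\<close>. The maps \<open>F\<close> and \<open>V\<close> are the
  semilinear extensions of their values on the basis.
\<close>

definition std_dm1 :: "bool list \<Rightarrow> ('k::field, nat) dm1" where
  "std_dm1 A =
    (let h = length A; v = zeros_upto A h in
    \<lparr> dm1_carrier = {x. \<forall>i. i \<notin> {1..h} \<longrightarrow> x i = 0},
      dm1_F = (\<lambda>x. \<Sum>i \<in> {1..h}.
        if delta A i then 0 else fscale (frob (x i)) (unit_fun (zeros_upto A i))),
      dm1_V = (\<lambda>x. \<Sum>j \<in> {1..h}.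
        if j > v then fscale (frob_inv (x j)) (unit_fun (one_index A (j - v))) else 0) \<rparr>)"

definition dm1_seq :: "('k::field, 'i) dm1 \<Rightarrow> bool list" where
  "dm1_seq N = (THE A. dm1_iso N (std_dm1 A))"

text \<open>
  The direct sum of sequences is defined through modules over the field \<open>'k\<close>, which therefore enters
  as a type argument.
\<close>

definition seq_oplus :: "'k::field itself \<Rightarrow> bool list \<Rightarrow> bool list \<Rightarrow> bool list" where
  "seq_oplus _ A B = dm1_seq (dm1_sum [std_dm1 A :: ('k, nat) dm1, std_dm1 B])"


section \<open>Minimal modules\<close>

definition minimal_seq :: "nat \<times> nat \<Rightarrow> bool list" where
  "minimal_seq = (\<lambda>(m, n). replicate m True @ replicate n False)"

definition minimal_dm1 :: "(nat \<times> nat) multiset \<Rightarrow> ('k::field, nat \<times> nat) dm1" where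
  "minimal_dm1 \<xi> = dm1_sum (map (\<lambda>p. std_dm1 (minimal_seq p)) (np_list \<xi>))"


section \<open>The relation \<open><\<close> on sequences\<close>

definition exchange_01 :: "bool list \<Rightarrow> bool list \<Rightarrow> bool" where
  "exchange_01 Q Q' \<longleftrightarrow>
    (\<exists>xs ys. Q = xs @ [False, True] @ ys \<and> Q' = xs @ [True, False] @ ys)"

definition seq_step :: "'k::field itself \<Rightarrow> bool list \<Rightarrow> bool list \<Rightarrow> bool" where
  "seq_step K B A \<longleftrightarrow>
    (\<exists>P Q Q'. A = seq_oplus K P Q \<and> B = seq_oplus K P Q' \<and> exchange_01 Q Q')"

definition seq_less :: "'k::field itself \<Rightarrow> bool list \<Rightarrow> bool list \<Rightarrow> bool" where
  "seq_less K B A \<longleftrightarrow>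
    (\<exists>l \<ge> 1. \<exists>S :: nat \<Rightarrow> bool list. S 0 = B \<and> S l = A \<and>
      (\<forall>i \<le> l. length (S i) = length A) \<and>
      (\<forall>i \<in> {1..l}. seq_step K (S (i - 1)) (S i)))"

end

theory Submission
  imports Defs "HOL-Combinatorics.List_Permutation" "HOL-Number_Theory.Cong"
begin

text \<open>
  \<^emph>\<open>Combinatorics of the modules.\<close> In the module of a sequence, \<open>F\<close> and the inverse of \<open>V\<close> together
  permute the standard basis: \<open>e\<^sub>i\<close> goes to \<open>F e\<^sub>i\<close> if \<open>\<delta>\<^sub>i = 0\<close>, and to the vector which \<open>V\<close> sends to
  \<open>e\<^sub>i\<close> if \<open>\<delta>\<^sub>i = 1\<close>. So the module is a finite set with a permutation and labels in \<open>{0, 1}\<close>, or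
  equivalently a multiset of cyclic words, and direct sums are disjoint unions. The sequence lists the
  labels in the lexicographic order of the pasts of the elements (\<open>words_lp_iso_exists\<close>); it is
  determined by the module because it can be read off from the dimensions in the canonical filtration
  (\<open>std_dm1_unique\<close>). Exchanging neighbouring labels \<open>0 1\<close> for \<open>1 0\<close> keeps the order of the elements
  and composes the permutation with a transposition (\<open>embeds_swap\<close>): it merges two cycles or splits one.
  The module \<open>N\<^bsub>m,n\<^esub>\<close> is a single cycle, namely a rotation, and its cyclic word is the Christoffel word
  of \<open>(m, n)\<close>.

  \<^emph>\<open>Polygons.\<close> The number \<open>c(\<zeta>, \<xi>)\<close> is twice the area between the polygons. It equals \<open>S(\<xi>) - S(\<zeta>)\<close>, where
  \<open>S\<close> is the sum of the absolute values of the determinants of all pairs of segments (\<open>np_c_eq\<close>). A lowest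
  slope that is common to \<open>\<zeta>\<close> and \<open>\<xi>\<close> may be removed from both. Otherwise the first corner \<open>v\<close> of \<open>\<xi>\<close>, between
  its two lowest slopes \<open>x\<close> and \<open>y\<close>, lies strictly below \<open>\<zeta>\<close>. Replace it by the lower boundary of the lattice
  points other than \<open>v\<close> in the triangle at \<open>v\<close>. This is a convex path \<open>a\<^sub>1, \<dots>, a\<^sub>r\<close> whose segments span
  with \<open>v\<close> triangles without further lattice points. Hence \<open>\<zeta>\<close> still lies above the new polygon
  (\<open>refined_above\<close>), while \<open>S\<close> drops by exactly \<open>r\<close> (\<open>fan_length\<close>).

  \<^emph>\<open>The exchanges.\<close> So it remains to go from \<open>N\<^sub>x \<oplus> N\<^sub>y\<close> to the sum of the modules of \<open>a\<^sub>1, \<dots>, a\<^sub>r\<close> by \<open>r\<close>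
  exchanges (\<open>refines_exists\<close>). The first exchange merges the two cycles into one, and each of the
  others cuts off the Christoffel word of one \<open>a\<^sub>k\<close>; after \<open>r - 1\<close> cuts the last one remains. Prepending
  ones to a sequence, one for every zero, is compatible with direct sums and exchanges and shears all
  slopes; together with duality this reduces to \<open>x\<close> and \<open>y\<close> on different sides of the diagonal. There
  the sequence of the sum has only four blocks, and most cuts follow the standard factorization of
  Christoffel words (\<open>chris_factor\<close>): they remove the upper Stern-Brocot parent from \<open>x\<close>
  until \<open>x = (1, 0)\<close>, and dually for \<open>y\<close>.
\<close>

section \<open>Labelled permutations\<close>

text \<open>
  A finite set whose elements carry a label (\<open>True\<close> for 1) and are permuted. It stands for the module
  with these elements as a basis in which \<open>F e = p e\<close> if \<open>e\<close> has label 0 and \<open>V (p e) = e\<close> if it has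
  label 1, all other basis vectors being sent to 0.
\<close>

type_synonym 'a lp = "'a set \<times> ('a \<Rightarrow> bool) \<times> ('a \<Rightarrow> 'a)"

definition lp_ok :: "'a lp \<Rightarrow> bool" where
  "lp_ok = (\<lambda>(T, d, p). finite T \<and> bij_betw p T T)"

definition lp_iso :: "'a lp \<Rightarrow> 'b lp \<Rightarrow> bool" (infix "\<simeq>" 50) where
  "L \<simeq> L' \<longleftrightarrow> (case L of (T, d, p) \<Rightarrow> case L' of (T', d', p') \<Rightarrow>
     \<exists>f. bij_betw f T T' \<and> (\<forall>t\<in>T. d' (f t) = d t \<and> f (p t) = p' (f t)))"

lemma lp_isoI:
  assumes "bij_betw f T T'" "\<And>t. t \<in> T \<Longrightarrow> d' (f t) = d t" "\<And>t. t \<in> T \<Longrightarrow> f (p t) = p' (f t)"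
  shows "(T, d, p) \<simeq> (T', d', p')"
  using assms unfolding lp_iso_def by auto

lemma lp_isoI':
  assumes "bij_betw f (fst L) (fst M)" "\<And>t. t \<in> fst L \<Longrightarrow> fst (snd M) (f t) = fst (snd L) t"
    "\<And>t. t \<in> fst L \<Longrightarrow> f (snd (snd L) t) = snd (snd M) (f t)"
  shows "L \<simeq> M"
  using assms unfolding lp_iso_def by (auto split: prod.splits)

lemma lp_isoE:
  assumes "(T, d, p) \<simeq> (T', d', p')"
  obtains f where "bij_betw f T T'" "\<And>t. t \<in> T \<Longrightarrow> d' (f t) = d t" "\<And>t. t \<in> T \<Longrightarrow> f (p t) = p' (f t)"
  using assms unfolding lp_iso_def by auto

lemma lp_iso_refl: "L \<simeq> L"
  by (cases L) (auto intro!: lp_isoI[where f = id])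

lemma lp_iso_trans:
  assumes "L \<simeq> M" "M \<simeq> N"
  shows "L \<simeq> N"
proof -
  obtain T d p where L: "L = (T, d, p)" by (cases L)
  obtain T' d' p' where M: "M = (T', d', p')" by (cases M)
  obtain T2 d2 p2 where N: "N = (T2, d2, p2)" by (cases N)
  obtain f where f: "bij_betw f T T'" "\<And>t. t \<in> T \<Longrightarrow> d' (f t) = d t" "\<And>t. t \<in> T \<Longrightarrow> f (p t) = p' (f t)"
    using assms(1) unfolding L M by (rule lp_isoE) blast
  obtain g where g: "bij_betw g T' T2" "\<And>t. t \<in> T' \<Longrightarrow> d2 (g t) = d' t" "\<And>t. t \<in> T' \<Longrightarrow> g (p' t) = p2 (g t)"
    using assms(2) unfolding M N by (rule lp_isoE) blast
  have "f t \<in> T'" if "t \<in> T" for t using f(1) that bij_betwE by blast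
  then show ?thesis unfolding L N
    by (intro lp_isoI[where f = "g \<circ> f"]) (use f g in \<open>auto intro: bij_betw_trans\<close>)
qed

lemma lp_iso_sym:
  assumes "lp_ok L" "L \<simeq> M"
  shows "M \<simeq> L"
proof -
  obtain T d p where L: "L = (T, d, p)" by (cases L)
  obtain T' d' p' where M: "M = (T', d', p')" by (cases M)
  obtain f where f: "bij_betw f T T'" "\<And>t. t \<in> T \<Longrightarrow> d' (f t) = d t" "\<And>t. t \<in> T \<Longrightarrow> f (p t) = p' (f t)"
    using assms(2) unfolding L M by (rule lp_isoE) blast
  have p: "p t \<in> T" if "t \<in> T" for t
    using assms(1) L that by (auto simp: lp_ok_def bij_betw_def)
  let ?g = "inv_into T f"
  have g: "bij_betw ?g T' T" using f(1) by (rule bij_betw_inv_into)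
  have g1: "?g s \<in> T" "f (?g s) = s" if "s \<in> T'" for s
    using bij_betwE[OF g] bij_betw_inv_into_right[OF f(1)] that by auto
  have g2: "?g (f t) = t" if "t \<in> T" for t
    using f(1) that by (simp add: bij_betw_inv_into_left)
  show ?thesis unfolding L M
  proof (rule lp_isoI[OF g])
    fix s assume s: "s \<in> T'"
    show "d (?g s) = d' s" using f(2)[OF g1(1)[OF s]] g1(2)[OF s] by simp
    have "f (p (?g s)) = p' s" using f(3)[OF g1(1)[OF s]] g1(2)[OF s] by simp
    then show "?g (p' s) = p (?g s)" using g2[OF p[OF g1(1)[OF s]]] by simp
  qed
qed

definition lp_sum :: "'a lp list \<Rightarrow> (nat \<times> 'a) lp" where
  "lp_sum Ls = ({(j, i). j < length Ls \<and> i \<in> fst (Ls ! j)},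
              (\<lambda>(j, i). fst (snd (Ls ! j)) i),
              (\<lambda>(j, i). (j, snd (snd (Ls ! j)) i)))"

lemma lp_ok_lp_sum:
  assumes "\<And>L. L \<in> set Ls \<Longrightarrow> lp_ok L"
  shows "lp_ok (lp_sum Ls)"
proof -
  let ?T = "{(j, i). j < length Ls \<and> i \<in> fst (Ls ! j)}"
  let ?p = "\<lambda>(j, i). (j, snd (snd (Ls ! j)) i)"
  have eq: "?T = Sigma {..<length Ls} (\<lambda>j. fst (Ls ! j))" by auto
  have ok: "finite (fst (Ls ! j))" "bij_betw (snd (snd (Ls ! j))) (fst (Ls ! j)) (fst (Ls ! j))"
    if "j < length Ls" for j
    using assms[of "Ls ! j"] that by (auto simp: lp_ok_def split: prod.splits)
  have "finite ?T" unfolding eq using ok by auto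
  moreover have "bij_betw ?p ?T ?T"
  proof (rule bij_betw_imageI)
    show "inj_on ?p ?T"
      using ok(2) by (auto simp: inj_on_def bij_betw_def)
    show "?p ` ?T = ?T"
    proof (intro equalityI subsetI)
      fix z assume "z \<in> ?p ` ?T"
      then show "z \<in> ?T" using ok(2) by (auto simp: bij_betw_def)
    next
      fix z assume "z \<in> ?T"
      then obtain j i where z: "z = (j, i)" "j < length Ls" "i \<in> fst (Ls ! j)" by auto
      then obtain i' where "i' \<in> fst (Ls ! j)" "i = snd (snd (Ls ! j)) i'"
        using ok(2) unfolding bij_betw_def by blast
      then show "z \<in> ?p ` ?T" using z by (intro image_eqI[where x = "(j, i')"]) auto
    qed
  qed
  ultimately show ?thesis by (simp add: lp_sum_def lp_ok_def)
qed

text \<open>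
  The bijection of the indices is arbitrary, so that this covers both the replacement and the
  reordering of summands.
\<close>

lemma lp_sum_iso:
  assumes g: "bij_betw g {..<length Ls} {..<length Ks}"
    and iso: "\<And>j. j < length Ls \<Longrightarrow> Ls ! j \<simeq> Ks ! g j"
  shows "lp_sum Ls \<simeq> lp_sum Ks"
proof -
  have "\<exists>f. bij_betw f (fst (Ls ! j)) (fst (Ks ! g j)) \<and>
      (\<forall>t\<in>fst (Ls ! j). fst (snd (Ks ! g j)) (f t) = fst (snd (Ls ! j)) t \<and>
         f (snd (snd (Ls ! j)) t) = snd (snd (Ks ! g j)) (f t))" if "j < length Ls" for j
    using iso[OF that] by (auto simp: lp_iso_def split: prod.splits)
  then obtain f where f: "\<And>j. j < length Ls \<Longrightarrow> bij_betw (f j) (fst (Ls ! j)) (fst (Ks ! g j))"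
    "\<And>j t. j < length Ls \<Longrightarrow> t \<in> fst (Ls ! j) \<Longrightarrow> fst (snd (Ks ! g j)) (f j t) = fst (snd (Ls ! j)) t"
    "\<And>j t. j < length Ls \<Longrightarrow> t \<in> fst (Ls ! j) \<Longrightarrow> f j (snd (snd (Ls ! j)) t) = snd (snd (Ks ! g j)) (f j t)"
    by metis
  show ?thesis unfolding lp_sum_def
  proof (rule lp_isoI[where f = "\<lambda>(j, i). (g j, f j i)"])
    show "bij_betw (\<lambda>(j, i). (g j, f j i)) {(j, i). j < length Ls \<and> i \<in> fst (Ls ! j)}
        {(j, i). j < length Ks \<and> i \<in> fst (Ks ! j)}"
    proof (rule bij_betw_imageI)
      show "inj_on (\<lambda>(j, i). (g j, f j i)) {(j, i). j < length Ls \<and> i \<in> fst (Ls ! j)}"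
      proof (rule inj_onI, clarsimp)
        fix j i k l assume a: "g j = g k" "f j i = f k l" "j < length Ls" "i \<in> fst (Ls ! j)"
          "k < length Ls" "l \<in> fst (Ls ! k)"
        then have "j = k" using bij_betw_imp_inj_on[OF g] by (auto simp: inj_on_def)
        then show "j = k \<and> i = l" using a bij_betw_imp_inj_on[OF f(1)] by (auto simp: inj_on_def)
      qed
      show "(\<lambda>(j, i). (g j, f j i)) ` {(j, i). j < length Ls \<and> i \<in> fst (Ls ! j)} =
          {(j, i). j < length Ks \<and> i \<in> fst (Ks ! j)}" (is "?l = ?r")
      proof (intro equalityI subsetI)
        fix z assume "z \<in> ?l" then show "z \<in> ?r"
          using g f(1) by (fastforce simp: bij_betw_def)
      next
        fix z assume "z \<in> ?r"
        then obtain j i where z: "z = (j, i)" "j < length Ks" "i \<in> fst (Ks ! j)" by auto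
        from z(2) obtain k where k: "k < length Ls" "j = g k"
          using g unfolding bij_betw_def by blast
        from z(3) obtain t where "t \<in> fst (Ls ! k)" "i = f k t"
          using f(1)[OF k(1)] k unfolding bij_betw_def by blast
        then show "z \<in> ?l" using z k by (intro image_eqI[where x = "(k, t)"]) auto
      qed
    qed
  qed (use f in auto)
qed

lemma lp_sum_cong: "list_all2 (\<simeq>) Ls Ks \<Longrightarrow> lp_sum Ls \<simeq> lp_sum Ks"
  by (rule lp_sum_iso[where g = id]) (auto simp: list_all2_conv_all_nth)

lemma lp_sum_mset:
  assumes "mset Ls = mset Ks"
  shows "lp_sum Ls \<simeq> lp_sum Ks"
proof -
  obtain g where "bij_betw g {..<length Ls} {..<length Ks}" "\<forall>i<length Ls. Ls ! i = Ks ! g i"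
    using permutation_Ex_bij assms by blast
  then show ?thesis by (intro lp_sum_iso[where g = g]) (auto simp: lp_iso_refl)
qed

lemma lp_sum_append:
  assumes "lp_sum Ls \<simeq> lp_sum Ls'" "lp_sum Ks \<simeq> lp_sum Ks'"
  shows "lp_sum (Ls @ Ks) \<simeq> lp_sum (Ls' @ Ks')"
proof -
  obtain f where f: "bij_betw f (fst (lp_sum Ls)) (fst (lp_sum Ls'))"
    "\<And>t. t \<in> fst (lp_sum Ls) \<Longrightarrow> fst (snd (lp_sum Ls')) (f t) = fst (snd (lp_sum Ls)) t"
    "\<And>t. t \<in> fst (lp_sum Ls) \<Longrightarrow> f (snd (snd (lp_sum Ls)) t) = snd (snd (lp_sum Ls')) (f t)"
    using assms(1) by (auto simp: lp_iso_def split: prod.splits)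
  obtain g where g: "bij_betw g (fst (lp_sum Ks)) (fst (lp_sum Ks'))"
    "\<And>t. t \<in> fst (lp_sum Ks) \<Longrightarrow> fst (snd (lp_sum Ks')) (g t) = fst (snd (lp_sum Ks)) t"
    "\<And>t. t \<in> fst (lp_sum Ks) \<Longrightarrow> g (snd (snd (lp_sum Ks)) t) = snd (snd (lp_sum Ks')) (g t)"
    using assms(2) by (auto simp: lp_iso_def split: prod.splits)
  have split: "lp_sum (Ls @ Ks) \<simeq> (Inl ` fst (lp_sum Ls) \<union> Inr ` fst (lp_sum Ks),
      case_sum (fst (snd (lp_sum Ls))) (fst (snd (lp_sum Ks))),
      map_sum (snd (snd (lp_sum Ls))) (snd (snd (lp_sum Ks))))" for Ls Ks :: "'c lp list"
    unfolding lp_sum_def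
    apply (rule lp_isoI[where f = "\<lambda>(j, i). if j < length Ls then Inl (j, i) else Inr (j - length Ls, i)"])
      subgoal
        apply (rule bij_betw_byWitness[where f' = "case_sum id (\<lambda>(j, i). (j + length Ls, i))"])
           apply (auto simp: nth_append split: if_splits)
        done
     apply (auto simp: nth_append)
    done
  have split': "(Inl ` fst (lp_sum Ls) \<union> Inr ` fst (lp_sum Ks),
      case_sum (fst (snd (lp_sum Ls))) (fst (snd (lp_sum Ks))),
      map_sum (snd (snd (lp_sum Ls))) (snd (snd (lp_sum Ks)))) \<simeq> lp_sum (Ls @ Ks)" for Ls Ks :: "'c lp list"
    unfolding lp_sum_def
    apply (rule lp_isoI[where f = "case_sum id (\<lambda>(j, i). (j + length Ls, i))"])
      subgoal
        apply (rule bij_betw_byWitness[where f' = "\<lambda>(j, i). if j < length Ls then Inl (j, i) else Inr (j - length Ls, i)"])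
           apply (auto simp: nth_append split: if_splits)
        done
     apply (auto simp: nth_append)
    done
  have "(Inl ` fst (lp_sum Ls) \<union> Inr ` fst (lp_sum Ks),
      case_sum (fst (snd (lp_sum Ls))) (fst (snd (lp_sum Ks))),
      map_sum (snd (snd (lp_sum Ls))) (snd (snd (lp_sum Ks)))) \<simeq>
     (Inl ` fst (lp_sum Ls') \<union> Inr ` fst (lp_sum Ks'),
      case_sum (fst (snd (lp_sum Ls'))) (fst (snd (lp_sum Ks'))),
      map_sum (snd (snd (lp_sum Ls'))) (snd (snd (lp_sum Ks'))))"
  proof (rule lp_isoI[where f = "map_sum f g"])
    show "bij_betw (map_sum f g) (Inl ` fst (lp_sum Ls) \<union> Inr ` fst (lp_sum Ks))
       (Inl ` fst (lp_sum Ls') \<union> Inr ` fst (lp_sum Ks'))"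
    proof (rule bij_betw_imageI)
      show "inj_on (map_sum f g) (Inl ` fst (lp_sum Ls) \<union> Inr ` fst (lp_sum Ks))"
        using f(1) g(1) unfolding bij_betw_def inj_on_def by force
      have "f ` fst (lp_sum Ls) = fst (lp_sum Ls')" "g ` fst (lp_sum Ks) = fst (lp_sum Ks')"
        using f(1) g(1) by (simp_all add: bij_betw_def)
      then show "map_sum f g ` (Inl ` fst (lp_sum Ls) \<union> Inr ` fst (lp_sum Ks)) =
          Inl ` fst (lp_sum Ls') \<union> Inr ` fst (lp_sum Ks')"
        by (simp only: image_Un image_image map_sum.simps) (simp only: image_image[symmetric])
    qed
  qed (use f g in auto)
  from lp_iso_trans[OF split lp_iso_trans[OF this split']] show ?thesis .
qed

section \<open>Sequences as labelled permutations\<close>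

definition zeros_before :: "bool list \<Rightarrow> nat \<Rightarrow> nat" where
  "zeros_before A i = card {k. k < i \<and> \<not> A ! k}"

definition ones_before :: "bool list \<Rightarrow> nat \<Rightarrow> nat" where
  "ones_before A i = card {k. k < i \<and> A ! k}"

text \<open>
  On the standard basis, counted from 0: a zero goes to its rank among the zeros (this is \<open>F\<close>), and a
  one goes behind all zeros to its rank among the ones (the inverse of \<open>V\<close>).
\<close>

definition word_perm :: "bool list \<Rightarrow> nat \<Rightarrow> nat" where
  "word_perm A i = (if A ! i then zeros_before A (length A) + ones_before A i else zeros_before A i)"

definition word_lp :: "bool list \<Rightarrow> nat lp" where
  "word_lp A = ({..<length A}, (!) A, word_perm A)"

abbreviation words_lp :: "bool list list \<Rightarrow> (nat \<times> nat) lp" where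
  "words_lp ws \<equiv> lp_sum (map word_lp ws)"

lemma zeros_before_0 [simp]: "zeros_before A 0 = 0" and ones_before_0 [simp]: "ones_before A 0 = 0"
  by (simp_all add: zeros_before_def ones_before_def)

lemma card_less_Suc_if: "card {k. k < Suc i \<and> P k} = card {k. k < i \<and> P k} + (if P i then 1 else 0)"
proof -
  have "{k. k < Suc i \<and> P k} = (if P i then insert i {k. k < i \<and> P k} else {k. k < i \<and> P k})"
    by (auto simp: less_Suc_eq)
  then show ?thesis by simp
qed

lemma zeros_before_Suc: "zeros_before A (Suc i) = zeros_before A i + (if A ! i then 0 else 1)"
  using card_less_Suc_if[of i "\<lambda>k. \<not> A ! k"] by (simp add: zeros_before_def)

lemma ones_before_Suc: "ones_before A (Suc i) = ones_before A i + (if A ! i then 1 else 0)"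
  using card_less_Suc_if[of i "\<lambda>k. A ! k"] by (simp add: ones_before_def)

lemma zeros_ones_before: "zeros_before A i + ones_before A i = i"
  by (induction i) (auto simp: zeros_before_Suc ones_before_Suc)

lemma zeros_before_mono: "i \<le> j \<Longrightarrow> zeros_before A i \<le> zeros_before A j"
  unfolding zeros_before_def by (intro card_mono) auto

lemma ones_before_mono: "i \<le> j \<Longrightarrow> ones_before A i \<le> ones_before A j"
  unfolding ones_before_def by (intro card_mono) auto

lemma zeros_before_less: "i < j \<Longrightarrow> \<not> A ! i \<Longrightarrow> zeros_before A i < zeros_before A j"
  using zeros_before_mono[of "Suc i" j A] by (simp add: zeros_before_Suc)

lemma ones_before_less: "i < j \<Longrightarrow> A ! i \<Longrightarrow> ones_before A i < ones_before A j"
  using ones_before_mono[of "Suc i" j A] by (simp add: ones_before_Suc)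

lemma word_perm_less: "i < length A \<Longrightarrow> word_perm A i < length A"
  using zeros_before_less[of i "length A" A] zeros_before_mono[of i "length A" A]
    ones_before_less[of i "length A" A] zeros_ones_before[of A "length A"]
  by (auto simp: word_perm_def)

lemma word_perm_zero_less:
  "i < length A \<Longrightarrow> \<not> A ! i \<Longrightarrow> word_perm A i < zeros_before A (length A)"
  using zeros_before_less[of i "length A" A] by (auto simp: word_perm_def)

lemma word_perm_inj: "inj_on (word_perm A) {..<length A}"
proof (rule linorder_inj_onI')
  fix i j assume "i \<in> {..<length A}" "j \<in> {..<length A}" "i < j"
  then show "word_perm A i \<noteq> word_perm A j"
    using zeros_before_less[of i j A] ones_before_less[of i j A]
      word_perm_zero_less[of i A] word_perm_zero_less[of j A]
    by (auto simp: word_perm_def split: if_splits)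
qed

lemma lp_ok_word_lp: "lp_ok (word_lp A)"
  unfolding lp_ok_def word_lp_def bij_betw_def
  using word_perm_inj[of A] by (auto simp: word_perm_less endo_inj_surj image_subset_iff)

lemma lp_ok_words_lp: "lp_ok (words_lp ws)"
  by (rule lp_ok_lp_sum) (auto simp: lp_ok_word_lp)

text \<open>
  This is an isomorphism of \<open>L\<close> with the elements of \<open>A\<close> which remembers the positions, because
  exchanges happen at given positions.
\<close>

definition embeds :: "('a \<Rightarrow> nat) \<Rightarrow> 'a lp \<Rightarrow> bool list \<Rightarrow> bool" where
  "embeds f L A \<longleftrightarrow> bij_betw f (fst L) {..<length A} \<and>
     (\<forall>t\<in>fst L. A ! f t = fst (snd L) t \<and> f (snd (snd L) t) = word_perm A (f t))"

lemma embeds_iso: "embeds f L A \<Longrightarrow> L \<simeq> word_lp A"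
  unfolding embeds_def word_lp_def by (intro lp_isoI'[where f = f]) auto

text \<open>
  The sequence is recovered from any order in which elements preceded by a zero come first and which
  is otherwise the order of the predecessors: the rank of \<open>p t\<close> is then a count of zeros or ones in
  front of \<open>t\<close>, as in \<^const>\<open>word_perm\<close>.
\<close>

lemma embedsI:
  assumes ok: "lp_ok (T, d, p)"
    and f: "bij_betw f T {..<length A}" and lab: "\<And>t. t \<in> T \<Longrightarrow> A ! f t = d t"
    and same: "\<And>s t. s \<in> T \<Longrightarrow> t \<in> T \<Longrightarrow> d s = d t \<Longrightarrow> f s < f t \<Longrightarrow> f (p s) < f (p t)"
    and diff: "\<And>s t. s \<in> T \<Longrightarrow> t \<in> T \<Longrightarrow> \<not> d s \<Longrightarrow> d t \<Longrightarrow> f (p s) < f (p t)"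
  shows "embeds f (T, d, p) A"
  unfolding embeds_def fst_conv snd_conv
proof (intro conjI ballI)
  show "bij_betw f T {..<length A}" by (rule f)
  fix t assume t: "t \<in> T"
  have T: "finite T" and p: "bij_betw p T T" using ok by (auto simp: lp_ok_def)
  have pT: "p s \<in> T" if "s \<in> T" for s using p that bij_betwE by blast
  have fin: "f s < length A" if "s \<in> T" for s using f that bij_betwE by blast
  have fp: "bij_betw (f \<circ> p) T {..<length A}" using p f by (rule bij_betw_trans)
  have count: "card {s \<in> T. P (f s)} = card {k. k < length A \<and> P k}" for P
  proof (rule bij_betw_same_card)
    show "bij_betw f {s \<in> T. P (f s)} {k. k < length A \<and> P k}"
      using f by (auto simp: bij_betw_def inj_on_def image_iff)
  qed
  have below: "f (p t) = card {s \<in> T. f (p s) < f (p t)}" if "t \<in> T" for t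
  proof -
    have "bij_betw (f \<circ> p) {s \<in> T. f (p s) < f (p t)} {..<f (p t)}"
    proof (rule bij_betw_imageI)
      show "inj_on (f \<circ> p) {s \<in> T. f (p s) < f (p t)}"
        using fp by (auto simp: bij_betw_def inj_on_def)
      show "(f \<circ> p) ` {s \<in> T. f (p s) < f (p t)} = {..<f (p t)}"
      proof (intro equalityI subsetI)
        fix k assume k: "k \<in> {..<f (p t)}"
        then have "k \<in> {..<length A}" using fin[OF pT[OF that]] by auto
        then have "k \<in> (f \<circ> p) ` T" using bij_betw_imp_surj_on[OF fp] by simp
        then obtain s where "s \<in> T" "k = f (p s)" by auto
        then show "k \<in> (f \<circ> p) ` {s \<in> T. f (p s) < f (p t)}" using k by auto
      qed auto
    qed
    then show ?thesis using bij_betw_same_card by fastforce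
  qed
  have lt_same: "f (p s) < f (p t) \<longleftrightarrow> f s < f t" if "s \<in> T" "t \<in> T" "d s = d t" for s t
  proof (cases "f s" "f t" rule: linorder_cases)
    case less then show ?thesis using same that by simp
  next
    case equal
    then have "s = t" using f that by (auto simp: bij_betw_def inj_on_def)
    then show ?thesis by simp
  next
    case greater then show ?thesis using same[of t s] that by simp
  qed
  show "A ! f t = d t" using lab t .
  show "f (p t) = word_perm A (f t)"
  proof (cases "d t")
    case False
    have "{s \<in> T. f (p s) < f (p t)} = {s \<in> T. f s < f t \<and> \<not> A ! f s}"
      using False t lt_same diff[of t] lab by (auto simp: not_less_iff_gr_or_eq) (metis not_less_iff_gr_or_eq)+
    also have "card \<dots> = card {k. k < length A \<and> k < f t \<and> \<not> A ! k}" by (rule count)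
    also have "{k. k < length A \<and> k < f t \<and> \<not> A ! k} = {k. k < f t \<and> \<not> A ! k}"
      using fin[OF t] by auto
    finally show ?thesis using below[OF t] False lab[OF t] by (simp add: word_perm_def zeros_before_def)
  next
    case True
    have "{s \<in> T. f (p s) < f (p t)} = {s \<in> T. \<not> A ! f s} \<union> {s \<in> T. f s < f t \<and> A ! f s}"
      using True t lt_same diff lab by auto
    then have "f (p t) = card ({s \<in> T. \<not> A ! f s} \<union> {s \<in> T. f s < f t \<and> A ! f s})"
      using below[OF t] by simp
    also have "\<dots> = card {s \<in> T. \<not> A ! f s} + card {s \<in> T. f s < f t \<and> A ! f s}"
      using T by (intro card_Un_disjoint) auto
    also have "card {s \<in> T. f s < f t \<and> A ! f s} = card {k. k < length A \<and> k < f t \<and> A ! k}"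
      by (rule count)
    also have "{k. k < length A \<and> k < f t \<and> A ! k} = {k. k < f t \<and> A ! k}"
      using fin[OF t] by auto
    finally show ?thesis using True lab[OF t] count[of "\<lambda>k. \<not> A ! k"]
      by (simp add: word_perm_def zeros_before_def ones_before_def)
  qed
qed

lemma rank_bij:
  fixes lt :: "'a \<Rightarrow> 'a \<Rightarrow> bool"
  assumes "finite T" and irr: "\<And>s. \<not> lt s s"
    and tr: "\<And>s t u. lt s t \<Longrightarrow> lt t u \<Longrightarrow> lt s u"
    and tot: "\<And>s t. s \<in> T \<Longrightarrow> t \<in> T \<Longrightarrow> s \<noteq> t \<Longrightarrow> lt s t \<or> lt t s"
  defines "f \<equiv> \<lambda>t. card {s \<in> T. lt s t}"
  shows "bij_betw f T {..<card T}"
    and "\<And>s t. s \<in> T \<Longrightarrow> t \<in> T \<Longrightarrow> f s < f t \<longleftrightarrow> lt s t"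
proof -
  have mono: "f s < f t" if "s \<in> T" "lt s t" for s t
    unfolding f_def
  proof (rule psubset_card_mono)
    show "{u \<in> T. lt u s} \<subset> {u \<in> T. lt u t}"
      using that tr irr by blast
  qed (use assms in auto)
  show iff: "f s < f t \<longleftrightarrow> lt s t" if "s \<in> T" "t \<in> T" for s t
    using mono[of s t] mono[of t s] tot[of s t] that by (metis less_asym less_irrefl)
  have "inj_on f T"
    using tot mono by (intro inj_onI) (metis less_irrefl)
  moreover have "f ` T \<subseteq> {..<card T}"
  proof (intro image_subsetI)
    fix t assume t: "t \<in> T"
    have "{s \<in> T. lt s t} \<subset> T" using t irr by blast
    then show "f t \<in> {..<card T}" unfolding f_def using \<open>finite T\<close> by (simp add: psubset_card_mono)
  qed
  ultimately show "bij_betw f T {..<card T}"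
    by (simp add: bij_betw_def card_image card_subset_eq)
qed

text \<open>
  The binary digits of \<open>b t\<close> are the labels met on the way back from \<open>t\<close>, so that going forward shifts
  in one digit. The order of these numbers is the lexicographic order of the pasts.
\<close>

lemma past_value:
  assumes ok: "lp_ok (T, d, p)"
  obtains b :: "'a \<Rightarrow> real" where
    "\<And>t. 0 \<le> b t" "\<And>t. b t \<le> 1" "\<And>t. t \<in> T \<Longrightarrow> b (p t) = (of_bool (d t) + b t) / 2"
proof -
  have p: "bij_betw p T T" using ok by (simp add: lp_ok_def)
  define r where "r = inv_into T p"
  define a where "a t k = of_bool (d ((r ^^ Suc k) t)) * (1/2 :: real) ^ Suc k" for t k
  define b where "b t = suminf (a t)" for t
  have geo: "(\<lambda>k. (1/2 :: real) ^ Suc k) sums 1" using power_half_series by simp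
  have le: "a t k \<le> (1/2) ^ Suc k" "0 \<le> a t k" for t k by (auto simp: a_def)
  have sm: "summable (a t)" for t
    by (rule summable_comparison_test'[where g = "\<lambda>k. (1/2) ^ Suc k" and N = 0])
       (use le geo in \<open>auto simp: sums_iff\<close>)
  show ?thesis
  proof
    show "0 \<le> b t" for t unfolding b_def using sm le by (intro suminf_nonneg) auto
    show "b t \<le> 1" for t
      unfolding b_def using suminf_le[OF le(1) sm] geo by (auto simp: sums_iff)
    fix t assume t: "t \<in> T"
    have "r (p t) = t" using p t by (simp add: r_def bij_betw_inv_into_left)
    then have "(r ^^ Suc k) (p t) = (r ^^ k) t" for k by (simp add: funpow_swap1)
    then have eq: "a (p t) k = of_bool (d ((r ^^ k) t)) * (1/2) ^ Suc k" for k by (simp only: a_def)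
    have "b (p t) = a (p t) 0 + (\<Sum>k. a (p t) (Suc k))"
      unfolding b_def using suminf_split_head[OF sm, of "p t"] by simp
    also have "a (p t) 0 = of_bool (d t) / 2" by (simp add: eq)
    also have "(\<lambda>k. a (p t) (Suc k)) = (\<lambda>k. a t k / 2)" unfolding eq by (simp add: a_def)
    also have "(\<Sum>k. a t k / 2) = b t / 2" unfolding b_def using sm by (rule suminf_divide)
    finally show "b (p t) = (of_bool (d t) + b t) / 2" by simp
  qed
qed

text \<open>
  Every direct sum of standard modules is standard: sort the elements by their pasts. Elements with
  equal pasts also have equal futures; among them the order by summand and position within the summand
  is respected by the permutation.
\<close>

theorem words_lp_iso_exists: "\<exists>A. words_lp ws \<simeq> word_lp A"
proof -
  obtain T d p where L: "words_lp ws = (T, d, p)" by (cases "words_lp ws")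
  then have ok: "lp_ok (T, d, p)" using lp_ok_words_lp by metis
  then have T: "finite T" and p: "bij_betw p T T" by (auto simp: lp_ok_def)
  have pT: "p t \<in> T" if "t \<in> T" for t using p that bij_betwE by blast
  have comp: "d t = ws ! fst t ! snd t" "p t = (fst t, word_perm (ws ! fst t) (snd t))"
    "fst t < length ws" "snd t < length (ws ! fst t)" if "t \<in> T" for t
    using that L by (auto simp: lp_sum_def word_lp_def)
  obtain b where b: "\<And>t. 0 \<le> b t" "\<And>t. b t \<le> (1::real)"
    "\<And>t. t \<in> T \<Longrightarrow> b (p t) = (of_bool (d t) + b t) / 2"
    using past_value[OF ok] by blast
  \<comment> \<open>Past first, then summand, then position: the permutation respects each of these in turn.\<close>
  define lt where "lt s t \<longleftrightarrow> b s < b t \<or> b s = b t \<and> (fst s < fst t \<or> fst s = fst t \<and> snd s < snd t)"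
    for s t
  define f where "f t = card {s \<in> T. lt s t}" for t
  have lt: "\<not> lt s s" "lt s t \<Longrightarrow> lt t u \<Longrightarrow> lt s u" "s \<noteq> t \<Longrightarrow> lt s t \<or> lt t s" for s t u
    by (auto simp: lt_def prod_eq_iff)
  have bij: "bij_betw f T {..<card T}" and iff: "\<And>s t. s \<in> T \<Longrightarrow> t \<in> T \<Longrightarrow> f s < f t \<longleftrightarrow> lt s t"
    unfolding f_def using rank_bij[OF T, of lt] lt by blast+
  \<comment> \<open>An element with nothing but ones in its past is itself a one, because its orbit is a cycle.\<close>
  have one: "d t" if "t \<in> T" "b t = 1" for t
  proof -
    let ?M = "{t \<in> T. b t = 1}"
    have "?M \<subseteq> p ` ?M \<and> (\<forall>s\<in>T. p s \<in> ?M \<longrightarrow> d s)"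
    proof safe
      fix s assume s: "s \<in> T" "b s = 1"
      then have "s \<in> p ` T" using bij_betw_imp_surj_on[OF p] by simp
      then obtain u where u: "u \<in> T" "p u = s" by auto
      then have "b u = 1" using b(3)[OF u(1)] b(2)[of u] s by (cases "d u") auto
      then show "s \<in> p ` ?M" using u by blast
    next
      fix s assume s: "s \<in> T" "b (p s) = 1"
      then show "d s" using b(3)[OF s(1)] b(2)[of s] by (cases "d s") auto
    qed
    moreover have "p ` ?M = ?M"
    proof (rule card_subset_eq[symmetric])
      show "card ?M = card (p ` ?M)"
        using p by (intro card_image[symmetric]) (auto simp: bij_betw_def inj_on_def)
      show "?M \<subseteq> p ` ?M" using calculation by blast
    qed (use T in auto)
    ultimately show ?thesis using that by blast
  qed
  have "\<exists>A. length A = card T \<and> (\<forall>t\<in>T. A ! f t = d t)"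
  proof (intro exI conjI ballI)
    let ?A = "map (\<lambda>i. d (inv_into T f i)) [0..<card T]"
    show "length ?A = card T" by simp
    fix t assume t: "t \<in> T"
    then have "f t < card T" using bij bij_betwE by blast
    then show "?A ! f t = d t" using bij t by (simp add: bij_betw_inv_into_left)
  qed
  then obtain A where A: "length A = card T" "\<forall>t\<in>T. A ! f t = d t" by blast
  have "embeds f (T, d, p) A"
  proof (rule embedsI[OF ok])
    show "bij_betw f T {..<length A}" using bij A by simp
    show "A ! f t = d t" if "t \<in> T" for t using A that by blast
  next
    fix s t assume st: "s \<in> T" "t \<in> T" "d s = d t" "f s < f t"
    then have l: "lt s t" using iff by simp
    have "snd (p s) < snd (p t)" if "fst s = fst t" "snd s < snd t"
      using st that comp[OF st(1)] comp[OF st(2)]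
        zeros_before_less[of "snd s" "snd t" "ws ! fst t"] ones_before_less[of "snd s" "snd t" "ws ! fst t"]
      by (auto simp: word_perm_def)
    then have "lt (p s) (p t)"
      using l st(3) b(3)[OF st(1)] b(3)[OF st(2)] comp(2)[OF st(1)] comp(2)[OF st(2)]
      by (auto simp: lt_def)
    then show "f (p s) < f (p t)" using iff pT st by simp
  next
    fix s t assume st: "s \<in> T" "t \<in> T" "\<not> d s" "d t"
    have "b (p s) < b (p t)"
      using b(3)[OF st(1)] b(3)[OF st(2)] st b(2)[of s] b(1)[of t] one[OF st(1)]
      by (cases "b s = 1") auto
    then have "lt (p s) (p t)" by (simp add: lt_def)
    then show "f (p s) < f (p t)" using iff pT st by simp
  qed
  then show ?thesis using L embeds_iso by metis
qed

section \<open>Lifting, duality and chains of exchanges\<close>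

lemma words_lp_single: "words_lp [A] \<simeq> word_lp A" and words_lp_single': "word_lp A \<simeq> words_lp [A]"
proof -
  show "words_lp [A] \<simeq> word_lp A" unfolding word_lp_def lp_sum_def
    by (rule lp_isoI[where f = snd]) (auto simp: word_lp_def bij_betw_def inj_on_def image_iff)
  then show "word_lp A \<simeq> words_lp [A]" using lp_iso_sym lp_ok_words_lp by blast
qed

text \<open>
  The elements of the new sequence are the old ones and a copy of every zero, inserted behind it with
  label 1. It turns \<open>1\<^sup>a0\<^sup>b\<close> into \<open>1\<^bsup>a+b\<^esup>0\<^bsup>b\<^esup>\<close>, that is, it shears slopes.
\<close>

definition lift_word :: "bool list \<Rightarrow> bool list" where
  "lift_word A = replicate (zeros_before A (length A)) True @ A"

text \<open>
  This is the duality of modules, which exchanges the roles of \<open>F\<close> and \<open>V\<close>.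
\<close>

definition dual_word :: "bool list \<Rightarrow> bool list" where
  "dual_word A = rev (map Not A)"

definition lp_lift :: "'a lp \<Rightarrow> ('a \<times> bool) lp" where
  "lp_lift = (\<lambda>(T, d, p). ({(t, e). t \<in> T \<and> (e \<longrightarrow> \<not> d t)}, (\<lambda>(t, e). d t \<or> e),
      (\<lambda>(t, e). if e \<or> d t then (p t, False) else (t, True))))"

definition lp_dual :: "'a lp \<Rightarrow> 'a lp" where
  "lp_dual = (\<lambda>(T, d, p). (T, (\<lambda>t. \<not> d t), p))"

lemma lp_lift_iso: "L \<simeq> M \<Longrightarrow> lp_lift L \<simeq> lp_lift M"
proof -
  assume a: "L \<simeq> M"
  obtain T d p where L: "L = (T, d, p)" by (cases L)
  obtain T' d' p' where M: "M = (T', d', p')" by (cases M)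
  obtain f where f: "bij_betw f T T'" "\<And>t. t \<in> T \<Longrightarrow> d' (f t) = d t" "\<And>t. t \<in> T \<Longrightarrow> f (p t) = p' (f t)"
    using a unfolding L M by (rule lp_isoE) blast
  show ?thesis unfolding L M lp_lift_def prod.case
  proof (rule lp_isoI[where f = "map_prod f id"])
    show "bij_betw (map_prod f id) {(t, e). t \<in> T \<and> (e \<longrightarrow> \<not> d t)} {(t, e). t \<in> T' \<and> (e \<longrightarrow> \<not> d' t)}"
    proof (rule bij_betw_imageI)
      show "inj_on (map_prod f id) {(t, e). t \<in> T \<and> (e \<longrightarrow> \<not> d t)}"
        using bij_betw_imp_inj_on[OF f(1)] by (auto simp: inj_on_def)
      show "map_prod f id ` {(t, e). t \<in> T \<and> (e \<longrightarrow> \<not> d t)} = {(t, e). t \<in> T' \<and> (e \<longrightarrow> \<not> d' t)}"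
      proof (intro equalityI subsetI)
        fix z assume "z \<in> {(t, e). t \<in> T' \<and> (e \<longrightarrow> \<not> d' t)}"
        then obtain t e where z: "z = (t, e)" "t \<in> T'" "e \<longrightarrow> \<not> d' t" by auto
        then have "t \<in> f ` T" using bij_betw_imp_surj_on[OF f(1)] by simp
        then obtain s where "s \<in> T" "t = f s" by auto
        then show "z \<in> map_prod f id ` {(t, e). t \<in> T \<and> (e \<longrightarrow> \<not> d t)}"
          using z f(2) by (intro image_eqI[where x = "(s, e)"]) auto
      qed (use f(2) bij_betwE[OF f(1)] in auto)
    qed
  qed (use f in auto)
qed

lemma lp_ok_lift: "lp_ok L \<Longrightarrow> lp_ok (lp_lift L)"
proof -
  assume ok: "lp_ok L"
  obtain T d p where L: "L = (T, d, p)" by (cases L)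
  have T: "finite T" and p: "bij_betw p T T" using ok L by (auto simp: lp_ok_def)
  let ?T = "{(t, e). t \<in> T \<and> (e \<longrightarrow> \<not> d t)}"
  let ?p = "\<lambda>(t, e). if e \<or> d t then (p t, False) else (t, True)"
  have "finite ?T" by (rule finite_subset[of _ "T \<times> UNIV"]) (use T in auto)
  moreover have "inj_on ?p ?T" using bij_betw_imp_inj_on[OF p] by (auto simp: inj_on_def)
  moreover have "?p ` ?T \<subseteq> ?T" using bij_betwE[OF p] by (auto split: if_splits)
  ultimately show ?thesis unfolding L lp_lift_def lp_ok_def prod.case
    by (simp add: bij_betw_def endo_inj_surj)
qed

lemma lp_dual_iso: "L \<simeq> M \<Longrightarrow> lp_dual L \<simeq> lp_dual M"
  by (auto simp: lp_iso_def lp_dual_def split: prod.splits)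

lemma lift_word_perm:
  assumes "i < length A"
  shows "word_perm (lift_word A) (zeros_before A (length A) + i) =
     (if A ! i then zeros_before A (length A) + word_perm A i else word_perm A i)"
    and "k < zeros_before A (length A) \<Longrightarrow> word_perm (lift_word A) k = zeros_before A (length A) + k"
proof -
  let ?v = "zeros_before A (length A)"
  have nth: "lift_word A ! k = (if k < ?v then True else A ! (k - ?v))" if "k < ?v + length A" for k
    using that by (simp add: lift_word_def nth_append)
  have z: "zeros_before (lift_word A) (?v + j) = zeros_before A j" if "j \<le> length A" for j
  proof -
    have "bij_betw ((+) ?v) {k. k < j \<and> \<not> A ! k} {k. k < ?v + j \<and> \<not> lift_word A ! k}"
    proof (rule bij_betw_byWitness[where f' = "\<lambda>k. k - ?v"])
      show "(+) ?v ` {k. k < j \<and> \<not> A ! k} \<subseteq> {k. k < ?v + j \<and> \<not> lift_word A ! k}"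
        using that by (auto simp: nth)
      show "(\<lambda>k. k - ?v) ` {k. k < ?v + j \<and> \<not> lift_word A ! k} \<subseteq> {k. k < j \<and> \<not> A ! k}"
        using that by (auto simp: nth split: if_splits)
      show "\<forall>a'\<in>{k. k < ?v + j \<and> \<not> lift_word A ! k}. ?v + (a' - ?v) = a'"
        using that by (auto simp: nth split: if_splits)
    qed auto
    from bij_betw_same_card[OF this] show ?thesis by (simp add: zeros_before_def)
  qed
  have o: "ones_before (lift_word A) (?v + j) = ?v + ones_before A j" if "j \<le> length A" for j
    using zeros_ones_before[of "lift_word A" "?v + j"] zeros_ones_before[of A j] z[OF that] by simp
  have o': "ones_before (lift_word A) k = k" if "k \<le> ?v" for k
    using that by (induction k) (auto simp: ones_before_Suc nth)
  have len: "length (lift_word A) = ?v + length A" by (simp add: lift_word_def)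
  show "word_perm (lift_word A) (?v + i) = (if A ! i then ?v + word_perm A i else word_perm A i)"
    using assms nth[of "?v + i"] z[of i] o[of i] z[of "length A"] by (simp add: word_perm_def len)
  show "word_perm (lift_word A) k = ?v + k" if "k < ?v"
    using that nth[of k] o'[of k] z[of "length A"] by (simp add: word_perm_def len)
qed

text \<open>
  The inserted elements are preceded by zeros and all others by ones. Hence in the order by pasts the
  inserted ones form the initial block of ones, and the others keep their order.
\<close>

lemma lift_words_lp: "lp_lift (words_lp ws) \<simeq> words_lp (map lift_word ws)"
proof -
  let ?v = "\<lambda>j. zeros_before (ws ! j) (length (ws ! j))"
  let ?g = "\<lambda>((j, i), e). (j, if e then word_perm (ws ! j) i else ?v j + i)"
  let ?T = "{(t, e). t \<in> {(j, i). j < length ws \<and> i < length (ws ! j)} \<and> (e \<longrightarrow> \<not> ws ! fst t ! snd t)}"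
  let ?T' = "{(j, i). j < length ws \<and> i < length (lift_word (ws ! j))}"
  have zero: "word_perm A ` {i. i < length A \<and> \<not> A ! i} = {..<zeros_before A (length A)}" for A
  proof (rule card_subset_eq)
    show "word_perm A ` {i. i < length A \<and> \<not> A ! i} \<subseteq> {..<zeros_before A (length A)}"
      by (auto simp: word_perm_zero_less)
    have "inj_on (word_perm A) {i. i < length A \<and> \<not> A ! i}"
      by (rule inj_on_subset[OF word_perm_inj]) auto
    then show "card (word_perm A ` {i. i < length A \<and> \<not> A ! i}) = card {..<zeros_before A (length A)}"
      by (simp add: card_image zeros_before_def)
  qed auto
  have len: "length (lift_word A) = zeros_before A (length A) + length A" for A
    by (simp add: lift_word_def)
  have nthl: "lift_word A ! k = (if k < zeros_before A (length A) then True else A ! (k - zeros_before A (length A)))" for A k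
    by (simp add: lift_word_def nth_append)
  have "bij_betw ?g ?T ?T'"
  proof (rule bij_betw_imageI)
    show "inj_on ?g ?T"
    proof (rule inj_onI)
      fix s t assume st: "s \<in> ?T" "t \<in> ?T" "?g s = ?g t"
      obtain j i e where s: "s = ((j, i), e)" by (cases s) auto
      obtain k l e' where t: "t = ((k, l), e')" by (cases t) auto
      show "s = t"
        using st word_perm_zero_less[of i "ws ! j"] word_perm_zero_less[of l "ws ! k"] word_perm_inj[of "ws ! j"]
        unfolding s t by (auto simp: inj_on_def split: if_splits)
    qed
    show "?g ` ?T = ?T'"
    proof (intro equalityI subsetI)
      fix z assume "z \<in> ?g ` ?T"
      then show "z \<in> ?T'" using word_perm_less by (auto simp: len trans_less_add2)
    next
      fix z assume "z \<in> ?T'"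
      then obtain j k where z: "z = (j, k)" "j < length ws" "k < ?v j + length (ws ! j)" by (auto simp: len)
      show "z \<in> ?g ` ?T"
      proof (cases "k < ?v j")
        case True
        then have "k \<in> word_perm (ws ! j) ` {i. i < length (ws ! j) \<and> \<not> (ws ! j) ! i}" using zero by simp
        then obtain i where "i < length (ws ! j)" "\<not> ws ! j ! i" "k = word_perm (ws ! j) i" by auto
        then show ?thesis using z by (intro image_eqI[where x = "((j, i), True)"]) auto
      next
        case False
        then show ?thesis using z by (intro image_eqI[where x = "((j, k - ?v j), False)"]) auto
      qed
    qed
  qed
  moreover have "fst (lp_lift (words_lp ws)) = ?T" "fst (words_lp (map lift_word ws)) = ?T'"
    by (auto simp: lp_lift_def lp_sum_def word_lp_def)
  moreover have "fst (snd (words_lp (map lift_word ws))) (?g t) = fst (snd (lp_lift (words_lp ws))) t"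
    "?g (snd (snd (lp_lift (words_lp ws))) t) = snd (snd (words_lp (map lift_word ws))) (?g t)" if t: "t \<in> ?T" for t
  proof -
    obtain j i e where te: "t = ((j, i), e)" by (cases t) auto
    then have ji: "j < length ws" "i < length (ws ! j)" "e \<longrightarrow> \<not> ws ! j ! i" using t by auto
    show "fst (snd (words_lp (map lift_word ws))) (?g t) = fst (snd (lp_lift (words_lp ws))) t"
      using ji by (simp add: te lp_lift_def lp_sum_def word_lp_def nthl word_perm_zero_less)
    show "?g (snd (snd (lp_lift (words_lp ws))) t) = snd (snd (words_lp (map lift_word ws))) (?g t)"
      using ji by (simp add: te lp_lift_def lp_sum_def word_lp_def lift_word_perm word_perm_zero_less)
  qed
  ultimately show ?thesis
    by (intro lp_isoI'[where f = ?g]) simp_all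
qed

lemma dual_word_perm:
  assumes "i < length A"
  shows "word_perm (dual_word A) (length A - 1 - i) = length A - 1 - word_perm A i"
proof -
  let ?h = "length A"
  have nth: "dual_word A ! k = (\<not> A ! (?h - 1 - k))" if "k < ?h" for k
    using that by (simp add: dual_word_def rev_nth)
  have z: "zeros_before (dual_word A) (?h - j) + ones_before A j = ones_before A ?h" if "j \<le> ?h" for j
  proof -
    have "bij_betw (\<lambda>k. ?h - 1 - k) {k. k < ?h - j \<and> \<not> dual_word A ! k} {k. j \<le> k \<and> k < ?h \<and> A ! k}"
      by (rule bij_betw_byWitness[where f' = "\<lambda>k. ?h - 1 - k"]) (use that in \<open>auto simp: nth\<close>)
    then have "zeros_before (dual_word A) (?h - j) = card {k. j \<le> k \<and> k < ?h \<and> A ! k}"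
      by (simp add: zeros_before_def bij_betw_same_card)
    moreover have "{k. k < ?h \<and> A ! k} = {k. j \<le> k \<and> k < ?h \<and> A ! k} \<union> {k. k < j \<and> A ! k}"
      using that by auto
    then have "card {k. k < ?h \<and> A ! k} = card ({k. j \<le> k \<and> k < ?h \<and> A ! k} \<union> {k. k < j \<and> A ! k})"
      by (rule arg_cong)
    then have "ones_before A ?h = card {k. j \<le> k \<and> k < ?h \<and> A ! k} + card {k. k < j \<and> A ! k}"
      unfolding ones_before_def by (subst (asm) card_Un_disjoint) auto
    ultimately show ?thesis by (simp add: ones_before_def)
  qed
  have len: "length (dual_word A) = ?h" by (simp add: dual_word_def)
  have s: "?h - 1 - i = ?h - Suc i" by simp
  have n: "dual_word A ! (?h - Suc i) = (\<not> A ! i)" using nth[of "?h - Suc i"] assms by simp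
  have "zeros_before (dual_word A) ?h = ones_before A ?h" using z[of 0] by simp
  moreover have "zeros_before (dual_word A) (?h - Suc i) + ones_before A (Suc i) = ones_before A ?h"
    using z[of "Suc i"] assms by simp
  ultimately show ?thesis
    unfolding s using assms n zeros_ones_before[of A ?h] zeros_ones_before[of A "Suc i"]
      zeros_ones_before[of "dual_word A" "?h - Suc i"] zeros_before_mono[of "Suc i" ?h A]
    by (auto simp: word_perm_def len zeros_before_Suc ones_before_Suc)
qed

lemma dual_words_lp: "lp_dual (words_lp ws) \<simeq> words_lp (map dual_word ws)"
proof -
  let ?g = "\<lambda>(j, i). (j, length (ws ! j) - 1 - i)"
  have len: "length (dual_word A) = length A" for A by (simp add: dual_word_def)
  have "bij_betw ?g {(j, i). j < length ws \<and> i < length (ws ! j)} {(j, i). j < length ws \<and> i < length (ws ! j)}"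
    by (rule bij_betw_byWitness[where f' = ?g]) auto
  moreover have "fst (lp_dual (words_lp ws)) = {(j, i). j < length ws \<and> i < length (ws ! j)}"
    "fst (words_lp (map dual_word ws)) = {(j, i). j < length ws \<and> i < length (ws ! j)}"
    by (auto simp: lp_dual_def lp_sum_def word_lp_def len)
  moreover have "fst (snd (words_lp (map dual_word ws))) (?g t) = fst (snd (lp_dual (words_lp ws))) t"
    "?g (snd (snd (lp_dual (words_lp ws))) t) = snd (snd (words_lp (map dual_word ws))) (?g t)"
    if t: "t \<in> {(j, i). j < length ws \<and> i < length (ws ! j)}" for t
  proof -
    obtain j i where te: "t = (j, i)" by (cases t) auto
    then have ji: "j < length ws" "i < length (ws ! j)" using t by auto
    then show "fst (snd (words_lp (map dual_word ws))) (?g t) = fst (snd (lp_dual (words_lp ws))) t"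
      by (simp add: te lp_dual_def lp_sum_def word_lp_def dual_word_def rev_nth)
    show "?g (snd (snd (lp_dual (words_lp ws))) t) = snd (snd (words_lp (map dual_word ws))) (?g t)"
      using ji dual_word_perm[OF ji(2)] by (simp add: te lp_dual_def lp_sum_def word_lp_def)
  qed
  ultimately show ?thesis
    by (intro lp_isoI'[where f = ?g]) simp_all
qed

text \<open>
  The step defining the order on sequences, for lists of sequences that stand for their direct sums.
  Compatibility with further direct summands, with lifting and with duality is easily seen in this form.
\<close>

definition wstep :: "bool list list \<Rightarrow> bool list list \<Rightarrow> bool" where
  "wstep us ws \<longleftrightarrow> (\<exists>ps Q Q'. words_lp ws \<simeq> words_lp (ps @ [Q]) \<and> words_lp us \<simeq> words_lp (ps @ [Q']) \<and> exchange_01 Q Q')"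

text \<open>
  Only the first list is prescribed literally; the last one matters up to isomorphism.
\<close>

definition wsteps :: "nat \<Rightarrow> bool list list \<Rightarrow> bool list list \<Rightarrow> bool" where
  "wsteps k us ws \<longleftrightarrow> (\<exists>S. S 0 = us \<and> words_lp (S k) \<simeq> words_lp ws \<and> (\<forall>i<k. wstep (S i) (S (Suc i))))"

lemma words_lp_iso_sym: "words_lp us \<simeq> words_lp ws \<Longrightarrow> words_lp ws \<simeq> words_lp us"
  by (rule lp_iso_sym[OF lp_ok_words_lp])

lemma wstep_iso: "words_lp us' \<simeq> words_lp us \<Longrightarrow> wstep us ws \<Longrightarrow> words_lp ws' \<simeq> words_lp ws \<Longrightarrow> wstep us' ws'"
  unfolding wstep_def by (meson lp_iso_trans)

lemma wsteps_0: "words_lp us \<simeq> words_lp ws \<Longrightarrow> wsteps 0 us ws"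
  unfolding wsteps_def by auto

lemma wsteps_Suc: "wsteps k us ws \<Longrightarrow> wstep ws ws' \<Longrightarrow> wsteps (Suc k) us ws'"
proof -
  assume "wsteps k us ws" and w: "wstep ws ws'"
  then obtain S where S: "S 0 = us" "words_lp (S k) \<simeq> words_lp ws" "\<forall>i<k. wstep (S i) (S (Suc i))"
    by (auto simp: wsteps_def)
  have "wstep (S k) ws'" using wstep_iso[OF S(2) w lp_iso_refl] .
  then show ?thesis unfolding wsteps_def
    by (intro exI[where x = "S(Suc k := ws')"]) (use S in \<open>auto simp: less_Suc_eq lp_iso_refl\<close>)
qed

lemma wsteps_iso: "words_lp us' \<simeq> words_lp us \<Longrightarrow> wsteps k us ws \<Longrightarrow> words_lp ws \<simeq> words_lp ws' \<Longrightarrow> wsteps k us' ws'"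
proof (cases k)
  case 0
  assume "words_lp us' \<simeq> words_lp us" "wsteps k us ws" "words_lp ws \<simeq> words_lp ws'"
  then show ?thesis unfolding 0 wsteps_def by (auto intro: lp_iso_trans intro!: exI[where x = "\<lambda>_. us'"])
next
  case (Suc m)
  assume a: "words_lp us' \<simeq> words_lp us" "wsteps k us ws" "words_lp ws \<simeq> words_lp ws'"
  then obtain S where S: "S 0 = us" "words_lp (S k) \<simeq> words_lp ws" "\<forall>i<k. wstep (S i) (S (Suc i))"
    by (auto simp: wsteps_def)
  have "wstep us' (S 1)" using wstep_iso[OF a(1) _ lp_iso_refl] S Suc by auto
  then show ?thesis unfolding wsteps_def
    by (intro exI[where x = "S(0 := us')"]) (use S a Suc in \<open>auto intro: lp_iso_trans simp: nth_Cons'\<close>)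
qed

lemma wsteps_trans: "wsteps k us ws \<Longrightarrow> wsteps m ws zs \<Longrightarrow> wsteps (k + m) us zs"
proof (induction m arbitrary: zs)
  case 0
  then obtain S where "S 0 = ws" "words_lp (S 0) \<simeq> words_lp zs" by (auto simp: wsteps_def)
  then show ?case using wsteps_iso[OF lp_iso_refl 0(1)] by simp
next
  case (Suc m)
  then obtain S where S: "S 0 = ws" "words_lp (S (Suc m)) \<simeq> words_lp zs" "\<forall>i<Suc m. wstep (S i) (S (Suc i))"
    by (auto simp: wsteps_def)
  then have "wsteps m ws (S m)" unfolding wsteps_def by (auto intro!: exI[where x = S] lp_iso_refl)
  then have "wsteps (Suc (k + m)) us (S (Suc m))"
    using wsteps_Suc[OF Suc.IH[OF Suc.prems(1)]] S(3) by simp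
  then show ?case using wsteps_iso[OF lp_iso_refl _ S(2)] by simp
qed

lemma wsteps_map:
  assumes "\<And>us ws. wstep us ws \<Longrightarrow> wstep (f us) (f ws)"
    and "\<And>us ws. words_lp us \<simeq> words_lp ws \<Longrightarrow> words_lp (f us) \<simeq> words_lp (f ws)"
    and "wsteps k us ws"
  shows "wsteps k (f us) (f ws)"
proof -
  obtain S where S: "S 0 = us" "words_lp (S k) \<simeq> words_lp ws" "\<forall>i<k. wstep (S i) (S (Suc i))"
    using assms(3) by (auto simp: wsteps_def)
  then show ?thesis unfolding wsteps_def using assms by (intro exI[where x = "f \<circ> S"]) auto
qed

lemma words_lp_append: "words_lp us \<simeq> words_lp us' \<Longrightarrow> words_lp ws \<simeq> words_lp ws' \<Longrightarrow> words_lp (us @ ws) \<simeq> words_lp (us' @ ws')"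
  using lp_sum_append by simp

lemma wsteps_append: "wsteps k us ws \<Longrightarrow> wsteps k (ps @ us) (ps @ ws)"
proof (rule wsteps_map[where f = "(@) ps"])
  fix us ws assume "wstep us ws"
  then obtain qs Q Q' where "words_lp ws \<simeq> words_lp (qs @ [Q])" "words_lp us \<simeq> words_lp (qs @ [Q'])" "exchange_01 Q Q'"
    by (auto simp: wstep_def)
  moreover from this have "words_lp (ps @ ws) \<simeq> words_lp (ps @ (qs @ [Q]))" "words_lp (ps @ us) \<simeq> words_lp (ps @ (qs @ [Q']))"
    by (blast intro: words_lp_append[OF lp_iso_refl])+
  then have "words_lp (ps @ ws) \<simeq> words_lp ((ps @ qs) @ [Q])" "words_lp (ps @ us) \<simeq> words_lp ((ps @ qs) @ [Q'])"
    by simp_all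
  ultimately show "wstep (ps @ us) (ps @ ws)" unfolding wstep_def by blast
qed (auto intro: words_lp_append lp_iso_refl simp del: map_append)

lemma words_lp_lift: "words_lp us \<simeq> words_lp ws \<Longrightarrow> words_lp (map lift_word us) \<simeq> words_lp (map lift_word ws)"
proof -
  assume a: "words_lp us \<simeq> words_lp ws"
  have "words_lp (map lift_word us) \<simeq> lp_lift (words_lp us)"
  proof (rule lp_iso_sym[OF _ lift_words_lp])
    show "lp_ok (lp_lift (words_lp us))"
      using lp_ok_lift lp_ok_words_lp by blast
  qed
  from lp_iso_trans[OF this lp_iso_trans[OF lp_lift_iso[OF a] lift_words_lp]] show ?thesis .
qed

lemma words_lp_dual: "words_lp us \<simeq> words_lp ws \<Longrightarrow> words_lp (map dual_word us) \<simeq> words_lp (map dual_word ws)"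
proof -
  assume a: "words_lp us \<simeq> words_lp ws"
  have "words_lp (map dual_word us) \<simeq> lp_dual (words_lp us)"
  proof (rule lp_iso_sym[OF _ dual_words_lp])
    show "lp_ok (lp_dual (words_lp us))"
      using lp_ok_words_lp[of us] by (auto simp: lp_ok_def lp_dual_def split: prod.splits)
  qed
  from lp_iso_trans[OF this lp_iso_trans[OF lp_dual_iso[OF a] dual_words_lp]] show ?thesis .
qed

lemma exchange_lift: "exchange_01 Q Q' \<Longrightarrow> exchange_01 (lift_word Q) (lift_word Q')"
proof -
  assume "exchange_01 Q Q'"
  then obtain xs ys where q: "Q = xs @ [False, True] @ ys" "Q' = xs @ [True, False] @ ys"
    by (auto simp: exchange_01_def)
  have z: "zeros_before A (length A) = length (filter Not A)" for A
    by (simp add: zeros_before_def length_filter_conv_card)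
  have "zeros_before Q (length Q) = zeros_before Q' (length Q')" unfolding z by (simp add: q)
  then show ?thesis unfolding exchange_01_def lift_word_def using q
    by (intro exI[where x = "replicate (zeros_before Q (length Q)) True @ xs"] exI[where x = ys]) simp
qed

lemma exchange_dual: "exchange_01 Q Q' \<Longrightarrow> exchange_01 (dual_word Q) (dual_word Q')"
proof -
  assume "exchange_01 Q Q'"
  then obtain xs ys where q: "Q = xs @ [False, True] @ ys" "Q' = xs @ [True, False] @ ys"
    by (auto simp: exchange_01_def)
  show ?thesis unfolding exchange_01_def dual_word_def using q
    by (intro exI[where x = "rev (map Not ys)"] exI[where x = "rev (map Not xs)"]) simp
qed

lemma wsteps_lift: "wsteps k us ws \<Longrightarrow> wsteps k (map lift_word us) (map lift_word ws)"
proof (rule wsteps_map[OF _ words_lp_lift])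
  fix us ws assume "wstep us ws"
  then obtain ps Q Q' where "words_lp ws \<simeq> words_lp (ps @ [Q])" "words_lp us \<simeq> words_lp (ps @ [Q'])" "exchange_01 Q Q'"
    by (auto simp: wstep_def)
  from words_lp_lift[OF this(1)] words_lp_lift[OF this(2)] exchange_lift[OF this(3)]
  show "wstep (map lift_word us) (map lift_word ws)" unfolding wstep_def
    by (intro exI[where x = "map lift_word ps"] exI[where x = "lift_word Q"] exI[where x = "lift_word Q'"]) simp
qed

lemma wsteps_dual: "wsteps k us ws \<Longrightarrow> wsteps k (map dual_word us) (map dual_word ws)"
proof (rule wsteps_map[OF _ words_lp_dual])
  fix us ws assume "wstep us ws"
  then obtain ps Q Q' where "words_lp ws \<simeq> words_lp (ps @ [Q])" "words_lp us \<simeq> words_lp (ps @ [Q'])" "exchange_01 Q Q'"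
    by (auto simp: wstep_def)
  from words_lp_dual[OF this(1)] words_lp_dual[OF this(2)] exchange_dual[OF this(3)]
  show "wstep (map dual_word us) (map dual_word ws)" unfolding wstep_def
    by (intro exI[where x = "map dual_word ps"] exI[where x = "dual_word Q"] exI[where x = "dual_word Q'"]) simp
qed

section \<open>Christoffel words\<close>

lemma length_minimal_seq [simp]: "length (minimal_seq (a, b)) = a + b"
  by (simp add: minimal_seq_def)

lemma nth_minimal_seq: "i < a + b \<Longrightarrow> minimal_seq (a, b) ! i \<longleftrightarrow> i < a"
  by (auto simp: minimal_seq_def nth_append)

lemma zeros_before_minimal_seq: "i \<le> a + b \<Longrightarrow> zeros_before (minimal_seq (a, b)) i = i - a"
  by (induction i) (auto simp: zeros_before_Suc nth_minimal_seq)

lemma word_perm_minimal_seq: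
  assumes "i < a + b"
  shows "word_perm (minimal_seq (a, b)) i = (if i < a then i + b else i - a)"
  using assms zeros_before_minimal_seq[of i a b] zeros_before_minimal_seq[of "a + b" a b]
    zeros_ones_before[of "minimal_seq (a, b)" i]
  by (auto simp: word_perm_def nth_minimal_seq)

text \<open>
  The elements are the gaps between consecutive letters of a cyclic word; the label of a gap is the
  letter that follows it.
\<close>

definition cyclic_lp :: "bool list \<Rightarrow> nat lp" where
  "cyclic_lp w = ({..<length w}, (!) w, (\<lambda>i. if Suc i = length w then 0 else Suc i))"

lemma lp_ok_cyclic_lp: "lp_ok (cyclic_lp w)"
proof -
  let ?p = "\<lambda>i. if Suc i = length w then 0 else Suc i"
  have inj: "inj_on ?p {..<length w}" by (auto simp: inj_on_def)
  have "?p ` {..<length w} \<subseteq> {..<length w}" by auto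
  from endo_inj_surj[OF _ this inj] show ?thesis
    using inj unfolding lp_ok_def cyclic_lp_def prod.case bij_betw_def by blast
qed

text \<open>
  The labels along the orbit of \<open>i\<close> in \<open>1\<^sup>a0\<^sup>b\<close>, where the permutation is the rotation by \<open>b\<close>
  modulo \<open>a + b\<close>. For \<open>i = 0\<close> this is the Christoffel word of \<open>(a, b)\<close>.
\<close>

definition chris :: "nat \<times> nat \<Rightarrow> nat \<Rightarrow> bool list" where
  "chris = (\<lambda>(a, b) i. map (\<lambda>t. (i + t * b) mod (a + b) < a) [0..<a + b])"

lemma length_chris [simp]: "length (chris (a, b) i) = a + b"
  by (simp add: chris_def)

lemma nth_chris: "t < a + b \<Longrightarrow> chris (a, b) i ! t \<longleftrightarrow> (i + t * b) mod (a + b) < a"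
  by (simp add: chris_def)

lemma chris_embed:
  assumes co: "coprime a b" and i: "i < a + b"
  shows "embeds (\<lambda>t. (i + t * b) mod (a + b)) (cyclic_lp (chris (a, b) i)) (minimal_seq (a, b))"
proof -
  let ?h = "a + b" let ?f = "\<lambda>t. (i + t * b) mod ?h"
  have co': "coprime b ?h" using co by (simp add: coprime_iff_gcd_eq_1 gcd.commute[of b])
  have fl: "?f t < ?h" for t by (rule mod_less_divisor) (use i in linarith)
  have "inj_on ?f {..<?h}"
  proof (rule linorder_inj_onI')
    fix s t assume st: "s \<in> {..<?h}" "t \<in> {..<?h}" "s < t"
    show "?f s \<noteq> ?f t"
    proof
      assume "?f s = ?f t"
      then have "?h dvd (i + t * b) - (i + s * b)"
        using st by (intro mod_eq_dvd_iff_nat[THEN iffD1]) auto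
      then have "?h dvd (t - s) * b" by (simp add: diff_mult_distrib)
      then have "?h dvd t - s" using co' by (simp add: coprime_dvd_mult_left_iff coprime_commute)
      then show False using st by (auto dest!: dvd_imp_le)
    qed
  qed
  moreover have "?f ` {..<?h} \<subseteq> {..<?h}" using fl by auto
  ultimately have bij: "bij_betw ?f {..<?h} {..<?h}"
    by (simp add: bij_betw_def endo_inj_surj)
  have wrap: "(r + b) mod ?h = (if r < a then r + b else r - a)" if "r < ?h" for r
    using that le_mod_geq[of ?h "r + b"] by (cases "r < a") (auto simp: not_less)
  have step: "(i + Suc t * b) mod ?h = (if ?f t < a then ?f t + b else ?f t - a)" for t
  proof -
    have "(i + Suc t * b) mod ?h = (?f t + b) mod ?h" by (simp add: mod_simps add_ac)
    then show ?thesis using wrap[OF fl[of t]] by simp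
  qed
  have last: "(i + ?h * b) mod ?h = i" using i by simp
  show ?thesis unfolding embeds_def cyclic_lp_def fst_conv snd_conv
  proof (intro conjI ballI)
    show "bij_betw ?f {..<length (chris (a, b) i)} {..<length (minimal_seq (a, b))}" using bij by simp
    fix t assume t: "t \<in> {..<length (chris (a, b) i)}"
    show "minimal_seq (a, b) ! ?f t = chris (a, b) i ! t"
      using t fl[of t] by (simp add: nth_minimal_seq nth_chris)
    have w: "word_perm (minimal_seq (a, b)) (?f t) = (i + Suc t * b) mod ?h"
      using fl[of t] step[of t] by (subst word_perm_minimal_seq) auto
    show "?f (if Suc t = length (chris (a, b) i) then 0 else Suc t) = word_perm (minimal_seq (a, b)) (?f t)"
      unfolding w using last i by (cases "Suc t = ?h") auto
  qed
qed

text \<open>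
  The standard factorization. A letter records whether the integer part of \<open>t b / (a + b)\<close> jumps, and
  because the determinant is 1 there is no integer between the multiples of the slope of the sum and
  those of the slope of either factor, as long as \<open>t\<close> stays within that factor.
\<close>

lemma chris_factor_0:
  assumes det: "a1 * b2 = a2 * b1 + (1::nat)"
  shows "chris (a1 + a2, b1 + b2) 0 = chris (a1, b1) 0 @ chris (a2, b2) 0"
proof (rule nth_equalityI)
  let ?a = "a1 + a2" let ?b = "b1 + b2" let ?h = "a1 + a2 + (b1 + b2)"
  let ?h1 = "a1 + b1" let ?h2 = "a2 + b2"
  show "length (chris (?a, ?b) 0) = length (chris (a1, b1) 0 @ chris (a2, b2) 0)" by simp
  fix t assume "t < length (chris (?a, ?b) 0)"
  then have t: "t < ?h" by simp
  have a1: "a1 > 0" and b2: "b2 > 0" using det by (auto intro: gr0I)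
  have det': "int a1 * int b2 = int a2 * int b1 + 1" using arg_cong[OF det, of int] by simp
  \<comment> \<open>The two factors have slopes just below and just above the slope of the sum.\<close>
  have h1b: "int ?h1 * int ?b = int b1 * int ?h + 1" and h1a: "int ?h * int a1 = int ?h1 * int ?a + 1"
    and h2b: "int ?h2 * int ?b = int b2 * int ?h - 1" and h2a: "int ?h * int a2 = int ?h2 * int ?a - 1"
    using det' by (simp_all add: algebra_simps)
  have key: "(T mod ?h < ?a) = (q < ?a)" if "int T = int k * int ?h + int q" "q < ?h" for T k q
  proof -
    have "T = k * ?h + q" using that(1) by (metis of_nat_add of_nat_eq_iff of_nat_mult)
    then show ?thesis using that(2) by simp
  qed
  show "chris (?a, ?b) 0 ! t = (chris (a1, b1) 0 @ chris (a2, b2) 0) ! t"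
  proof (cases "t < ?h1")
    case True
    define k r where "k = t * b1 div ?h1" and "r = t * b1 mod ?h1"
    have "t * b1 = k * ?h1 + r" unfolding k_def r_def by (rule div_mult_mod_eq[symmetric])
    then have kr: "int t * int b1 = int k * int ?h1 + int r" by (metis of_nat_add of_nat_mult)
    have r: "r < ?h1" unfolding r_def using a1 by simp
    \<comment> \<open>This is the residue of \<open>t b\<close>: the quotient \<open>k\<close> is the same as for the first factor.\<close>
    define q where "q = int t * int ?b - int k * int ?h"
    have "int ?h1 * q = int t * (int ?h1 * int ?b) - int k * int ?h1 * int ?h"
      by (simp only: q_def algebra_simps)
    also have "\<dots> = int ?h * (int t * int b1 - int k * int ?h1) + int t" unfolding h1b by (simp add: algebra_simps)
    also have "\<dots> = int ?h * int r + int t" unfolding kr by simp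
    finally have q: "int ?h1 * q = int ?h * int r + int t" .
    have "int ?h1 * q \<ge> 0" unfolding q by simp
    then have q0: "q \<ge> 0" using a1 by (simp add: zero_le_mult_iff)
    have "int ?h * int r \<le> int ?h * (int ?h1 - 1)" using r by (intro mult_left_mono) auto
    then have "int ?h1 * q < int ?h1 * int ?h" using q True b2 by (simp add: algebra_simps)
    then have qh: "q < int ?h" using a1 by (simp add: mult_less_cancel_left)
    have lt: "q < int ?a \<longleftrightarrow> r < a1"
    proof (cases "r < a1")
      case True
      have "int ?h * int r \<le> int ?h * (int a1 - 1)" using True by (intro mult_left_mono) auto
      then have "int ?h1 * q < int ?h1 * int ?a" using q \<open>t < ?h1\<close> h1a b2 by (simp add: algebra_simps)
      then show ?thesis using True a1 by (simp add: mult_less_cancel_left)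
    next
      case False
      have "int ?h * int r \<ge> int ?h * int a1" using False by (intro mult_left_mono) auto
      then have "int ?h1 * q > int ?h1 * int ?a" using q h1a by (simp add: algebra_simps)
      then show ?thesis using False a1 by (simp add: mult_less_cancel_left)
    qed
    have "int (t * ?b) = int k * int ?h + int (nat q)" using q0 by (simp add: q_def algebra_simps)
    then have "(t * ?b mod ?h < ?a) = (nat q < ?a)" by (rule key) (use qh q0 in auto)
    also have "\<dots> = (r < a1)" using lt q0 by auto
    finally show ?thesis using True t by (simp add: nth_append nth_chris r_def)
  next
    case False
    define s where "s = t - ?h1"
    have ts: "t = ?h1 + s" "s < ?h2" using False t by (auto simp: s_def)
    define k r where "k = s * b2 div ?h2" and "r = s * b2 mod ?h2"
    have "s * b2 = k * ?h2 + r" unfolding k_def r_def by (rule div_mult_mod_eq[symmetric])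
    then have kr: "int s * int b2 = int k * int ?h2 + int r" by (metis of_nat_add of_nat_mult)
    have r: "r < ?h2" unfolding r_def using b2 by simp
    \<comment> \<open>The residue again; the summand 1 is contributed by the first factor.\<close>
    define q where "q = int s * int ?b - int k * int ?h + 1"
    have "int ?h2 * q = int s * (int ?h2 * int ?b) - int k * int ?h2 * int ?h + int ?h2"
      by (simp only: q_def algebra_simps mult_1)
    also have "\<dots> = int ?h * (int s * int b2 - int k * int ?h2) - int s + int ?h2" unfolding h2b by (simp add: algebra_simps)
    also have "\<dots> = int ?h * int r - int s + int ?h2" unfolding kr by simp
    finally have q: "int ?h2 * q = int ?h * int r - int s + int ?h2" .
    have "0 \<le> int ?h * int r" by simp
    then have "int ?h2 * q \<ge> 0" unfolding q using ts(2) by linarith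
    then have q0: "q \<ge> 0" using b2 by (simp add: zero_le_mult_iff)
    have "int ?h * int r \<le> int ?h * (int ?h2 - 1)" using r by (intro mult_left_mono) auto
    then have "int ?h2 * q < int ?h2 * int ?h" using q a1 by (simp add: algebra_simps)
    then have qh: "q < int ?h" using b2 by (simp add: mult_less_cancel_left)
    have lt: "q < int ?a \<longleftrightarrow> r < a2"
    proof (cases "r < a2")
      case True
      have "int ?h * int r \<le> int ?h * (int a2 - 1)" using True by (intro mult_left_mono) auto
      then have "int ?h2 * q < int ?h2 * int ?a" using q h2a a1 by (simp add: algebra_simps)
      then show ?thesis using True b2 by (simp add: mult_less_cancel_left)
    next
      case False
      have "int ?h * int r \<ge> int ?h * int a2" using False by (intro mult_left_mono) auto
      then have "int ?h2 * q \<ge> int ?h2 * int ?a" using q h2a ts by (simp add: algebra_simps)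
      then show ?thesis using False b2 by (simp add: mult_le_cancel_left)
    qed
    have "int (t * ?b) = int (b1 + k) * int ?h + int (nat q)"
      using q0 h1b ts by (simp add: q_def algebra_simps)
    then have "(t * ?b mod ?h < ?a) = (nat q < ?a)" by (rule key) (use qh q0 in auto)
    also have "\<dots> = (r < a2)" using lt q0 by auto
    finally show ?thesis using False t ts by (simp add: nth_append nth_chris r_def)
  qed
qed

lemma chris_rotate: "chris (a, b) b = rotate1 (chris (a, b) 0)"
proof (rule nth_equalityI)
  fix t assume "t < length (chris (a, b) b)"
  then have t: "t < a + b" by simp
  have "rotate1 (chris (a, b) 0) ! t = chris (a, b) 0 ! (Suc t mod (a + b))"
    using t nth_rotate1[of t "chris (a, b) 0"] by simp
  also have "\<dots> \<longleftrightarrow> ((Suc t mod (a + b)) * b) mod (a + b) < a" using t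
    by (subst nth_chris) (auto intro: mod_less_divisor)
  also have "((Suc t mod (a + b)) * b) mod (a + b) = (b + t * b) mod (a + b)"
    by (simp only: mod_mult_left_eq mult_Suc)
  finally show "chris (a, b) b ! t = rotate1 (chris (a, b) 0) ! t" using t by (simp add: nth_chris)
qed simp

text \<open>
  Both factors and the product start with a one, so that moving this letter to the end turns the
  standard factorization into a factorization of the rotated words.
\<close>

lemma chris_factor:
  assumes det: "a1 * b2 = a2 * b1 + (1::nat)" and a2: "0 < a2"
  shows "chris (a1 + a2, b1 + b2) (b1 + b2) = chris (a1, b1) b1 @ chris (a2, b2) b2"
proof -
  have a1: "a1 > 0" using det by (auto intro: gr0I)
  have "\<exists>w. chris (a, b) 0 = True # w" if "a > 0" for a b
    using that by (cases "chris (a, b) 0") (auto simp: chris_def upt_rec)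
  then obtain v w where vw: "chris (a1, b1) 0 = True # v" "chris (a2, b2) 0 = True # w" using a1 a2 by metis
  show ?thesis unfolding chris_rotate chris_factor_0[OF det] vw by simp
qed

section \<open>Exchanges of neighbouring elements\<close>

lemma exchange_update:
  assumes "Suc q < length W" "\<not> W ! q" "W ! Suc q"
  shows "exchange_01 W (W[q := True, Suc q := False])"
proof -
  have i: "Suc (Suc (i - 2)) = i" if "q \<le> i" "i \<noteq> q" "i \<noteq> Suc q" for i
    using that by simp
  have "W = take q W @ [False, True] @ drop (q + 2) W"
    by (rule nth_equalityI) (use assms in \<open>auto simp: nth_append nth_Cons' not_less le_Suc_eq i\<close>)
  moreover have "W[q := True, Suc q := False] = take q W @ [True, False] @ drop (q + 2) W"
    by (rule nth_equalityI) (use assms in \<open>auto simp: nth_append nth_Cons' nth_list_update not_less i\<close>)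
  ultimately show ?thesis unfolding exchange_01_def by blast
qed

text \<open>
  Exchanging the labels of neighbouring elements keeps the order of all elements and exchanges the
  futures of the two, that is, it composes the permutation with a transposition.
\<close>

lemma embeds_swap:
  assumes emb: "embeds f (T, d, p) W" and xy: "x \<in> T" "y \<in> T" "f y = Suc (f x)"
    and lab: "\<not> d x" "d y"
  shows "embeds f (T, d(x := True, y := False), p(x := p y, y := p x)) (W[f x := True, f y := False])"
proof -
  let ?q = "f x" let ?W = "W[f x := True, f y := False]"
  have bij: "bij_betw f T {..<length W}" and W: "\<And>t. t \<in> T \<Longrightarrow> W ! f t = d t \<and> f (p t) = word_perm W (f t)"
    using emb by (auto simp: embeds_def)
  have inj: "f s = f t \<longleftrightarrow> s = t" if "s \<in> T" "t \<in> T" for s t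
    using bij_betw_imp_inj_on[OF bij] that by (auto simp: inj_on_def)
  have lt: "f t < length W" if "t \<in> T" for t using bij_betwE[OF bij] that by auto
  have q: "Suc ?q < length W" using lt[OF xy(2)] xy(3) by simp
  have Wq: "\<not> W ! ?q" "W ! Suc ?q" using W[OF xy(1)] W[OF xy(2)] lab xy(3) by auto
  have nth: "?W ! k = (if k = ?q then True else if k = Suc ?q then False else W ! k)" for k
    using q xy(3) by (auto simp: nth_list_update)
  have z1: "zeros_before ?W k = zeros_before W k" if "k \<le> ?q" for k
    using that by (induction k) (auto simp: zeros_before_Suc nth)
  have z2: "zeros_before ?W (Suc (Suc ?q) + k) = zeros_before W (Suc (Suc ?q) + k)" for k
    using z1[of ?q] Wq by (induction k) (auto simp: zeros_before_Suc nth)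
  have z3: "zeros_before ?W (Suc ?q) = zeros_before W ?q" using z1[of ?q] by (simp add: zeros_before_Suc nth)
  have z: "zeros_before ?W k = zeros_before W k" if "k \<noteq> Suc ?q" for k
  proof (cases "k \<le> ?q")
    case False
    then have "Suc (Suc ?q) + (k - Suc (Suc ?q)) = k" using that by simp
    with z2[of "k - Suc (Suc ?q)"] show ?thesis by (simp only:)
  qed (rule z1)
  have o: "ones_before ?W k = ones_before W k" if "k \<noteq> Suc ?q" for k
    using z[OF that] zeros_ones_before[of W k] zeros_ones_before[of ?W k] by simp
  have len: "length ?W \<noteq> Suc ?q" using q by simp
  have p1: "word_perm ?W ?q = word_perm W (Suc ?q)"
    using z[OF len] o[of ?q] Wq by (simp add: word_perm_def nth ones_before_Suc)
  have p2: "word_perm ?W (Suc ?q) = word_perm W ?q"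
    using z3 Wq by (simp add: word_perm_def nth)
  have p3: "word_perm ?W k = word_perm W k" if "k \<noteq> ?q" "k \<noteq> Suc ?q" for k
    using z[OF len] z[OF that(2)] o[OF that(2)] that by (simp add: word_perm_def nth)
  have ne: "x \<noteq> y" using xy(3) by auto
  show ?thesis unfolding embeds_def fst_conv snd_conv
  proof (intro conjI ballI)
    show "bij_betw f T {..<length ?W}" using bij by simp
    fix t assume t: "t \<in> T"
    show "?W ! f t = (d(x := True, y := False)) t"
      using W[OF t] inj[OF t xy(1)] inj[OF t xy(2)] xy(3) ne unfolding nth by auto
    show "f ((p(x := p y, y := p x)) t) = word_perm ?W (f t)"
      using W[OF t] W[OF xy(1)] W[OF xy(2)] inj[OF t xy(1)] inj[OF t xy(2)] xy(3) ne p1 p2 p3[of "f t"] by auto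
  qed
qed

text \<open>
  If the two elements lie on different cycles, these merge: after the exchange the past of either
  element continues with the future of the other one.
\<close>

lemma embeds_merge:
  assumes emb: "embeds f (lp_sum [cyclic_lp u, cyclic_lp v]) W"
    and u: "u \<noteq> []" "u ! 0" and v: "v \<noteq> []" "\<not> v ! 0"
    and adj: "f (0, 0) = Suc (f (1, 0))"
  shows "cyclic_lp (u @ v) \<simeq> word_lp (W[f (1, 0) := True, f (0, 0) := False])"
proof -
  obtain T d p where L: "lp_sum [cyclic_lp u, cyclic_lp v] = (T, d, p)" by (cases "lp_sum [cyclic_lp u, cyclic_lp v]")
  have T: "T = {(j, i). j = 0 \<and> i < length u \<or> j = 1 \<and> i < length v}"
    using arg_cong[OF L, of fst] by (auto simp: lp_sum_def cyclic_lp_def less_Suc_eq nth_Cons')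
  have d: "d (0, i) = u ! i" "d (Suc 0, i) = v ! i" for i
    using arg_cong[OF L, of "\<lambda>L. fst (snd L)"] by (auto simp: lp_sum_def cyclic_lp_def)
  have p: "p (0, i) = (0, if Suc i = length u then 0 else Suc i)" "p (Suc 0, i) = (Suc 0, if Suc i = length v then 0 else Suc i)" for i
    using arg_cong[OF L, of "\<lambda>L. snd (snd L)"] by (auto simp: lp_sum_def cyclic_lp_def)
  have x: "(1, 0) \<in> T" "(0, 0) \<in> T" using u v by (auto simp: T)
  have "embeds f (T, d((1, 0) := True, (0, 0) := False), p((1, 0) := p (0, 0), (0, 0) := p (1, 0)))
    (W[f (1, 0) := True, f (0, 0) := False])"
    by (rule embeds_swap[OF emb[unfolded L] x adj]) (use u v d in auto)
  then have 1: "(T, d((1, 0) := True, (0, 0) := False), p((1, 0) := p (0, 0), (0, 0) := p (1, 0)))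
    \<simeq> word_lp (W[f (1, 0) := True, f (0, 0) := False])" by (rule embeds_iso)
  let ?g = "\<lambda>s. if s = 0 then (1, 0) else if s < length u then (0, s) else if s = length u then (0, 0) else (1, s - length u)"
  have "cyclic_lp (u @ v) \<simeq> (T, d((1, 0) := True, (0, 0) := False), p((1, 0) := p (0, 0), (0, 0) := p (1, 0)))"
    unfolding cyclic_lp_def
  proof (rule lp_isoI[where f = ?g])
    show "bij_betw ?g {..<length (u @ v)} T"
      by (rule bij_betw_byWitness[where f' = "\<lambda>(j :: nat, i). if j = 0 then (if i = 0 then length u else i) else if i = 0 then 0 else length u + i"])
         (use u v in \<open>auto simp: T split: if_splits\<close>)
    fix s assume s: "s \<in> {..<length (u @ v)}"
    show "(d((1, 0) := True, (0, 0) := False)) (?g s) = (u @ v) ! s"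
      using s u v by (auto simp: d nth_append)
    show "?g (if Suc s = length (u @ v) then 0 else Suc s) = (p((1, 0) := p (0, 0), (0, 0) := p (1, 0))) (?g s)"
    proof -
      have pos: "0 < length u" "0 < length v" using u v by auto
      consider (a) "s = 0" | (b) "0 < s" "s < length u" | (c) "s = length u" | (d) i where "s = length u + i" "0 < i" "i < length v"
        using s pos by (metis add.right_neutral gr0I lessThan_iff length_append less_imp_add_positive linorder_neqE_nat nat_add_left_cancel_less)
      moreover obtain m n where "length u = Suc m" "length v = Suc n" using u(1) v(1) by (metis length_Suc_conv neq_Nil_conv)
      ultimately show ?thesis by cases (auto simp: p)
    qed
  qed
  then show ?thesis using 1 by (rule lp_iso_trans)
qed

text \<open>
  If the two elements lie on the same cycle, this splits. Here the element \<open>(0, 0)\<close>, which has just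
  been exchanged, is exchanged again, now with the first gap of \<open>u2\<close>. This cuts off \<open>u2\<close> and leaves
  \<open>u1\<close> merged with \<open>v\<close>.
\<close>

lemma embeds_cut:
  assumes emb: "embeds f (lp_sum [cyclic_lp (u1 @ u2), cyclic_lp v]) W"
    and u1: "u1 \<noteq> []" "u1 ! 0" and u2: "u2 \<noteq> []" "u2 ! 0" and v: "v \<noteq> []" "\<not> v ! 0"
    and adj: "f (0, 0) = Suc (f (1, 0))" "f (0, length u1) = Suc (f (0, 0))"
  shows "lp_sum [cyclic_lp (u1 @ v), cyclic_lp u2] \<simeq>
    word_lp (W[f (1, 0) := True, f (0, 0) := False, f (0, 0) := True, f (0, length u1) := False])"
proof -
  let ?u = "u1 @ u2"
  obtain T d p where L: "lp_sum [cyclic_lp ?u, cyclic_lp v] = (T, d, p)" by (cases "lp_sum [cyclic_lp ?u, cyclic_lp v]")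
  have T: "T = {(j, i). j = 0 \<and> i < length ?u \<or> j = 1 \<and> i < length v}"
    using arg_cong[OF L, of fst] by (auto simp: lp_sum_def cyclic_lp_def less_Suc_eq nth_Cons')
  have d: "d (0, i) = ?u ! i" "d (Suc 0, i) = v ! i" for i
    using arg_cong[OF L, of "\<lambda>L. fst (snd L)"] by (auto simp: lp_sum_def cyclic_lp_def)
  have p: "p (0, i) = (0, if Suc i = length ?u then 0 else Suc i)" "p (Suc 0, i) = (Suc 0, if Suc i = length v then 0 else Suc i)" for i
    using arg_cong[OF L, of "\<lambda>L. snd (snd L)"] by (auto simp: lp_sum_def cyclic_lp_def)
  let ?k = "length u1"
  have x: "(1, 0) \<in> T" "(0, 0) \<in> T" "(0, ?k) \<in> T" and k: "0 < ?k" "?u ! 0" "?u ! ?k"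
    using u1 u2 v by (auto simp: T nth_append)
  let ?d1 = "d((1, 0) := True, (0, 0) := False)" let ?p1 = "p((1, 0) := p (0, 0), (0, 0) := p (1, 0))"
  let ?d2 = "?d1((0, 0) := True, (0, ?k) := False)" let ?p2 = "?p1((0, 0) := ?p1 (0, ?k), (0, ?k) := ?p1 (0, 0))"
  have 1: "embeds f (T, ?d1, ?p1) (W[f (1, 0) := True, f (0, 0) := False])"
    by (rule embeds_swap[OF emb[unfolded L] x(1,2) adj(1)]) (use u1 u2 v d k in auto)
  have "embeds f (T, ?d2, ?p2) (W[f (1, 0) := True, f (0, 0) := False, f (0, 0) := True, f (0, ?k) := False])"
    by (rule embeds_swap[OF 1 x(2,3) adj(2)]) (use u1 u2 v d k in auto)
  then have 2: "(T, ?d2, ?p2) \<simeq> word_lp (W[f (1, 0) := True, f (0, 0) := False, f (0, 0) := True, f (0, ?k) := False])"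
    by (rule embeds_iso)
  have p2: "?p2 (1, 0) = p (0, 0)" "?p2 (0, 0) = p (0, ?k)" "?p2 (0, ?k) = p (1, 0)"
    "\<And>i. i \<noteq> 0 \<Longrightarrow> i \<noteq> ?k \<Longrightarrow> ?p2 (0, i) = p (0, i)" "\<And>i. i \<noteq> 0 \<Longrightarrow> ?p2 (Suc 0, i) = p (1, i)"
    using k(1) by auto
  have d2: "?d2 (1, 0)" "?d2 (0, 0)" "\<not> ?d2 (0, ?k)"
    "\<And>i. i \<noteq> 0 \<Longrightarrow> i \<noteq> ?k \<Longrightarrow> ?d2 (0, i) = ?u ! i" "\<And>i. i \<noteq> 0 \<Longrightarrow> ?d2 (Suc 0, i) = v ! i"
    using k(1) d by auto
  let ?g = "\<lambda>(j :: nat, s). if j = 0 then (if s = 0 then (1, 0) else if s \<le> ?k then (0, s) else (1, s - ?k))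
     else (if s = 0 then (0, 0) else (0, ?k + s))"
  have fs: "fst (lp_sum [cyclic_lp (u1 @ v), cyclic_lp u2]) = {(j, i). j = 0 \<and> i < length (u1 @ v) \<or> j = 1 \<and> i < length u2}"
    by (auto simp: lp_sum_def cyclic_lp_def less_Suc_eq nth_Cons')
  have "lp_sum [cyclic_lp (u1 @ v), cyclic_lp u2] \<simeq> (T, ?d2, ?p2)"
  proof (rule lp_isoI'[where f = ?g], unfold fs fst_conv snd_conv)
    show "bij_betw ?g {(j, i). j = 0 \<and> i < length (u1 @ v) \<or> j = 1 \<and> i < length u2} T"
      by (rule bij_betw_byWitness[where f' = "\<lambda>(j :: nat, i). if j = 0 then (if i = 0 then (1, 0) else if i \<le> ?k then (0, i) else (1, i - ?k)) else (0, if i = 0 then 0 else ?k + i)"])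
         (use u1 u2 v in \<open>auto simp: T split: if_splits simp flip: length_greater_0_conv\<close>)
    fix z :: "nat \<times> nat" assume z: "z \<in> {(j, i). j = 0 \<and> i < length (u1 @ v) \<or> j = 1 \<and> i < length u2}"
    obtain j s where js: "z = (j, s)" by (cases z)
    obtain m n l where lens: "length u1 = Suc m" "length u2 = Suc n" "length v = Suc l"
      using u1(1) u2(1) v(1) by (metis length_Suc_conv neq_Nil_conv)
    consider (a) "j = 0" "s = 0" | (b) "j = 0" "0 < s" "s < ?k" | (c) "j = 0" "s = ?k" | (d) "j = 0" "s > ?k" "s < ?k + length v"
      | (e) "j = 1" "s = 0" | (f) "j = 1" "0 < s" "s < length u2"
      using z js k(1) by force
    then have "?d2 (?g (j, s)) = fst (snd (lp_sum [cyclic_lp (u1 @ v), cyclic_lp u2])) (j, s) \<and>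
      ?g (snd (snd (lp_sum [cyclic_lp (u1 @ v), cyclic_lp u2])) (j, s)) = ?p2 (?g (j, s))"
    proof cases
      case a
      then show ?thesis using lens p2(1) d2(1) k u1 u2 v by (auto simp: lp_sum_def cyclic_lp_def p nth_append)
    next
      case b then show ?thesis using lens p2(4)[of s] d2(4)[of s] k u1 u2 v by (auto simp: lp_sum_def cyclic_lp_def p nth_append)
    next
      case c then show ?thesis using lens p2(3) d2(3) k u1 u2 v by (auto simp: lp_sum_def cyclic_lp_def p nth_append)
    next
      case d then show ?thesis using lens p2(5)[of "s - ?k"] d2(5)[of "s - ?k"] k u1 u2 v
        by (auto simp: lp_sum_def cyclic_lp_def p nth_append)
    next
      case e then show ?thesis using lens p2(2) d2(2) k u1 u2 v by (auto simp: lp_sum_def cyclic_lp_def p nth_append)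
    next
      case f then show ?thesis using lens p2(4)[of "?k + s"] d2(4)[of "?k + s"] k u1 u2 v
        by (auto simp: lp_sum_def cyclic_lp_def p nth_append)
    qed
    then show "?d2 (?g z) = fst (snd (lp_sum [cyclic_lp (u1 @ v), cyclic_lp u2])) z"
      "?g (snd (snd (lp_sum [cyclic_lp (u1 @ v), cyclic_lp u2])) z) = ?p2 (?g z)" unfolding js by blast+
  qed
  then show ?thesis using 2 by (rule lp_iso_trans)
qed

section \<open>Two slopes on either side of the diagonal\<close>

text \<open>
  For \<open>b < a\<close> and \<open>c < d\<close> the sum of \<open>1\<^sup>a0\<^sup>b\<close> and \<open>1\<^sup>c0\<^sup>d\<close> is the sequence
  \<open>1\<^sup>c0\<^bsup>d-c\<^esup> 1\<^sup>b 0\<^sup>c 1\<^bsup>a-b\<^esup>0\<^sup>b\<close>. Its four blocks are the elements of the second and the first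
  summand that are preceded by a zero, followed by those that are preceded by a one. Every zero of the
  first summand comes after every zero of the second, and likewise for the ones, so the images
  under the permutation come in this order again.
\<close>

definition pair_word :: "nat \<Rightarrow> nat \<Rightarrow> nat \<Rightarrow> nat \<Rightarrow> bool list" where
  "pair_word a b c d =
     map (\<lambda>p. p < c \<or> d \<le> p \<and> p < d + b \<or> b + c + d \<le> p \<and> p < a + c + d) [0..<a + b + c + d]"

text \<open>
  The position of the last element of the second summand, which is a zero. The next element is a one of
  the first summand. If \<open>c = 0\<close>, then the second summand is that of \<open>(0, 1)\<close> and
  has its only element at position 0.
\<close>

definition cut_pos :: "nat \<Rightarrow> nat \<Rightarrow> nat \<Rightarrow> nat" where
  "cut_pos b c d = (if c = 0 then 0 else b + c + d - 1)"

text \<open>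
  The sequence after the exchange that merges the two summands into one cycle.
\<close>

definition join_word :: "nat \<Rightarrow> nat \<Rightarrow> nat \<Rightarrow> nat \<Rightarrow> bool list" where
  "join_word a b c d = (pair_word a b c d)[cut_pos b c d := True, Suc (cut_pos b c d) := False]"

lemma length_pair_word [simp]: "length (pair_word a b c d) = a + b + c + d"
  by (simp add: pair_word_def)

lemma length_join_word [simp]: "length (join_word a b c d) = a + b + c + d"
  by (simp add: join_word_def)

lemma nth_pair_word:
  "p < a + b + c + d \<Longrightarrow> pair_word a b c d ! p \<longleftrightarrow> p < c \<or> d \<le> p \<and> p < d + b \<or> b + c + d \<le> p \<and> p < a + c + d"
  by (simp add: pair_word_def)

text \<open>
  The position in \<^const>\<open>pair_word\<close> of the element \<open>i\<close> of the summand \<open>j\<close>.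
\<close>

definition pair_pos :: "nat \<Rightarrow> nat \<Rightarrow> nat \<Rightarrow> nat \<times> nat \<Rightarrow> nat" where
  "pair_pos b c d = (\<lambda>(j, i). if j = 0 then (if i < b then d + i else c + d + i)
     else (if i < d then i else b + i))"

lemma pair_embed:
  assumes "b \<le> a" "c \<le> d"
  shows "embeds (pair_pos b c d) (words_lp [minimal_seq (a, b), minimal_seq (c, d)]) (pair_word a b c d)"
proof -
  let ?L = "words_lp [minimal_seq (a, b), minimal_seq (c, d)]"
  obtain T l p where L: "?L = (T, l, p)" by (cases ?L)
  have T: "T = {(j, i). j = 0 \<and> i < a + b \<or> j = 1 \<and> i < c + d}"
    using arg_cong[OF L, of fst] by (auto simp: lp_sum_def word_lp_def less_Suc_eq nth_Cons')
  have l: "l (0, i) = minimal_seq (a, b) ! i" "l (Suc 0, i) = minimal_seq (c, d) ! i" for i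
    using arg_cong[OF L, of "\<lambda>L. fst (snd L)"] by (auto simp: lp_sum_def word_lp_def)
  have p: "p (0, i) = (0, word_perm (minimal_seq (a, b)) i)" "p (Suc 0, i) = (Suc 0, word_perm (minimal_seq (c, d)) i)" for i
    using arg_cong[OF L, of "\<lambda>L. snd (snd L)"] by (auto simp: lp_sum_def word_lp_def)
  note simps = l p nth_minimal_seq word_perm_minimal_seq nth_pair_word pair_pos_def
  show ?thesis unfolding L
  proof (rule embedsI)
    show "lp_ok (T, l, p)" using lp_ok_words_lp L by metis
    show "bij_betw (pair_pos b c d) T {..<length (pair_word a b c d)}"
      by (rule bij_betw_byWitness[where f' = "\<lambda>q. if q < d then (1, q) else if q < d + b then (0, q - d)
            else if q < b + c + d then (1, q - b) else (0, q - (c + d))"])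
         (use assms in \<open>auto simp: T pair_pos_def split: if_splits\<close>)
    show "pair_word a b c d ! pair_pos b c d t = l t" if "t \<in> T" for t
      using that assms by (auto simp: T simps split: if_splits)
    fix s t assume st: "s \<in> T" "t \<in> T"
    obtain j i where s: "s = (j, i)" by (cases s)
    obtain k m where t: "t = (k, m)" by (cases t)
    have c: "j = 0 \<and> i < a + b \<or> j = Suc 0 \<and> i < c + d" "k = 0 \<and> m < a + b \<or> k = Suc 0 \<and> m < c + d"
      using st by (auto simp: T s t)
    show "pair_pos b c d (p s) < pair_pos b c d (p t)" if "l s = l t" "pair_pos b c d s < pair_pos b c d t"
      using c that assms unfolding s t by (elim disjE conjE) (auto simp: simps split: if_splits)
    show "pair_pos b c d (p s) < pair_pos b c d (p t)" if "\<not> l s" "l t"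
      using c that assms unfolding s t by (elim disjE conjE) (auto simp: simps split: if_splits)
  qed
qed

lemma embeds_compose:
  assumes f: "embeds f M A" and g: "bij_betw g (fst L) (fst M)"
    "\<And>t. t \<in> fst L \<Longrightarrow> fst (snd M) (g t) = fst (snd L) t"
    "\<And>t. t \<in> fst L \<Longrightarrow> g (snd (snd L) t) = snd (snd M) (g t)"
  shows "embeds (f \<circ> g) L A"
  using f g bij_betwE[OF g(1)] bij_betw_trans[OF g(1)] unfolding embeds_def by auto

text \<open>
  The indices within the two summands of the elements that are exchanged first.
\<close>

definition cut_x :: "nat \<Rightarrow> nat \<Rightarrow> nat" where "cut_x b c = (if c = 0 then 0 else b)"
definition cut_y :: "nat \<Rightarrow> nat \<Rightarrow> nat" where "cut_y c d = (if c = 0 then 0 else c + d - 1)"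

lemma chris_pair_embed:
  assumes "coprime a b" "coprime c d" "b < a" "c < d"
  defines "f \<equiv> \<lambda>(j, t). pair_pos b c d (if j = 0 then (0, (cut_x b c + t * b) mod (a + b))
      else (1, (cut_y c d + t * d) mod (c + d)))"
  shows "embeds f (lp_sum [cyclic_lp (chris (a, b) (cut_x b c)), cyclic_lp (chris (c, d) (cut_y c d))]) (pair_word a b c d)"
proof -
  let ?g = "\<lambda>(j :: nat, t). if j = 0 then (0 :: nat, (cut_x b c + t * b) mod (a + b))
      else (1, (cut_y c d + t * d) mod (c + d))"
  let ?L = "lp_sum [cyclic_lp (chris (a, b) (cut_x b c)), cyclic_lp (chris (c, d) (cut_y c d))]"
  have lt: "cut_x b c < a + b" "cut_y c d < c + d" using assms by (auto simp: cut_x_def cut_y_def)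
  note x = chris_embed[OF assms(1) lt(1), unfolded embeds_def]
  note y = chris_embed[OF assms(2) lt(2), unfolded embeds_def]
  have fsL: "fst ?L = {(j, i). j = 0 \<and> i < a + b \<or> j = 1 \<and> i < c + d}"
    by (auto simp: lp_sum_def cyclic_lp_def less_Suc_eq nth_Cons')
  have fsM: "fst (words_lp [minimal_seq (a, b), minimal_seq (c, d)]) = {(j, i). j = 0 \<and> i < a + b \<or> j = 1 \<and> i < c + d}"
    by (auto simp: lp_sum_def word_lp_def less_Suc_eq nth_Cons')
  have "embeds (pair_pos b c d \<circ> ?g) ?L (pair_word a b c d)"
  proof (rule embeds_compose[OF pair_embed], unfold fsL fsM)
    have X: "bij_betw (\<lambda>t. (cut_x b c + t * b) mod (a + b)) {..<a + b} {..<a + b}"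
      and Y: "bij_betw (\<lambda>t. (cut_y c d + t * d) mod (c + d)) {..<c + d} {..<c + d}"
      using x y by (simp_all add: cyclic_lp_def)
    let ?T = "{(j :: nat, i). j = 0 \<and> i < a + b \<or> j = 1 \<and> i < c + d}"
    have inj: "inj_on ?g ?T"
      using bij_betw_imp_inj_on[OF X] bij_betw_imp_inj_on[OF Y] by (auto simp: inj_on_def)
    have "?g ` ?T \<subseteq> ?T" using bij_betwE[OF X] bij_betwE[OF Y] by auto
    moreover have "finite ?T"
      by (rule finite_subset[of _ "{..1} \<times> {..<a + b + c + d}"]) auto
    ultimately show "bij_betw ?g ?T ?T" using inj by (simp add: bij_betw_def endo_inj_surj)
    fix z :: "nat \<times> nat" assume "z \<in> ?T"
    then obtain j t where z: "z = (j, t)" "j = 0 \<and> t < a + b \<or> j = Suc 0 \<and> t < c + d" by auto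
    show "fst (snd (words_lp [minimal_seq (a, b), minimal_seq (c, d)])) (?g z) = fst (snd ?L) z"
      using x y z by (auto simp: lp_sum_def word_lp_def cyclic_lp_def)
    show "?g (snd (snd ?L) z) = snd (snd (words_lp [minimal_seq (a, b), minimal_seq (c, d)])) (?g z)"
      using x y z by (elim disjE conjE) (simp_all add: lp_sum_def word_lp_def cyclic_lp_def)
  qed (use assms in auto)
  also have "pair_pos b c d \<circ> ?g = f" by (auto simp: f_def)
  finally show ?thesis .
qed

lemma chris_Nil [simp]: "chris (a, b) i = [] \<longleftrightarrow> a = 0 \<and> b = 0"
  by (metis add_is_0 length_0_conv length_chris)

lemma join_word_iso:
  assumes "coprime a b" "coprime c d" "b < a" "c < d"
  shows "cyclic_lp (chris (a, b) (cut_x b c) @ chris (c, d) (cut_y c d)) \<simeq> word_lp (join_word a b c d)"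
    and "exchange_01 (pair_word a b c d) (join_word a b c d)"
proof -
  let ?f = "\<lambda>(j, t). pair_pos b c d (if j = (0 :: nat) then (0, (cut_x b c + t * b) mod (a + b))
      else (1, (cut_y c d + t * d) mod (c + d)))"
  have lt: "cut_x b c < a + b" "cut_y c d < c + d" using assms by (auto simp: cut_x_def cut_y_def)
  have d1: "c = 0 \<Longrightarrow> d = 1" using assms by simp
  have f: "?f (1, 0) = cut_pos b c d" "?f (0, 0) = Suc (cut_pos b c d)"
    using lt assms d1 by (auto simp: pair_pos_def cut_x_def cut_y_def cut_pos_def)
  have "cyclic_lp (chris (a, b) (cut_x b c) @ chris (c, d) (cut_y c d)) \<simeq>
      word_lp ((pair_word a b c d)[?f (1, 0) := True, ?f (0, 0) := False])"
  proof (rule embeds_merge[OF chris_pair_embed[OF assms]])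
    show "chris (a, b) (cut_x b c) ! 0" using lt assms by (subst nth_chris) (auto simp: cut_x_def)
    show "\<not> chris (c, d) (cut_y c d) ! 0" using lt assms by (subst nth_chris) (auto simp: cut_y_def)
    show "?f (0, 0) = Suc (?f (1, 0))" using f by metis
  qed (use assms in auto)
  then show "cyclic_lp (chris (a, b) (cut_x b c) @ chris (c, d) (cut_y c d)) \<simeq> word_lp (join_word a b c d)"
    unfolding f join_word_def .
  show "exchange_01 (pair_word a b c d) (join_word a b c d)"
    unfolding join_word_def
    by (rule exchange_update) (use assms d1 in \<open>auto simp: nth_pair_word cut_pos_def\<close>)
qed

lemma join_step:
  assumes "coprime a b" "coprime c d" "b < a" "c < d"
  shows "wstep [join_word a b c d] [minimal_seq (a, b), minimal_seq (c, d)]"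
  unfolding wstep_def
proof (intro exI conjI)
  show "words_lp [minimal_seq (a, b), minimal_seq (c, d)] \<simeq> words_lp ([] @ [pair_word a b c d])"
    using lp_iso_trans[OF embeds_iso[OF pair_embed] words_lp_single'] assms by simp
  show "words_lp [join_word a b c d] \<simeq> words_lp ([] @ [join_word a b c d])" by (simp add: lp_iso_refl)
  show "exchange_01 (pair_word a b c d) (join_word a b c d)" by (rule join_word_iso[OF assms])
qed

text \<open>
  The element exchanged first and its successor in the order are neighbours within the first summand,
  and both are ones. The step between neighbouring elements takes \<open>a1 + b1\<close> applications of the
  rotation, so the second exchange cuts the word of the first summand at its standard factorization.
\<close>

lemma cut_step_regular:
  assumes det: "a1 * b2 = a2 * b1 + (1::nat)" and co: "coprime (a1 + a2) (b1 + b2)" "coprime c d"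
    and lt: "b1 < a1" "b2 \<le> a2" "c < d" and ok: "c = 0 \<or> b1 + b2 + 1 < a1 + a2"
  shows "wstep [join_word a1 b1 c d, minimal_seq (a2, b2)] [join_word (a1 + a2) (b1 + b2) c d]"
proof -
  let ?a = "a1 + a2" let ?b = "b1 + b2" let ?h = "?a + ?b"
  let ?f = "\<lambda>(j, t). pair_pos ?b c d (if j = (0 :: nat) then (0, (cut_x ?b c + t * ?b) mod ?h)
      else (1, (cut_y c d + t * d) mod (c + d)))"
  let ?q = "cut_pos ?b c d"
  have co1: "coprime a1 b1" and co2: "coprime a2 b2"
  proof -
    have "g dvd 1" if "g dvd a1" "g dvd b1" for g
      using that det by (metis dvd_add_right_iff dvd_mult dvd_mult2)
    then show "coprime a1 b1" by (rule coprimeI)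
    have "g dvd 1" if "g dvd a2" "g dvd b2" for g
      using that det by (metis dvd_add_right_iff dvd_mult dvd_mult2)
    then show "coprime a2 b2" by (rule coprimeI)
  qed
  have pos: "0 < a1" "0 < b2" using det by (auto intro: gr0I)
  then have a2: "0 < a2" and b: "?b < ?a" using lt by auto
  \<comment> \<open>Equality means \<open>(a2, b2) = (1, 1)\<close>, which forces \<open>a = b + 1\<close>.\<close>
  have b2: "b2 < a2" if "c \<noteq> 0"
  proof (rule ccontr)
    assume "\<not> b2 < a2"
    then have eq: "a2 = b2" using lt by simp
    have "b2 * (a1 - b1) = 1" using det lt by (simp add: eq algebra_simps diff_mult_distrib2)
    then have "b2 = 1" "a1 = b1 + 1" using lt by auto
    then show False using ok that eq by simp
  qed
  have fac: "chris (?a, ?b) (cut_x ?b c) = chris (a1, b1) (cut_x b1 c) @ chris (a2, b2) (cut_x b2 c)"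
    using chris_factor_0[OF det] chris_factor[OF det a2] by (simp add: cut_x_def)
  have d1: "c = 0 \<Longrightarrow> d = 1" using co by simp
  have h1: "(a1 + b1) * ?b = b1 * ?h + 1" using det by (simp add: algebra_simps)
  have cxl: "cut_x ?b c + 1 < ?h" using b pos a2 by (auto simp: cut_x_def)
  have "(cut_x ?b c + (a1 + b1) * ?b) mod ?h = (cut_x ?b c + 1 + b1 * ?h) mod ?h" unfolding h1 by simp
  also have "\<dots> = cut_x ?b c + 1" using cxl by (simp only: mod_mult_self1 mod_less)
  finally have m: "(cut_x ?b c + (a1 + b1) * ?b) mod ?h = cut_x ?b c + 1" .
  have cl: "cut_x ?b c < ?h" "cut_y c d < c + d" using b lt by (auto simp: cut_x_def cut_y_def)
  have f: "?f (1, 0) = ?q" "?f (0, 0) = Suc ?q"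
    using cl b lt d1 by (auto simp: pair_pos_def cut_x_def cut_y_def cut_pos_def)
  have "?f (0, a1 + b1) = pair_pos ?b c d (0, cut_x ?b c + 1)" unfolding prod.case by (simp only: m if_True refl)
  also have "\<dots> = Suc (Suc ?q)"
    using cl b lt d1 by (auto simp: pair_pos_def cut_x_def cut_y_def cut_pos_def)
  finally have f3: "?f (0, a1 + b1) = Suc (Suc ?q)" .
  let ?Q = "(join_word ?a ?b c d)[Suc ?q := True, Suc (Suc ?q) := False]"
  have "lp_sum [cyclic_lp (chris (a1, b1) (cut_x b1 c) @ chris (c, d) (cut_y c d)), cyclic_lp (chris (a2, b2) (cut_x b2 c))] \<simeq>
    word_lp ((pair_word ?a ?b c d)[?f (1, 0) := True, ?f (0, 0) := False, ?f (0, 0) := True,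
         ?f (0, length (chris (a1, b1) (cut_x b1 c))) := False])"
  proof (rule embeds_cut)
    show "embeds ?f (lp_sum [cyclic_lp (chris (a1, b1) (cut_x b1 c) @ chris (a2, b2) (cut_x b2 c)), cyclic_lp (chris (c, d) (cut_y c d))]) (pair_word ?a ?b c d)"
      using chris_pair_embed[OF co b lt(3)] unfolding fac .
    show "chris (a1, b1) (cut_x b1 c) ! 0" using lt pos by (subst nth_chris) (auto simp: cut_x_def)
    show "chris (a2, b2) (cut_x b2 c) ! 0" using lt pos a2 b2 by (subst nth_chris) (auto simp: cut_x_def)
    show "\<not> chris (c, d) (cut_y c d) ! 0" using cl lt by (subst nth_chris) (auto simp: cut_y_def)
    show "?f (0, 0) = Suc (?f (1, 0))" unfolding f ..
    show "?f (0, length (chris (a1, b1) (cut_x b1 c))) = Suc (?f (0, 0))" unfolding f length_chris f3 ..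
  qed (use pos lt in auto)
  then have Q: "lp_sum [cyclic_lp (chris (a1, b1) (cut_x b1 c) @ chris (c, d) (cut_y c d)), cyclic_lp (chris (a2, b2) (cut_x b2 c))] \<simeq> word_lp ?Q"
    unfolding f length_chris f3 join_word_def .
  have cx2: "cut_x b2 c < a2 + b2" using a2 by (auto simp: cut_x_def)
  have "lp_sum [cyclic_lp (chris (a1, b1) (cut_x b1 c) @ chris (c, d) (cut_y c d)), cyclic_lp (chris (a2, b2) (cut_x b2 c))] \<simeq>
     words_lp [join_word a1 b1 c d, minimal_seq (a2, b2)]"
    using join_word_iso(1)[OF co1 co(2) lt(1,3)] embeds_iso[OF chris_embed[OF co2 cx2]]
    by (intro lp_sum_cong) simp
  then have R: "words_lp [join_word a1 b1 c d, minimal_seq (a2, b2)] \<simeq> words_lp [?Q]"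
    using Q lp_iso_trans lp_iso_sym words_lp_single' lp_ok_lp_sum lp_ok_cyclic_lp
    by (smt (verit) empty_iff empty_set insert_iff list.simps(15))
  show ?thesis unfolding wstep_def
  proof (intro exI conjI)
    show "words_lp [join_word ?a ?b c d] \<simeq> words_lp ([] @ [join_word ?a ?b c d])" by (simp add: lp_iso_refl)
    show "words_lp [join_word a1 b1 c d, minimal_seq (a2, b2)] \<simeq> words_lp ([] @ [?Q])" using R by simp
    show "exchange_01 (join_word ?a ?b c d) ?Q"
    proof (rule exchange_update)
      show "Suc (Suc ?q) < length (join_word ?a ?b c d)" using b lt pos a2 d1 by (auto simp: cut_pos_def)
      show "\<not> join_word ?a ?b c d ! Suc ?q" using b lt pos a2 d1 by (auto simp: join_word_def cut_pos_def)
      show "join_word ?a ?b c d ! Suc (Suc ?q)"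
        using b lt pos a2 d1 ok by (auto simp: join_word_def nth_pair_word cut_pos_def)
    qed
  qed
qed

text \<open>
  A set of elements that is closed under the permutation is a direct summand, and the summand has the
  subsequence of its labels as its sequence.
\<close>

lemma split_iso:
  assumes e: "strict_mono_on {..<length B} e" "strict_mono_on {..<length C} g"
    and part: "e ` {..<length B} \<union> g ` {..<length C} = {..<length A}"
      "e ` {..<length B} \<inter> g ` {..<length C} = {}"
    and closed: "word_perm A ` g ` {..<length C} \<subseteq> g ` {..<length C}"
    and lab: "\<And>i. i < length B \<Longrightarrow> A ! e i = B ! i" "\<And>i. i < length C \<Longrightarrow> A ! g i = C ! i"
  shows "words_lp [B, C] \<simeq> words_lp [A]"
proof -
  let ?S = "\<lambda>e B. e ` {..<length B}"
  have sub: "?S e B \<subseteq> {..<length A}" "?S g C \<subseteq> {..<length A}" using part by auto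
  have injA: "inj_on (word_perm A) S" if "S \<subseteq> {..<length A}" for S
    using word_perm_inj that by (rule inj_on_subset)
  have fin: "finite (?S e B)" "finite (?S g C)" by auto
  have onto: "word_perm A ` ?S g C = ?S g C"
    using endo_inj_surj[OF fin(2) closed injA[OF sub(2)]] .
  have "word_perm A ` ?S e B \<subseteq> ?S e B"
  proof
    fix z assume "z \<in> word_perm A ` ?S e B"
    then obtain y where y: "y \<in> ?S e B" "z = word_perm A y" by blast
    have "z \<notin> ?S g C"
    proof
      assume "z \<in> ?S g C"
      then have "z \<in> word_perm A ` ?S g C" using onto by simp
      then obtain y' where "y' \<in> ?S g C" "z = word_perm A y'" by blast
      then have "y = y'" using y sub injA[of "{..<length A}"] by (auto simp: inj_on_def)
      then show False using y \<open>y' \<in> ?S g C\<close> part(2) by blast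
    qed
    moreover have "z \<in> {..<length A}" using y sub(1) by (auto simp: word_perm_less)
    ultimately show "z \<in> ?S e B" using part(1) by blast
  qed
  then have onto': "word_perm A ` ?S e B = ?S e B"
    using endo_inj_surj[OF fin(1) _ injA[OF sub(1)]] by blast
  have key: "e (word_perm B i) = word_perm A (e i)"
    if e: "strict_mono_on {..<length B} e" and sub: "?S e B \<subseteq> {..<length A}"
      and onto: "word_perm A ` ?S e B = ?S e B" and lab: "\<And>i. i < length B \<Longrightarrow> A ! e i = B ! i"
      and i: "i < length B" for e B i
  proof -
    let ?T = "?S e B" let ?f = "inv_into {..<length B} e"
    have inj: "inj_on e {..<length B}" using e by (rule strict_mono_on_imp_inj_on)
    have fe: "?f (e k) = k" if "k < length B" for k using inj that by simp
    have less: "e k < e l \<longleftrightarrow> k < l" if "k < length B" "l < length B" for k l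
      using that strict_mono_on_less[OF e] by simp
    have "embeds ?f (?T, (!) A, word_perm A) B"
    proof (rule embedsI)
      show "lp_ok (?T, (!) A, word_perm A)"
        unfolding lp_ok_def using onto injA[OF sub] by (simp add: bij_betw_def)
      show "bij_betw ?f ?T {..<length B}"
        by (rule bij_betw_inv_into) (simp add: bij_betw_def inj)
      show "B ! ?f t = A ! t" if "t \<in> ?T" for t using that fe lab by auto
      have img: "word_perm A (e k) \<in> ?T" if "k < length B" for k using onto that by blast
      fix s t assume "s \<in> ?T" "t \<in> ?T"
      then obtain k l where kl: "k < length B" "s = e k" "l < length B" "t = e l" by auto
      obtain k' l' where kl': "k' < length B" "word_perm A s = e k'" "l' < length B" "word_perm A t = e l'"
        using img[OF kl(1)] img[OF kl(3)] kl by auto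
      have goal: "?f (word_perm A s) < ?f (word_perm A t)" if "word_perm A s < word_perm A t"
        using that kl' fe less by simp
      show "?f (word_perm A s) < ?f (word_perm A t)" if "A ! s = A ! t" "?f s < ?f t"
      proof (rule goal)
        have "s < t" using that kl fe less by simp
        then show "word_perm A s < word_perm A t"
          using that zeros_before_less[of s t A] ones_before_less[of s t A] by (auto simp: word_perm_def)
      qed
      show "?f (word_perm A s) < ?f (word_perm A t)" if "\<not> A ! s" "A ! t"
      proof (rule goal)
        have "s < length A" using kl sub by auto
        then show "word_perm A s < word_perm A t" using that word_perm_zero_less[of s A] by (auto simp: word_perm_def)
      qed
    qed
    then have "?f (word_perm A (e i)) = word_perm B (?f (e i))" using i unfolding embeds_def by auto
    moreover have "word_perm A (e i) \<in> ?T" using onto i by blast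
    ultimately show ?thesis using fe[OF i] by (metis f_inv_into_f)
  qed
  note k1 = key[OF e(1) sub(1) onto' lab(1)] and k2 = key[OF e(2) sub(2) onto lab(2)]
  let ?g = "\<lambda>(j :: nat, i). if j = 0 then e i else g i"
  let ?D = "{(j :: nat, i). j = 0 \<and> i < length B \<or> j = 1 \<and> i < length C}"
  have D: "fst (words_lp [B, C]) = ?D" by (auto simp: lp_sum_def word_lp_def less_Suc_eq nth_Cons')
  have "bij_betw ?g ?D {..<length A}"
  proof (rule bij_betw_imageI)
    show "inj_on ?g ?D"
      using strict_mono_on_imp_inj_on[OF assms(1)] strict_mono_on_imp_inj_on[OF assms(2)] part(2)
      by (auto simp: inj_on_def)
    show "?g ` ?D = {..<length A}" unfolding part(1)[symmetric]
    proof (intro equalityI subsetI)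
      fix z assume "z \<in> e ` {..<length B} \<union> g ` {..<length C}"
      then consider i where "i < length B" "z = e i" | i where "i < length C" "z = g i" by auto
      then show "z \<in> ?g ` ?D"
      proof cases
        case (1 i) then show ?thesis by (intro image_eqI[where x = "(0, i)"]) auto
      next
        case (2 i) then show ?thesis by (intro image_eqI[where x = "(1, i)"]) auto
      qed
    qed auto
  qed
  moreover have "A ! ?g t = fst (snd (words_lp [B, C])) t \<and> ?g (snd (snd (words_lp [B, C])) t) = word_perm A (?g t)"
    if "t \<in> ?D" for t
    using that lab k1 k2 by (auto simp: lp_sum_def word_lp_def)
  ultimately have "words_lp [B, C] \<simeq> word_lp A"
    by (intro lp_isoI'[where f = ?g], unfold D) (simp_all add: word_lp_def)
  then show ?thesis using words_lp_single' by (rule lp_iso_trans)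
qed

text \<open>
  For \<open>a = b + 1\<close> the last block of ones has length one and is used up by the first exchange. Instead
  the boundary of the second and the third block is exchanged, which creates a cycle \<open>1 0\<close> of length
  two. Removing this cycle leaves the merged sequence for \<open>(b, b - 1)\<close>.
\<close>

lemma cut_step_special:
  assumes "1 \<le> b" "1 \<le> c" "c < d"
  shows "wstep [join_word b (b - 1) c d, minimal_seq (1, 1)] [join_word (b + 1) b c d]"
proof -
  let ?J = "join_word (b + 1) b c d" let ?B = "join_word b (b - 1) c d"
  let ?Q = "?J[d - 1 := True, Suc (d - 1) := False]"
  let ?z = "d + c + b"
  obtain b' where b: "b = Suc b'" using assms by (cases b) auto
  obtain c' where c: "c = Suc c'" using assms by (cases c) auto
  obtain k where d: "d = Suc (c + k)" using assms less_imp_Suc_add by blast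
  have Q: "?Q = (replicate c True @ replicate k False) @ True # (False # replicate b' True @ replicate c' False @ [True]) @
      False # replicate b False"
  proof (rule nth_equalityI)
    fix i assume "i < length ?Q"
    then have i: "i < Suc b + b + c + d" by simp
    show "?Q ! i = ((replicate c True @ replicate k False) @ True # (False # replicate b' True @ replicate c' False @ [True]) @
      False # replicate b False) ! i"
      using i by (auto simp: join_word_def cut_pos_def nth_pair_word nth_list_update nth_append nth_Cons' b c d)
  qed (simp add: b c d)
  have zb: "zeros_before A i = length (filter Not (take i A))" if "i \<le> length A" for A i
  proof -
    have "{k. k < i \<and> \<not> A ! k} = {k. k < length (take i A) \<and> \<not> take i A ! k}" using that by auto
    then show ?thesis by (simp add: zeros_before_def length_filter_conv_card)
  qed
  have nth: "?Q ! (d - 1)" "\<not> ?Q ! ?z"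
    using assms by (auto simp: join_word_def cut_pos_def nth_pair_word nth_list_update b c d)
  have len: "length ?Q = Suc b + b + c + d" by simp
  have "zeros_before ?Q (length ?Q) = length (filter Not ?Q)" using zb[of "length ?Q" ?Q] by simp
  also have "\<dots> = d + b" unfolding Q by (simp add: b c d)
  finally have z0: "zeros_before ?Q (length ?Q) = d + b" .
  have "zeros_before ?Q (d - 1) = length (filter Not (take (d - 1) ?Q))" by (rule zb) (simp add: d)
  also have "\<dots> = k" unfolding Q by (simp add: b c d)
  finally have z1: "zeros_before ?Q (d - 1) = k" .
  have "zeros_before ?Q ?z = length (filter Not (take ?z ?Q))" by (rule zb) simp
  also have "\<dots> = d - 1" unfolding Q by (simp add: b c d numeral_3_eq_3)
  finally have z2: "zeros_before ?Q ?z = d - 1" .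
  have "ones_before ?Q (d - 1) = c" using zeros_ones_before[of ?Q "d - 1"] z1 d by simp
  then have p1: "word_perm ?Q (d - 1) = ?z" using nth(1) z0 by (simp add: word_perm_def)
  have p2: "word_perm ?Q ?z = d - 1" using nth(2) z2 by (simp add: word_perm_def)
  \<comment> \<open>The positions other than \<open>d - 1\<close> and \<open>?z\<close>, which form the cycle of length two.\<close>
  let ?e = "\<lambda>i. if i < d - 1 then i else if i < ?z - 1 then i + 1 else i + 2"
  let ?g = "\<lambda>i. if i = (0 :: nat) then d - 1 else ?z"
  have len2: "length (minimal_seq (1, 1)) = 2" by simp
  have s2: "{..<2 :: nat} = {0, 1}" by auto
  have img: "?g ` {..<length (minimal_seq (1, 1))} = {d - 1, ?z}" unfolding len2 s2 by auto
  have ime: "?e ` {..<length ?B} = {..<length ?Q} - {d - 1, ?z}"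
  proof (intro equalityI subsetI)
    fix z assume z: "z \<in> {..<length ?Q} - {d - 1, ?z}"
    show "z \<in> ?e ` {..<length ?B}"
      by (rule image_eqI[where x = "if z < d - 1 then z else if z < ?z then z - 1 else z - 2"])
         (use z assms in \<open>auto simp: b c d\<close>)
  qed (use assms in \<open>auto simp: b c d\<close>)
  have R: "words_lp [?B, minimal_seq (1, 1)] \<simeq> words_lp [?Q]"
  proof (rule split_iso[where e = ?e and g = ?g])
    show "strict_mono_on {..<length ?B} ?e" by (auto simp: strict_mono_on_def)
    show "strict_mono_on {..<length (minimal_seq (1, 1))} ?g" by (auto simp: strict_mono_on_def b c d)
    show "?e ` {..<length ?B} \<union> ?g ` {..<length (minimal_seq (1, 1))} = {..<length ?Q}"
      unfolding img ime by (auto simp: b c d)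
    show "?e ` {..<length ?B} \<inter> ?g ` {..<length (minimal_seq (1, 1))} = {}"
      unfolding img ime by auto
    show "word_perm ?Q ` ?g ` {..<length (minimal_seq (1, 1))} \<subseteq> ?g ` {..<length (minimal_seq (1, 1))}"
      unfolding img using p1 p2 by auto
    show "?Q ! ?e i = ?B ! i" if "i < length ?B" for i
      using that by (auto simp: join_word_def cut_pos_def nth_pair_word nth_list_update b c d)
    show "?Q ! ?g i = minimal_seq (1, 1) ! i" if "i < length (minimal_seq (1, 1))" for i
      using that nth by (simp add: nth_minimal_seq)
  qed
  show ?thesis unfolding wstep_def
  proof (intro exI conjI)
    show "words_lp [?J] \<simeq> words_lp ([] @ [?J])" by (simp add: lp_iso_refl)
    show "words_lp [?B, minimal_seq (1, 1)] \<simeq> words_lp ([] @ [?Q])" using R by simp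
    show "exchange_01 ?J ?Q"
      by (rule exchange_update) (use assms in \<open>auto simp: join_word_def cut_pos_def nth_pair_word nth_list_update b c d\<close>)
  qed
qed

text \<open>
  Once the first summand is reduced to \<open>(1, 0)\<close>, the two vectors change roles under duality.
\<close>

lemma join_word_dual:
  assumes "0 < c" "c < d"
  shows "join_word 1 0 c d = dual_word (join_word d c 0 1)"
  by (rule nth_equalityI)
     (use assms in \<open>auto simp: dual_word_def rev_nth join_word_def cut_pos_def nth_pair_word nth_list_update\<close>)

lemma join_word_last: "join_word 1 0 0 1 = minimal_seq (1, 1)"
  by (simp add: join_word_def pair_word_def cut_pos_def minimal_seq_def upt_rec)

section \<open>Refining a corner of a polygon\<close>

text \<open>
  In these coordinates the slope of \<open>v\<close> is larger than that of \<open>u\<close> if and only if the determinant is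
  positive.
\<close>

definition idet :: "int \<times> int \<Rightarrow> int \<times> int \<Rightarrow> int" where
  "idet u v = fst u * snd v - snd u * fst v"

definition int_pair :: "nat \<times> nat \<Rightarrow> int \<times> int" where
  "int_pair s = (int (fst s), int (snd s))"

definition sdet :: "nat \<times> nat \<Rightarrow> nat \<times> nat \<Rightarrow> int" where
  "sdet s t = idet (int_pair s) (int_pair t)"

lemma sdet_eq: "sdet s t = int (fst s) * int (snd t) - int (snd s) * int (fst t)"
  by (simp add: sdet_def idet_def int_pair_def)

lemma sdet_add [simp]: "sdet (s + t) u = sdet s u + sdet t u" "sdet s (t + u) = sdet s t + sdet s u"
  by (simp_all add: sdet_eq algebra_simps)

lemma sdet_zero [simp]: "sdet 0 s = 0" "sdet s 0 = 0" by (simp_all add: sdet_eq)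

lemma sdet_self [simp]: "sdet s s = 0" by (simp add: sdet_eq)

lemma sdet_anti: "sdet t s = - sdet s t" by (simp add: sdet_eq)

lemma int_pair_add: "int_pair (s + t) = int_pair s + int_pair t" by (simp add: int_pair_def)

lemma idet_add [simp]: "idet (s + t) u = idet s u + idet t u" "idet s (t + u) = idet s t + idet s u"
  by (simp_all add: idet_def algebra_simps)

text \<open>
  Let a polygon arrive at a lattice point \<open>v\<close> with the vector \<open>x\<close> and leave it with the vector \<open>y\<close>. The
  list \<open>as\<close> leads from \<open>v - x\<close> to \<open>v + y\<close> such that any two consecutive points on the way span together
  with \<open>v\<close> a triangle of area \<open>1/2\<close>.
\<close>

inductive fan :: "nat \<times> nat \<Rightarrow> (nat \<times> nat) list \<Rightarrow> nat \<times> nat \<Rightarrow> bool" where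
  base: "sdet x y = 1 \<Longrightarrow> fan x [x + y] y"
| left: "fan x as y \<Longrightarrow> sdet x e = 1 \<Longrightarrow> 0 \<le> sdet e y \<Longrightarrow> fan (x + e) (e # as) y"
| right: "fan x as y \<Longrightarrow> sdet e y = 1 \<Longrightarrow> 0 \<le> sdet x e \<Longrightarrow> fan x (as @ [e]) (e + y)"

lemma fan_sum: "fan x as y \<Longrightarrow> sum_list as = x + y"
  by (induction rule: fan.induct) (auto simp: ac_simps)

lemma fan_pos: "fan x as y \<Longrightarrow> 1 \<le> sdet x y"
  by (induction rule: fan.induct) auto

fun det_sum :: "(nat \<times> nat) list \<Rightarrow> int" where
  "det_sum [] = 0"
| "det_sum (s # ss) = sdet s (sum_list ss) + det_sum ss"

lemma det_sum_append: "det_sum (ss @ [t]) = det_sum ss + sdet (sum_list ss) t"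
  by (induction ss) auto

text \<open>
  Twice the area between the corner and the path, which is cut into triangles of area \<open>1/2\<close>.
\<close>

lemma fan_length: "fan x as y \<Longrightarrow> int (length as) = sdet x y - det_sum as"
proof (induction rule: fan.induct)
  case (left x as y e)
  then show ?case using fan_sum[OF left(1)] sdet_anti[of e x] by simp
next
  case (right x as y e)
  then show ?case using fan_sum[OF right(1)] sdet_anti[of e y] by (simp add: det_sum_append)
qed simp

text \<open>
  For directions \<open>w\<close> between \<open>x\<close> and \<open>y\<close>, no lattice point of the cone at \<open>v\<close>, other than \<open>v\<close> itself,
  lies below the path: it is a combination with non-negative integer coefficients of two consecutive
  points of the path as seen from \<open>v\<close>. The lowest point of the path is estimated by adding all its
  descending segments.
\<close>

lemma fan_support:
  assumes "fan x as y" and q: "q \<noteq> 0" "0 \<le> idet (int_pair x) q" "0 \<le> idet (int_pair y) q"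
    and w: "0 \<le> idet (int_pair x) w" "0 \<le> idet w (int_pair y)"
  shows "idet w q \<ge> idet (int_pair x) w + (\<Sum>a\<leftarrow>as. min 0 (idet w (int_pair a)))"
  using assms
proof (induction arbitrary: q w rule: fan.induct)
  case (base x y)
  \<comment> \<open>In the basis \<open>- x, y\<close> the coordinates of \<open>q\<close> are these determinants.\<close>
  let ?al = "idet (int_pair y) q" and ?be = "idet (int_pair x) q"
  have D: "idet (int_pair x) (int_pair y) = 1" using base by (simp add: sdet_def)
  have q: "fst q = ?be * fst (int_pair y) - ?al * fst (int_pair x)" "snd q = ?be * snd (int_pair y) - ?al * snd (int_pair x)"
  proof -
    have "fst q = idet (int_pair x) (int_pair y) * fst q" "snd q = idet (int_pair x) (int_pair y) * snd q" using D by simp_all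
    then show "fst q = ?be * fst (int_pair y) - ?al * fst (int_pair x)" "snd q = ?be * snd (int_pair y) - ?al * snd (int_pair x)"
      by (simp_all add: idet_def algebra_simps)
  qed
  have wq: "idet w q = ?al * idet (int_pair x) w + ?be * idet w (int_pair y)"
    using arg_cong[OF q(1), of "\<lambda>z. snd w * z"] arg_cong[OF q(2), of "\<lambda>z. fst w * z"]
    by (simp add: idet_def[of w] idet_def[of _ w] algebra_simps)
  have "?al \<noteq> 0 \<or> ?be \<noteq> 0" using q base(2) by (auto simp: prod_eq_iff)
  then have "?al \<ge> 1 \<or> ?be \<ge> 1" using base(3,4) by linarith
  then have "idet w q \<ge> min (idet (int_pair x) w) (idet w (int_pair y))"
  proof
    assume "?al \<ge> 1"
    then have "idet (int_pair x) w \<le> ?al * idet (int_pair x) w" using base(5) by (simp add: mult_le_cancel_right1)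
    then show ?thesis unfolding wq using base by (simp add: add_increasing2 min.coboundedI1)
  next
    assume "?be \<ge> 1"
    then have "idet w (int_pair y) \<le> ?be * idet w (int_pair y)" using base(6) by (simp add: mult_le_cancel_right1)
    then show ?thesis unfolding wq using base by (simp add: add_increasing min.coboundedI2)
  qed
  moreover have "idet w (int_pair x) = - idet (int_pair x) w" by (simp add: idet_def)
  ultimately show ?case by (simp add: int_pair_add min_def split: if_splits)
next
  case (left x as y e)
  have xe: "idet (int_pair x) (int_pair e) = 1" and ey: "0 \<le> idet (int_pair e) (int_pair y)" and xy: "1 \<le> idet (int_pair x) (int_pair y)"
    using left(2,3) fan_pos[OF left(1)] by (simp_all add: sdet_def)
  have we: "idet (int_pair e) w = - idet w (int_pair e)" by (simp add: idet_def)
  \<comment> \<open>The vector \<open>- x\<close> lies in the cone spanned by \<open>- (x + e)\<close> and \<open>y\<close>.\<close>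
  have X: "0 \<le> idet (int_pair x) w"
  proof -
    have "idet (int_pair x) w * (idet (int_pair x) (int_pair y) + idet (int_pair e) (int_pair y)) =
        idet (int_pair x) (int_pair y) * (idet (int_pair x) w + idet (int_pair e) w) + idet (int_pair x) (int_pair e) * idet w (int_pair y)"
      by (simp add: idet_def algebra_simps)
    moreover have "0 \<le> idet (int_pair x) (int_pair y) * (idet (int_pair x) w + idet (int_pair e) w)" using left.prems xy by (simp add: int_pair_add)
    ultimately have "0 \<le> idet (int_pair x) w * (idet (int_pair x) (int_pair y) + idet (int_pair e) (int_pair y))"
      using xe left.prems by simp
    then show ?thesis using xy ey by (simp add: zero_le_mult_iff)
  qed
  have sum0: "(\<Sum>a\<leftarrow>as. min 0 (idet w (int_pair a))) \<le> 0" by (intro sum_list_nonpos) auto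
  show ?case
  proof (cases "0 \<le> idet (int_pair x) q")
    case True
    have "idet w q \<ge> idet (int_pair x) w + (\<Sum>a\<leftarrow>as. min 0 (idet w (int_pair a)))"
      using left.IH[OF left.prems(1) True left.prems(3) X] left.prems by simp
    then show ?thesis using we by (simp add: int_pair_add)
  next
    case False
    \<comment> \<open>The coordinates of \<open>q\<close> in the basis \<open>- (x + e), - x\<close>.\<close>
    let ?al = "- idet (int_pair x) q" and ?be = "idet (int_pair x) q + idet (int_pair e) q"
    have be: "?be \<ge> 0" using left.prems by (simp add: int_pair_add)
    have "idet w q * idet (int_pair x) (int_pair e) = ?al * (idet (int_pair x) w + idet (int_pair e) w) + ?be * idet (int_pair x) w"
      by (simp add: idet_def algebra_simps)
    then have "idet w q = ?al * (idet (int_pair x) w + idet (int_pair e) w) + ?be * idet (int_pair x) w" using xe by simp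
    moreover have "idet (int_pair x) w + idet (int_pair e) w \<le> ?al * (idet (int_pair x) w + idet (int_pair e) w)"
      using False left.prems by (simp only: mult_le_cancel_right1 int_pair_add idet_add) linarith
    moreover have "0 \<le> ?be * idet (int_pair x) w" using be X by (rule mult_nonneg_nonneg)
    ultimately have "idet w q \<ge> idet (int_pair x) w + idet (int_pair e) w" by linarith
    then show ?thesis using sum0 by (simp add: int_pair_add)
  qed
next
  case (right x as y e)
  have ey: "idet (int_pair e) (int_pair y) = 1" and xe: "0 \<le> idet (int_pair x) (int_pair e)" and xy: "1 \<le> idet (int_pair x) (int_pair y)"
    using right(2,3) fan_pos[OF right(1)] by (simp_all add: sdet_def)
  have Y: "0 \<le> idet w (int_pair y)"
  proof -
    have "idet w (int_pair y) * (idet (int_pair x) (int_pair y) + idet (int_pair x) (int_pair e)) =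
        idet (int_pair x) (int_pair y) * (idet w (int_pair e) + idet w (int_pair y)) + idet (int_pair e) (int_pair y) * idet (int_pair x) w"
      by (simp add: idet_def algebra_simps)
    moreover have "0 \<le> idet (int_pair x) (int_pair y) * (idet w (int_pair e) + idet w (int_pair y))" using right.prems xy by (simp add: int_pair_add)
    ultimately have "0 \<le> idet w (int_pair y) * (idet (int_pair x) (int_pair y) + idet (int_pair x) (int_pair e))"
      using ey right.prems by simp
    then show ?thesis using xy xe by (simp add: zero_le_mult_iff)
  qed
  have total: "idet (int_pair x) w + (\<Sum>a\<leftarrow>as. min 0 (idet w (int_pair a))) \<le> idet w (int_pair y)"
  proof -
    have "(\<Sum>a\<leftarrow>as. min 0 (idet w (int_pair a))) \<le> (\<Sum>a\<leftarrow>as. idet w (int_pair a))" by (intro sum_list_mono) auto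
    also have "\<dots> = idet w (int_pair (sum_list as))"
      by (induction as) (auto simp: int_pair_add, auto simp: int_pair_def idet_def)
    also have "\<dots> = idet w (int_pair y) - idet (int_pair x) w"
      using fan_sum[OF right(1)] by (simp add: int_pair_add) (simp add: idet_def)
    finally show ?thesis by simp
  qed
  show ?case
  proof (cases "0 \<le> idet (int_pair y) q")
    case True
    have "idet w q \<ge> idet (int_pair x) w + (\<Sum>a\<leftarrow>as. min 0 (idet w (int_pair a)))"
      using right.IH[OF right.prems(1,2) True right.prems(4) Y] .
    then show ?thesis by simp
  next
    case False
    \<comment> \<open>The coordinates of \<open>q\<close> in the basis \<open>e + y, y\<close>.\<close>
    let ?al = "- idet (int_pair y) q" and ?be = "idet (int_pair e) q + idet (int_pair y) q"
    have be: "?be \<ge> 0" using right.prems by (simp add: int_pair_add)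
    have "idet w q * idet (int_pair e) (int_pair y) = ?al * (idet w (int_pair e) + idet w (int_pair y)) + ?be * idet w (int_pair y)"
      by (simp add: idet_def algebra_simps)
    then have "idet w q = ?al * (idet w (int_pair e) + idet w (int_pair y)) + ?be * idet w (int_pair y)" using ey by simp
    moreover have "idet w (int_pair e) + idet w (int_pair y) \<le> ?al * (idet w (int_pair e) + idet w (int_pair y))"
      using False right.prems by (simp only: mult_le_cancel_right1 int_pair_add idet_add) linarith
    moreover have "0 \<le> ?be * idet w (int_pair y)" using be Y by (rule mult_nonneg_nonneg)
    ultimately have "idet w q \<ge> idet w (int_pair e) + idet w (int_pair y)" by linarith
    then show ?thesis using total by simp
  qed
qed

lemma fan_dual: "fan x as y \<Longrightarrow> fan (prod.swap y) (rev (map prod.swap as)) (prod.swap x)"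
proof (induction rule: fan.induct)
  have sw: "sdet (prod.swap t) (prod.swap s) = sdet s t" for s t by (simp add: sdet_eq)
  have add: "prod.swap (s + t) = prod.swap t + prod.swap s" for s t :: "nat \<times> nat" by (simp add: prod_eq_iff)
  {
    case (base x y)
    then show ?case using fan.base[of "prod.swap y" "prod.swap x"] by (simp add: sw add)
  next
    case (left x as y e)
    then show ?case using fan.right[OF left.IH, of "prod.swap e"] by (simp add: sw add)
  next
    case (right x as y e)
    then show ?case using fan.left[OF right.IH, of "prod.swap e"] by (simp add: sw add)
  }
qed

text \<open>
  The effect of \<^const>\<open>lift_word\<close> on the vector of a minimal module.
\<close>

definition shear :: "nat \<times> nat \<Rightarrow> nat \<times> nat" where
  "shear s = (fst s + snd s, snd s)"

lemma shear_add: "shear (s + t) = shear s + shear t" by (simp add: shear_def)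

lemma sdet_shear [simp]: "sdet (shear s) (shear t) = sdet s t"
  by (simp add: sdet_eq shear_def algebra_simps)

lemma fan_shear: "fan x as y \<Longrightarrow> fan (shear x) (map shear as) (shear y)"
  by (induction rule: fan.induct) (auto simp: shear_add intro: fan.intros)

lemma sdet_trans:
  assumes "0 \<le> sdet s t" "0 \<le> sdet t u" "t \<noteq> 0"
  shows "0 \<le> sdet s u"
proof -
  have "sdet s u * int (fst t) = sdet s t * int (fst u) + sdet t u * int (fst s)"
    "sdet s u * int (snd t) = sdet s t * int (snd u) + sdet t u * int (snd s)"
    by (simp_all add: sdet_eq algebra_simps)
  then have "0 \<le> sdet s u * int (fst t)" "0 \<le> sdet s u * int (snd t)" using assms by simp_all
  then show ?thesis using assms(3) by (auto simp: zero_le_mult_iff prod_eq_iff)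
qed

text \<open>
  Since both determinants with \<open>x\<close> are 1, \<open>e = u + k x\<close> for \<open>k\<close> the determinant of \<open>e\<close> and \<open>u\<close>. A
  negative \<open>k\<close> would make \<open>u\<close> at least as large as \<open>x = x' + u\<close>, although \<open>x'\<close> is not zero.
\<close>

lemma parents_convex:
  assumes "sdet x e = 1" "x = x' + u" "sdet x' u = 1"
  shows "0 \<le> sdet e u"
proof (rule ccontr)
  assume neg: "\<not> 0 \<le> sdet e u"
  have xu: "sdet x u = 1" using assms by simp
  have "int (fst u) * sdet x e + sdet e u * int (fst x) = int (fst e) * sdet x u"
    "int (snd u) * sdet x e + sdet e u * int (snd x) = int (snd e) * sdet x u"
    by (simp_all add: sdet_eq algebra_simps)
  then have e: "int (fst u) + sdet e u * int (fst x) = int (fst e)" "int (snd u) + sdet e u * int (snd x) = int (snd e)"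
    using assms xu by simp_all
  have "sdet e u * int (fst x) \<le> - int (fst x)" "sdet e u * int (snd x) \<le> - int (snd x)"
    using neg mult_right_mono[of "sdet e u" "-1" "int (fst x)"] mult_right_mono[of "sdet e u" "-1" "int (snd x)"] by auto
  then have "fst e = 0" "snd e = 0" using e assms(2) by auto
  then show False using assms(1) by (simp add: sdet_eq)
qed

text \<open>
  The neighbours of \<open>b / a\<close> in the Stern-Brocot tree; \<open>a1\<close> is the inverse of \<open>b\<close> modulo \<open>a\<close>.
\<close>

lemma parents_exist:
  assumes "coprime a b" "0 < b" "b < (a :: nat)"
  shows "\<exists>a1 b1 a2 b2. a = a1 + a2 \<and> b = b1 + b2 \<and> a1 * b2 = a2 * b1 + 1 \<and> b1 < a1 \<and> b2 \<le> a2 \<and>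
    (a = b + 1 \<longrightarrow> a1 = b \<and> b1 = b - 1 \<and> a2 = 1 \<and> b2 = 1)"
proof (cases "a = b + 1")
  case True
  show ?thesis
    by (intro exI[of _ b] exI[of _ "b - 1"] exI[of _ 1]) (use True assms in auto)
next
  case False
  have a: "1 < a" using assms by simp
  obtain r where r: "[b * r = 1] (mod a)"
    using cong_solve_coprime_nat[of b a] assms(1) by (auto simp: coprime_commute)
  define a1 where "a1 = r mod a"
  have "[b * a1 = 1] (mod a)" using r unfolding a1_def by (simp add: cong_def mod_simps)
  then have m: "(b * a1) mod a = 1" using a by (simp add: cong_def)
  define b1 where "b1 = b * a1 div a"
  have eq: "b * a1 = a * b1 + 1" using m mult_div_mod_eq[of a "b * a1"] by (simp add: b1_def)
  have a1: "a1 < a" "0 < a1" using a m by (auto simp: a1_def intro: gr0I)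
  have "a * b1 < b * a1" using eq by simp
  also have "\<dots> \<le> b * a" using a1 by simp
  finally have b1: "b1 < b" using assms by (simp add: mult.commute)
  have "a * b1 < a * a1" using eq assms a1 by (metis add_less_cancel_right less_add_one mult_less_mono1 nat_less_le order.strict_trans1 Suc_eq_plus1 le_less_Suc_eq not_less_eq)
  then have b1a: "b1 < a1" by simp
  let ?a2 = "a - a1" and ?b2 = "b - b1"
  have "int a * (int ?b2 - int ?a2) = 1 - (int a - int b) * int ?a2 "
    using arg_cong[OF eq, of int] a1 b1 by (simp add: of_nat_diff algebra_simps)
  also have "\<dots> \<le> 0"
  proof -
    have "1 * 1 \<le> (int a - int b) * int ?a2" using a1 assms by (intro mult_mono) auto
    then show ?thesis by linarith
  qed
  finally have "int ?b2 \<le> int ?a2" using a by (simp add: mult_le_0_iff)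
  then have b2: "?b2 \<le> ?a2" by simp
  have "int (a1 * ?b2) = int (?a2 * b1 + 1)"
    using arg_cong[OF eq, of int] a1 b1 by (simp add: of_nat_diff algebra_simps)
  then have d: "a1 * ?b2 = ?a2 * b1 + 1" by (simp only: of_nat_eq_iff)
  show ?thesis by (intro exI[of _ a1] exI[of _ b1] exI[of _ ?a2] exI[of _ ?b2]) (use False a1 b1 b1a b2 d in auto)
qed

abbreviation coprime_pair :: "nat \<times> nat \<Rightarrow> bool" where "coprime_pair s \<equiv> coprime (fst s) (snd s)"

lemma coprime_pair_nonzero: "coprime_pair s \<Longrightarrow> s \<noteq> 0" by auto

lemma det_coprime_pair: "sdet s t = 1 \<Longrightarrow> coprime_pair s" "sdet s t = 1 \<Longrightarrow> coprime_pair t"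
proof -
  assume d: "sdet s t = 1"
  have "g dvd 1" if "g dvd fst s" "g dvd snd s" for g
  proof -
    have "int g dvd sdet s t" using that unfolding sdet_eq by (intro dvd_diff dvd_mult2) auto
    then show ?thesis using d by simp
  qed
  then show "coprime_pair s" by (rule coprimeI)
  have "g dvd 1" if "g dvd fst t" "g dvd snd t" for g
  proof -
    have "int g dvd sdet s t" using that unfolding sdet_eq by (intro dvd_diff dvd_mult) auto
    then show ?thesis using d by simp
  qed
  then show "coprime_pair t" by (rule coprimeI)
qed

text \<open>
  Going from \<open>(a, b)\<close> to its lower parent again and again ends at \<open>(1, 0)\<close>; the vectors \<open>es\<close> are the upper
  parents met on the way. Each of them extends fans, costs one exchange, and by
  \<open>parents_convex\<close> they come in the order of increasing slopes; the condition on the head of \<open>es\<close>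
  is what this argument needs in the induction.
\<close>

lemma lower_chain:
  assumes "coprime a b" "b < a"
  shows "\<exists>es. (\<forall>as y. fan (1, 0) as y \<longrightarrow> fst y < snd y \<longrightarrow> fan (a, b) (es @ as) y) \<and>
    sorted_wrt (\<lambda>s t. 0 \<le> sdet s t) es \<and> (\<forall>e\<in>set es. coprime_pair e \<and> 0 \<le> sdet (a, b) e \<and> snd e \<le> fst e) \<and>
    (\<forall>e es'. es = e # es' \<longrightarrow> (\<exists>x. (a, b) = x + e \<and> sdet x e = 1)) \<and>
    (\<forall>c d. coprime c d \<longrightarrow> c < d \<longrightarrow>
       wsteps (length es) (map minimal_seq es @ [join_word 1 0 c d]) [join_word a b c d])"
  using assms
proof (induction b arbitrary: a rule: less_induct)
  case (less b)
  show ?case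
  proof (cases "b = 0")
    case True
    then have "a = 1" using less.prems by simp
    then show ?thesis using True by (intro exI[where x = "[]"]) (auto intro: wsteps_0 lp_iso_refl)
  next
    case False
    obtain a1 b1 a2 b2 where p: "a = a1 + a2" "b = b1 + b2" "a1 * b2 = a2 * b1 + 1" "b1 < a1" "b2 \<le> a2"
      "a = b + 1 \<longrightarrow> a1 = b \<and> b1 = b - 1 \<and> a2 = 1 \<and> b2 = 1"
      using parents_exist[OF less.prems(1) _ less.prems(2)] False by blast
    let ?x = "(a1, b1)" and ?e = "(a2, b2)"
    have det: "sdet ?x ?e = 1" using arg_cong[OF p(3), of int] by (simp add: sdet_eq)
    have "0 < b2" using p(3) by (cases b2) auto
    then have "b1 < b" using p(2) by simp
    moreover have "coprime a1 b1" using det_coprime_pair(1)[OF det] by simp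
    ultimately obtain es where es: "\<forall>as y. fan (1, 0) as y \<longrightarrow> fst y < snd y \<longrightarrow> fan ?x (es @ as) y"
      "sorted_wrt (\<lambda>s t. 0 \<le> sdet s t) es" "\<forall>e\<in>set es. coprime_pair e \<and> 0 \<le> sdet ?x e \<and> snd e \<le> fst e"
      "\<forall>e es'. es = e # es' \<longrightarrow> (\<exists>x. ?x = x + e \<and> sdet x e = 1)"
      "\<forall>c d. coprime c d \<longrightarrow> c < d \<longrightarrow>
       wsteps (length es) (map minimal_seq es @ [join_word 1 0 c d]) [join_word a1 b1 c d]"
      using less.IH[of b1 a1] p(4) by blast
    have xe: "(a, b) = ?x + ?e" using p(1,2) by simp
    have e0: "?e \<noteq> 0" using \<open>0 < b2\<close> by (simp add: prod_eq_iff)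
    have ge: "0 \<le> sdet ?e u" if "u \<in> set es" for u
    proof -
      obtain v es' where v: "es = v # es'" using \<open>u \<in> set es\<close> by (cases es) auto
      then obtain x' where "?x = x' + v" "sdet x' v = 1" using es(4) by blast
      then have ev: "0 \<le> sdet ?e v" using parents_convex[OF det] by blast
      show ?thesis
      proof (cases "u = v")
        case False
        then have "0 \<le> sdet v u" using es(2) that v by simp
        moreover have "v \<noteq> 0" using es(3) v coprime_pair_nonzero by auto
        ultimately show ?thesis using sdet_trans[OF ev] by blast
      qed (use ev in simp)
    qed
    show ?thesis
    proof (intro exI[where x = "?e # es"] conjI allI impI ballI)
      fix as y assume y: "fan (1, 0) as y" "fst y < (snd y :: nat)"
      have "b2 * fst y \<le> a2 * snd y" using p(5) y(2) by (intro mult_mono) auto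
      then have "0 \<le> sdet ?e y" by (simp add: sdet_eq flip: of_nat_mult)
      moreover have "fan ?x (es @ as) y" using es(1) y by blast
      ultimately have "fan (?x + ?e) (?e # es @ as) y" using det by (intro fan.left)
      then show "fan (a, b) ((?e # es) @ as) y" unfolding xe by simp
    next
      show "sorted_wrt (\<lambda>s t. 0 \<le> sdet s t) (?e # es)" using es(2) ge by simp
      fix e assume e: "e \<in> set (?e # es)"
      then show "coprime_pair e" using es(3) det_coprime_pair(2)[OF det] by auto
      have "0 \<le> sdet ?x e + sdet ?e e" using e es(3) ge[of e] det by auto
      then show "0 \<le> sdet (a, b) e" unfolding xe by (simp only: sdet_add)
      show "snd e \<le> fst e" using e es(3) p(5) by auto
    next
      fix e es' assume "?e # es = e # es'"
      then show "\<exists>x. (a, b) = x + e \<and> sdet x e = 1" using xe det by (intro exI[where x = ?x]) simp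
    next
      fix c d :: nat assume cd: "coprime c d" "c < d"
      have w: "wstep [join_word a1 b1 c d, minimal_seq ?e] [join_word a b c d]"
      proof (cases "c \<noteq> 0 \<and> a = b + 1")
        case True
        then show ?thesis using p(6) cut_step_special[of b c d] False cd by simp
      next
        case False
        then have "c = 0 \<or> b1 + b2 + 1 < a1 + a2" using p(1,2) less.prems(2) by linarith
        then show ?thesis using cut_step_regular[OF p(3) _ cd(1) p(4,5) cd(2)] p(1,2) less.prems(1) by simp
      qed
      have "wsteps (length es) ([minimal_seq ?e] @ (map minimal_seq es @ [join_word 1 0 c d]))
          ([minimal_seq ?e] @ [join_word a1 b1 c d])"
        using es(5) cd by (intro wsteps_append) blast
      then have "wsteps (length es) (map minimal_seq (?e # es) @ [join_word 1 0 c d]) [join_word a1 b1 c d, minimal_seq ?e]"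
        by (rule wsteps_iso[rotated]) (auto intro!: lp_sum_mset)
      then show "wsteps (length (?e # es)) (map minimal_seq (?e # es) @ [join_word 1 0 c d]) [join_word a b c d]"
        using wsteps_Suc w by fastforce
    qed
  qed
qed

text \<open>
  The corner with the vectors \<open>x\<close> and \<open>y\<close> can be replaced by the convex path \<open>as\<close>, at the cost of one
  exchange for every vector of the path.
\<close>

definition refines :: "nat \<times> nat \<Rightarrow> nat \<times> nat \<Rightarrow> (nat \<times> nat) list \<Rightarrow> bool" where
  "refines x y as \<longleftrightarrow> fan x as y \<and> sorted_wrt (\<lambda>s t. 0 \<le> sdet s t) as \<and>
     (\<forall>s\<in>set as. coprime_pair s \<and> 0 \<le> sdet x s \<and> 0 \<le> sdet s y) \<and>
     wsteps (length as) (map minimal_seq as) [minimal_seq x, minimal_seq y]"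

lemma dual_minimal_seq: "dual_word (minimal_seq s) = minimal_seq (prod.swap s)"
  by (cases s) (simp add: dual_word_def minimal_seq_def)

lemma lift_minimal_seq: "lift_word (minimal_seq s) = minimal_seq (shear s)"
proof (cases s)
  case (Pair a b)
  have "zeros_before (minimal_seq (a, b)) (a + b) = b" by (simp add: zeros_before_minimal_seq)
  then show ?thesis
    by (simp add: Pair shear_def lift_word_def)
       (simp add: minimal_seq_def add.commute flip: append_assoc replicate_add)
qed

lemma sdet_swap: "sdet (prod.swap t) (prod.swap s) = sdet s t" by (simp add: sdet_eq)

lemma refines_dual: "refines x y as \<Longrightarrow> refines (prod.swap y) (prod.swap x) (rev (map prod.swap as))"
proof -
  assume r: "refines x y as"
  have "wsteps (length as) (map dual_word (map minimal_seq as)) (map dual_word [minimal_seq x, minimal_seq y])"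
    using r unfolding refines_def by (blast intro: wsteps_dual)
  then have "wsteps (length as) (map minimal_seq (map prod.swap as)) [minimal_seq (prod.swap x), minimal_seq (prod.swap y)]"
    by (simp add: dual_minimal_seq o_def)
  then have "wsteps (length as) (map minimal_seq (rev (map prod.swap as))) [minimal_seq (prod.swap y), minimal_seq (prod.swap x)]"
    by (rule wsteps_iso[rotated]) (auto intro!: lp_sum_mset simp: rev_map)
  then show ?thesis using r fan_dual unfolding refines_def
    by (auto simp: sorted_wrt_rev sorted_wrt_map sdet_swap coprime_commute)
qed

lemma refines_shear: "refines x y as \<Longrightarrow> refines (shear x) (shear y) (map shear as)"
proof -
  assume r: "refines x y as"
  have "wsteps (length as) (map lift_word (map minimal_seq as)) (map lift_word [minimal_seq x, minimal_seq y])"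
    using r unfolding refines_def by (blast intro: wsteps_lift)
  then have "wsteps (length as) (map minimal_seq (map shear as)) [minimal_seq (shear x), minimal_seq (shear y)]"
    by (simp add: lift_minimal_seq o_def)
  moreover have "coprime_pair (shear s)" if "coprime_pair s" for s
    using that by (simp add: shear_def coprime_iff_gcd_eq_1)
  ultimately show ?thesis using r fan_shear unfolding refines_def
    by (auto simp: sorted_wrt_map)
qed

text \<open>
  The first exchange merges the two cycles. Then the upper parents on the side of \<open>x\<close> are cut off one
  by one until \<open>x\<close> has become \<open>(1, 0)\<close>, and dually those on the side of \<open>y\<close> until it has become \<open>(0, 1)\<close>.
  What remains is the sequence \<open>1 0\<close> of \<open>(1, 1)\<close>.
\<close>

lemma refines_exists_reduced:
  assumes "coprime a b" "coprime c d" "b < a" "c < d"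
  shows "\<exists>as. refines (a, b) (c, d) as"
proof -
  let ?x = "(a, b)" and ?y = "(c, d)"
  obtain es where es: "\<forall>as y. fan (1, 0) as y \<longrightarrow> fst y < snd y \<longrightarrow> fan ?x (es @ as) y"
      "sorted_wrt (\<lambda>s t. 0 \<le> sdet s t) es" "\<forall>e\<in>set es. coprime_pair e \<and> 0 \<le> sdet ?x e \<and> snd e \<le> fst e"
      "\<forall>c d. coprime c d \<longrightarrow> c < d \<longrightarrow>
       wsteps (length es) (map minimal_seq es @ [join_word 1 0 c d]) [join_word a b c d]"
    using lower_chain[OF assms(1,3)] by blast
  have "coprime d c" using assms(2) by (simp add: coprime_commute)
  then obtain fs where fs: "\<forall>as y. fan (1, 0) as y \<longrightarrow> fst y < snd y \<longrightarrow> fan (d, c) (fs @ as) y"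
      "sorted_wrt (\<lambda>s t. 0 \<le> sdet s t) fs" "\<forall>e\<in>set fs. coprime_pair e \<and> 0 \<le> sdet (d, c) e \<and> snd e \<le> fst e"
      "\<forall>c' d'. coprime c' d' \<longrightarrow> c' < d' \<longrightarrow>
       wsteps (length fs) (map minimal_seq fs @ [join_word 1 0 c' d']) [join_word d c c' d']"
    using lower_chain[of d c] assms(4) by blast
  let ?gs = "rev (map prod.swap fs)"
  let ?as = "es @ (1, 1) # ?gs"
  have gs: "coprime_pair g" "0 \<le> sdet g ?y" "fst g \<le> snd g" if "g \<in> set ?gs" for g
    using that fs(3) by (auto simp: coprime_commute sdet_eq mult.commute)
  show ?thesis unfolding refines_def
  proof (intro exI[where x = ?as] conjI ballI)
    have "fan (1, 0) [(1, 1)] (0, 1)" using fan.base[of "(1, 0)" "(0, 1)"] by (simp add: sdet_eq)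
    then have "fan (d, c) (fs @ [(1, 1)]) (0, 1)" using fs(1) by simp
    from fan_dual[OF this] have "fan (1, 0) ((1, 1) # ?gs) (c, d)" by simp
    then show "fan ?x ?as ?y" using es(1) assms by simp
    have le: "0 \<le> sdet e g" if "snd e \<le> fst e" "fst g \<le> snd g" for e g
    proof -
      have "snd e * fst g \<le> fst e * snd g" using that by (intro mult_mono) auto
      then show ?thesis by (simp add: sdet_eq flip: of_nat_mult)
    qed
    have "sorted_wrt (\<lambda>s t. 0 \<le> sdet s t) ?gs" using fs(2) by (simp add: sorted_wrt_rev sorted_wrt_map sdet_swap)
    then show "sorted_wrt (\<lambda>s t. 0 \<le> sdet s t) ?as"
      using es(2,3) gs le by (simp add: sorted_wrt_append)
    fix s assume s: "s \<in> set ?as"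
    then consider "s \<in> set es" | "s = (1, 1)" | "s \<in> set ?gs" by auto
    then show "coprime_pair s" "0 \<le> sdet ?x s" "0 \<le> sdet s ?y"
      using es(3) gs le[of ?x s] le[of s ?y] assms by (cases; force)+
  next
    have "wsteps (length fs) (map minimal_seq fs @ [join_word 1 0 0 1]) [join_word d c 0 1]"
      using fs(4) by simp
    from wsteps_dual[OF this]
    have "wsteps (length fs) (map minimal_seq (map prod.swap fs) @ [minimal_seq (1, 1)]) [dual_word (join_word d c 0 1)]"
      by (simp add: dual_minimal_seq o_def join_word_last[unfolded One_nat_def])
    moreover have "dual_word (join_word d c 0 1) = join_word 1 0 c d"
    proof (cases "c = 0")
      case True
      then show ?thesis using assms by (simp add: join_word_last[unfolded One_nat_def] dual_minimal_seq)
    next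
      case False then show ?thesis using join_word_dual[of c d] assms by simp
    qed
    ultimately have "wsteps (length fs) (map minimal_seq (map prod.swap fs) @ [minimal_seq (1, 1)]) [join_word 1 0 c d]"
      by simp
    from wsteps_append[OF this, of "map minimal_seq es"]
    have "wsteps (length fs) (map minimal_seq es @ map minimal_seq (map prod.swap fs) @ [minimal_seq (1, 1)])
       (map minimal_seq es @ [join_word 1 0 c d])" .
    from wsteps_trans[OF this] have "wsteps (length fs + length es)
       (map minimal_seq es @ map minimal_seq (map prod.swap fs) @ [minimal_seq (1, 1)]) [join_word a b c d]"
      using es(4) assms by blast
    from wsteps_Suc[OF this join_step[OF assms]]
    have "wsteps (length ?as) (map minimal_seq es @ map minimal_seq (map prod.swap fs) @ [minimal_seq (1, 1)])
       [minimal_seq ?x, minimal_seq ?y]" by (simp add: add.commute)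
    then show "wsteps (length ?as) (map minimal_seq ?as) [minimal_seq ?x, minimal_seq ?y]"
      by (rule wsteps_iso[OF _ _ lp_iso_refl, rotated]) (auto intro!: lp_sum_mset simp: rev_map)
  qed
qed

text \<open>
  The Euclidean algorithm on both vectors at once: as long as they lie on the same side of the
  diagonal, both come from smaller vectors by a shear, or by a shear and duality.
\<close>

lemma refines_exists:
  assumes "coprime_pair x" "coprime_pair y" "1 \<le> sdet x y"
  shows "\<exists>as. refines x y as"
  using assms
proof (induction "fst x + snd x + fst y + snd y" arbitrary: x y rule: less_induct)
  case less
  obtain a b where x: "x = (a, b)" by (cases x)
  obtain c d where y: "y = (c, d)" by (cases y)
  have "int b * int c < int a * int d" using less.prems by (simp add: x y sdet_eq)
  then have lt: "b * c < a * d" by (simp flip: of_nat_mult)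
  have pos: "0 < a" "0 < d" using lt by (auto intro: gr0I)
  consider (1) "b < a" "c < d" | (2) "b \<le> a" "d \<le> c" | (3) "a \<le> b" "c \<le> d"
  proof (cases "b < a")
    case False
    then have "a * c \<le> b * c" by simp
    then have "a * c < a * d" using lt by (rule le_less_trans)
    then show ?thesis using False that(3) by simp
  qed (use that in linarith)
  then show ?case
  proof cases
    case 1
    then show ?thesis using refines_exists_reduced less.prems unfolding x y by simp
  next
    case 2
    let ?x = "(a - b, b)" and ?y = "(c - d, d)"
    have s: "shear ?x = x" "shear ?y = y" using 2 by (simp_all add: shear_def x y)
    have "coprime_pair ?x" "coprime_pair ?y" using less.prems 2 gcd_diff1_nat[of b a] gcd_diff1_nat[of d c]
      by (simp_all add: x y coprime_iff_gcd_eq_1)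
    moreover have "sdet ?x ?y = sdet x y" using sdet_shear[of ?x ?y] unfolding s by simp
    ultimately obtain as where "refines ?x ?y as"
      using less.hyps[of ?x ?y] less.prems 2 pos by (auto simp: x y)
    from refines_shear[OF this] show ?thesis unfolding s by blast
  next
    case 3
    let ?x = "(d - c, c)" and ?y = "(b - a, a)"
    have s: "shear ?x = prod.swap y" "shear ?y = prod.swap x" using 3 by (simp_all add: shear_def x y)
    have "coprime_pair ?x" "coprime_pair ?y" using less.prems 3 gcd_diff1_nat[of a b] gcd_diff1_nat[of c d]
      by (simp_all add: x y coprime_iff_gcd_eq_1 gcd.commute)
    moreover have "sdet ?x ?y = sdet x y" using sdet_shear[of ?x ?y] unfolding s by (simp add: sdet_swap)
    ultimately obtain as where "refines ?x ?y as"
      using less.hyps[of ?x ?y] less.prems 3 pos by (auto simp: x y)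
    from refines_dual[OF refines_shear[OF this, unfolded s]] show ?thesis by auto
  qed
qed

section \<open>The Frobenius map\<close>

lemma frob_zero [simp]: "CHAR('k::alg_closed_field) > 0 \<Longrightarrow> frob (0 :: 'k) = 0"
  by (simp add: frob_def)

lemma frob_add: "CHAR('k::alg_closed_field) > 0 \<Longrightarrow> frob (x + y :: 'k) = frob x + frob y"
  unfolding frob_def by (intro freshmans_dream prime_CHAR_semidom) auto

lemma frob_mult: "frob (x * y) = frob x * frob y"
  by (simp add: frob_def power_mult_distrib)

lemma frob_bij:
  assumes "CHAR('k::alg_closed_field) > 0"
  shows "bij (frob :: 'k \<Rightarrow> 'k)"
proof (rule bijI)
  show "inj (frob :: 'k \<Rightarrow> 'k)"
  proof (rule injI)
    fix x y :: 'k assume eq: "frob x = frob y"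
    have "frob x = frob (x - y) + frob y" using frob_add[OF assms, of "x - y" y] by simp
    then have "frob (x - y) = 0" using eq by simp
    then show "x = y" using assms by (simp add: frob_def)
  qed
  show "surj (frob :: 'k \<Rightarrow> 'k)"
    using nth_root_exists[OF assms] unfolding frob_def surj_def by metis
qed

lemma frob_frob_inv [simp]:
  assumes "CHAR('k::alg_closed_field) > 0"
  shows "frob (frob_inv x :: 'k) = x" "frob_inv (frob x :: 'k) = x"
  using frob_bij[OF assms] by (simp_all add: frob_inv_def bij_is_surj surj_f_inv_f bij_is_inj)

lemma frob_eq_0 [simp]: "CHAR('k::alg_closed_field) > 0 \<Longrightarrow> frob (x :: 'k) = 0 \<longleftrightarrow> x = 0"
  by (simp add: frob_def)

lemma frob_inv_zero [simp]: "CHAR('k::alg_closed_field) > 0 \<Longrightarrow> frob_inv (0 :: 'k) = 0"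
  using frob_frob_inv(2)[of "0 :: 'k"] by simp

lemma frob_inv_eq_0 [simp]: "CHAR('k::alg_closed_field) > 0 \<Longrightarrow> frob_inv (x :: 'k) = 0 \<longleftrightarrow> x = 0"
  using frob_frob_inv(1)[of x] frob_zero[where 'k = 'k] frob_inv_zero[where 'k = 'k] by metis

lemma frob_inv_add: "CHAR('k::alg_closed_field) > 0 \<Longrightarrow> frob_inv (x + y :: 'k) = frob_inv x + frob_inv y"
  using frob_add[of "frob_inv x" "frob_inv y"] frob_frob_inv by metis

lemma frob_inv_mult: "CHAR('k::alg_closed_field) > 0 \<Longrightarrow> frob_inv (x * y :: 'k) = frob_inv x * frob_inv y"
  using frob_mult[of "frob_inv x" "frob_inv y"] frob_frob_inv by metis

section \<open>The module of a labelled permutation\<close>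

text \<open>
  The maps of a module are unspecified outside the carrier, so that different descriptions of a module
  agree only there.
\<close>

definition dm1_agree :: "('k::field, 'i) dm1 \<Rightarrow> ('k, 'i) dm1 \<Rightarrow> bool" where
  "dm1_agree N M \<longleftrightarrow> dm1_carrier N = dm1_carrier M \<and>
     (\<forall>x\<in>dm1_carrier N. dm1_F N x = dm1_F M x \<and> dm1_V N x = dm1_V M x)"

definition coord_space :: "'i set \<Rightarrow> ('i \<Rightarrow> 'k::field) set" where
  "coord_space T = {x. \<forall>i. i \<notin> T \<longrightarrow> x i = 0}"

definition lp_module :: "'i lp \<Rightarrow> ('k::field, 'i) dm1" where
  "lp_module = (\<lambda>(T, d, p). \<lparr> dm1_carrier = coord_space T,
     dm1_F = (\<lambda>x s. if s \<in> T \<and> \<not> d (inv_into T p s) then frob (x (inv_into T p s)) else 0),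
     dm1_V = (\<lambda>x t. if t \<in> T \<and> d t then frob_inv (x (p t)) else 0) \<rparr>)"

lemma semilinear_on_cong:
  assumes "fun_vs.subspace N" "\<And>x. x \<in> N \<Longrightarrow> f x = g x"
  shows "semilinear_on s N f \<longleftrightarrow> semilinear_on s N g"
proof -
  have "x + y \<in> N" "fscale c x \<in> N" if "x \<in> N" "y \<in> N" for x y c
    using fun_vs.subspace_add[OF assms(1)] fun_vs.subspace_scale[OF assms(1)] that by auto
  then show ?thesis unfolding semilinear_on_def using assms(2) by auto
qed

lemma is_dm1_agree:
  assumes "dm1_agree N M" "is_dm1 h M"
  shows "is_dm1 h N"
proof -
  let ?N = "dm1_carrier M"
  have eq: "dm1_carrier N = ?N" "\<And>x. x \<in> ?N \<Longrightarrow> dm1_F N x = dm1_F M x" "\<And>x. x \<in> ?N \<Longrightarrow> dm1_V N x = dm1_V M x"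
    using assms(1) by (auto simp: dm1_agree_def)
  have sub: "fun_vs.subspace ?N" using assms(2) by (simp add: is_dm1_def)
  have "dm1_F N ` ?N = dm1_F M ` ?N" "dm1_V N ` ?N = dm1_V M ` ?N"
    "{x \<in> ?N. dm1_F N x = 0} = {x \<in> ?N. dm1_F M x = 0}" "{x \<in> ?N. dm1_V N x = 0} = {x \<in> ?N. dm1_V M x = 0}"
    using eq by auto
  then show ?thesis
    using assms(2) semilinear_on_cong[OF sub eq(2)] semilinear_on_cong[OF sub eq(3)]
    unfolding is_dm1_def eq(1) by simp
qed

lemma dm1_agree_iso:
  assumes "dm1_agree N M" "dm1_F M ` dm1_carrier M \<subseteq> dm1_carrier M" "dm1_V M ` dm1_carrier M \<subseteq> dm1_carrier M"
  shows "dm1_iso N M"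
  unfolding dm1_iso_def
  by (rule exI[of _ id]) (use assms in \<open>auto simp: dm1_agree_def semilinear_on_def\<close>)

lemma subspace_coord_space: "fun_vs.subspace (coord_space T)"
  by (auto simp: coord_space_def fun_vs.subspace_def fscale_def)

definition unit_at :: "'i \<Rightarrow> 'i \<Rightarrow> 'k::field" where
  "unit_at i = (\<lambda>j. if j = i then 1 else 0)"

lemma inj_unit_at: "inj unit_at"
  by (rule injI) (metis unit_at_def zero_neq_one)

lemma sum_fun_eval: "(\<Sum>i\<in>T. f i) j = (\<Sum>i\<in>T. f i j)"
  by (induction T rule: infinite_finite_induct) auto

lemma sum_unit_at: "finite T \<Longrightarrow> (\<Sum>i\<in>T. fscale (u i) (unit_at i)) = (\<lambda>j. if j \<in> T then u j else 0)"
  by (rule ext) (simp add: sum_fun_eval fscale_def unit_at_def if_distrib cong: if_cong)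

lemma coord_space_basis:
  assumes "finite T"
  shows "fun_vs.independent (unit_at ` T :: ('i \<Rightarrow> 'k::field) set)"
    and "fun_vs.span (unit_at ` T :: ('i \<Rightarrow> 'k::field) set) = coord_space T"
    and "card (unit_at ` T :: ('i \<Rightarrow> 'k::field) set) = card T"
proof -
  have inj: "inj_on unit_at T" using inj_unit_at by (rule inj_on_subset) simp
  show "card (unit_at ` T :: ('i \<Rightarrow> 'k) set) = card T" using inj by (rule card_image)
  have sum: "(\<Sum>v\<in>unit_at ` T. fscale (u v) v) = (\<lambda>j. if j \<in> T then u (unit_at j) else 0)"
    for u :: "('i \<Rightarrow> 'k) \<Rightarrow> 'k"
    using sum_unit_at[OF assms, of "\<lambda>i. u (unit_at i)"] by (simp add: sum.reindex[OF inj])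
  show "fun_vs.independent (unit_at ` T :: ('i \<Rightarrow> 'k) set)"
  proof (rule fun_vs.independent_if_scalars_zero)
    fix u :: "('i \<Rightarrow> 'k) \<Rightarrow> 'k" and v :: "'i \<Rightarrow> 'k" assume "(\<Sum>v\<in>unit_at ` T. fscale (u v) v) = 0" and v: "v \<in> unit_at ` T"
    then have z: "(\<lambda>j. if j \<in> T then u (unit_at j) else 0) = 0" using sum[of u] by simp
    obtain i where "i \<in> T" "v = unit_at i" using v by auto
    then show "u v = 0" using fun_cong[OF z, of i] by simp
  qed (use assms in simp)
  show "fun_vs.span (unit_at ` T :: ('i \<Rightarrow> 'k) set) = coord_space T"
  proof
    show "fun_vs.span (unit_at ` T :: ('i \<Rightarrow> 'k) set) \<subseteq> coord_space T"
      by (rule fun_vs.span_minimal[OF _ subspace_coord_space]) (auto simp: coord_space_def unit_at_def)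
    show "coord_space T \<subseteq> fun_vs.span (unit_at ` T :: ('i \<Rightarrow> 'k) set)"
    proof
      fix x :: "'i \<Rightarrow> 'k" assume "x \<in> coord_space T"
      then have "x = (\<Sum>i\<in>T. fscale (x i) (unit_at i))"
        by (subst sum_unit_at[OF assms]) (auto simp: coord_space_def)
      also have "\<dots> \<in> fun_vs.span (unit_at ` T)"
        by (intro fun_vs.span_sum fun_vs.span_scale fun_vs.span_base) auto
      finally show "x \<in> fun_vs.span (unit_at ` T)" .
    qed
  qed
qed

lemma lp_module_dm1:
  assumes ch: "CHAR('k::alg_closed_field) > 0" and ok: "lp_ok (T, d, p)"
  shows "is_dm1 (card T) (lp_module (T, d, p) :: ('k, 'i) dm1)"
proof -
  have T: "finite T" and p: "bij_betw p T T" using ok by (auto simp: lp_ok_def)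
  let ?N = "coord_space T :: ('i \<Rightarrow> 'k) set" and ?r = "inv_into T p"
  let ?F = "\<lambda>(x :: 'i \<Rightarrow> 'k) s. if s \<in> T \<and> \<not> d (?r s) then frob (x (?r s)) else 0"
  let ?V = "\<lambda>(x :: 'i \<Rightarrow> 'k) t. if t \<in> T \<and> d t then frob_inv (x (p t)) else 0"
  have pT: "p t \<in> T" if "t \<in> T" for t using p that bij_betwE by blast
  have rT: "?r t \<in> T" if "t \<in> T" for t using bij_betwE[OF bij_betw_inv_into[OF p]] that by blast
  have pr: "p (?r t) = t" if "t \<in> T" for t using p that by (simp add: bij_betw_inv_into_right)
  have rp: "?r (p t) = t" if "t \<in> T" for t using p that by (simp add: bij_betw_inv_into_left)
  have FN: "?F x \<in> ?N" and VN: "?V x \<in> ?N" for x by (auto simp: coord_space_def)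
  have kerF: "{x \<in> ?N. ?F x = 0} = ?V ` ?N"
  proof (intro equalityI subsetI)
    fix x assume x: "x \<in> {x \<in> ?N. ?F x = 0}"
    have x0: "x t = 0" if "t \<in> T" "\<not> d t" for t
      using fun_cong[of "?F x" 0 "p t"] x that pT rp ch by (auto split: if_splits)
    let ?y = "\<lambda>s. if s \<in> T then frob (x (?r s)) else 0"
    have eq: "?V ?y = x" using x x0 ch pT rp by (auto simp: coord_space_def fun_eq_iff)
    have "?y \<in> ?N" by (auto simp: coord_space_def)
    from imageI[OF this, of ?V] show "x \<in> ?V ` ?N" by (simp only: eq)
  next
    fix x assume "x \<in> ?V ` ?N"
    then obtain y where "y \<in> ?N" "x = ?V y" by blast
    then show "x \<in> {x \<in> ?N. ?F x = 0}" using ch by (auto simp: coord_space_def fun_eq_iff)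
  qed
  have imF: "?F ` ?N = {x \<in> ?N. ?V x = 0}"
  proof (intro equalityI subsetI)
    fix x assume x: "x \<in> {x \<in> ?N. ?V x = 0}"
    have x0: "x (p t) = 0" if "t \<in> T" "d t" for t
      using fun_cong[of "?V x" 0 t] x that ch by (auto split: if_splits)
    let ?y = "\<lambda>t. if t \<in> T then frob_inv (x (p t)) else 0"
    have eq: "?F ?y = x" using x x0[OF rT] ch rT pr by (auto simp: coord_space_def fun_eq_iff)
    have "?y \<in> ?N" by (auto simp: coord_space_def)
    from imageI[OF this, of ?F] show "x \<in> ?F ` ?N" by (simp only: eq)
  next
    fix x assume "x \<in> ?F ` ?N"
    then obtain y where "y \<in> ?N" "x = ?F y" by blast
    then show "x \<in> {x \<in> ?N. ?V x = 0}" using ch rp by (auto simp: coord_space_def fun_eq_iff)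
  qed
  have linF: "semilinear_on frob ?N ?F" and linV: "semilinear_on frob_inv ?N ?V"
    using ch by (auto simp: semilinear_on_def fscale_def fun_eq_iff frob_add frob_mult frob_inv_add frob_inv_mult)
  have "\<exists>B. finite B \<and> card B = card T \<and> fun_vs.independent B \<and> fun_vs.span B = ?N"
    using coord_space_basis[OF T, where 'k = 'k] T by blast
  then show ?thesis
    unfolding is_dm1_def lp_module_def prod.case dm1.simps
    using subspace_coord_space FN VN kerF imF linF linV by blast
qed

lemma lp_module_iso:
  assumes ok: "lp_ok L" and iso: "L \<simeq> M"
  shows "dm1_iso (lp_module L :: ('k::field, 'i) dm1) (lp_module M)"
proof -
  obtain T d p where L: "L = (T, d, p)" by (cases L)
  obtain T' d' p' where M: "M = (T', d', p')" by (cases M)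
  have p: "bij_betw p T T" using ok L by (auto simp: lp_ok_def)
  obtain f where f: "bij_betw f T T'" "\<And>t. t \<in> T \<Longrightarrow> d' (f t) = d t" "\<And>t. t \<in> T \<Longrightarrow> f (p t) = p' (f t)"
    using iso unfolding L M by (rule lp_isoE) blast
  let ?r = "inv_into T p" and ?r' = "inv_into T' p'" and ?g = "inv_into T f"
  have pT: "p t \<in> T" if "t \<in> T" for t using p that bij_betwE by blast
  have rT: "?r t \<in> T" if "t \<in> T" for t using bij_betwE[OF bij_betw_inv_into[OF p]] that by blast
  have pr: "p (?r t) = t" if "t \<in> T" for t using p that by (simp add: bij_betw_inv_into_right)
  have fT: "f t \<in> T'" if "t \<in> T" for t using f(1) that bij_betwE by blast
  have gT: "?g t \<in> T" if "t \<in> T'" for t using bij_betwE[OF bij_betw_inv_into[OF f(1)]] that by blast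
  have fg: "f (?g t) = t" if "t \<in> T'" for t using f(1) that by (simp add: bij_betw_inv_into_right)
  have gf: "?g (f t) = t" if "t \<in> T" for t using f(1) that by (simp add: bij_betw_inv_into_left)
  have inj': "inj_on p' T'"
  proof (rule inj_onI)
    fix s t assume st: "s \<in> T'" "t \<in> T'" "p' s = p' t"
    then have "f (p (?g s)) = f (p (?g t))" using f(3) gT fg by simp
    then have "p (?g s) = p (?g t)" using gf pT gT st by metis
    then have "?g s = ?g t" using bij_betw_imp_inj_on[OF p] gT st by (auto simp: inj_on_def)
    then show "s = t" using fg st by metis
  qed
  have r': "?r' s = f (?r (?g s))" if "s \<in> T'" for s
  proof (rule inv_into_f_eq[OF inj'])
    show "f (?r (?g s)) \<in> T'" using that fT rT gT by blast
    show "p' (f (?r (?g s))) = s" using that f(3) rT gT pr fg by metis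
  qed
  define h where "h x s = (if s \<in> T' then x (?g s) else 0)" for x :: "'i \<Rightarrow> 'k" and s
  have bij: "bij_betw h (coord_space T) (coord_space T')"
    by (rule bij_betw_byWitness[where f' = "\<lambda>y t. if t \<in> T then y (f t) else 0"])
       (auto simp: h_def coord_space_def fun_eq_iff gf fg fT gT)
  have lin: "semilinear_on id (coord_space T) h"
    by (auto simp: semilinear_on_def h_def fscale_def fun_eq_iff)
  have hf: "h x (f t) = x t" if "t \<in> T" for x t using that by (simp add: h_def fT gf)
  have d': "d' s = d (?g s)" "p' s = f (p (?g s))" if "s \<in> T'" for s
    using f(2,3)[OF gT[OF that]] fg[OF that] by simp_all
  have F: "h (\<lambda>s. if s \<in> T \<and> \<not> d (?r s) then frob (x (?r s)) else 0) =
      (\<lambda>s. if s \<in> T' \<and> \<not> d' (?r' s) then frob (h x (?r' s)) else 0)" for x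
  proof
    fix s show "h (\<lambda>s. if s \<in> T \<and> \<not> d (?r s) then frob (x (?r s)) else 0) s =
      (if s \<in> T' \<and> \<not> d' (?r' s) then frob (h x (?r' s)) else 0)"
      using r'[of s] f(2)[OF rT[OF gT[of s]]] hf[OF rT[OF gT[of s]]] gT[of s]
      by (cases "s \<in> T'") (simp_all add: h_def[of _ s])
  qed
  have V: "h (\<lambda>t. if t \<in> T \<and> d t then frob_inv (x (p t)) else 0) =
      (\<lambda>t. if t \<in> T' \<and> d' t then frob_inv (h x (p' t)) else 0)" for x
  proof
    fix s show "h (\<lambda>t. if t \<in> T \<and> d t then frob_inv (x (p t)) else 0) s =
      (if s \<in> T' \<and> d' s then frob_inv (h x (p' s)) else 0)"
      using d'[of s] hf[OF pT[OF gT[of s]]] gT[of s]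
      by (cases "s \<in> T'") (simp_all add: h_def[of _ s])
  qed
  show ?thesis unfolding dm1_iso_def L M lp_module_def prod.case dm1.simps
    using bij lin F V by blast
qed

lemma dm1_iso_trans:
  assumes "dm1_iso N M" "dm1_iso M L"
  shows "dm1_iso N L"
proof -
  obtain f where f: "bij_betw f (dm1_carrier N) (dm1_carrier M)" "semilinear_on id (dm1_carrier N) f"
     "\<And>x. x \<in> dm1_carrier N \<Longrightarrow> f (dm1_F N x) = dm1_F M (f x)"
     "\<And>x. x \<in> dm1_carrier N \<Longrightarrow> f (dm1_V N x) = dm1_V M (f x)" using assms(1) by (auto simp: dm1_iso_def)
  obtain g where g: "bij_betw g (dm1_carrier M) (dm1_carrier L)" "semilinear_on id (dm1_carrier M) g"
     "\<And>x. x \<in> dm1_carrier M \<Longrightarrow> g (dm1_F M x) = dm1_F L (g x)"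
     "\<And>x. x \<in> dm1_carrier M \<Longrightarrow> g (dm1_V M x) = dm1_V L (g x)" using assms(2) by (auto simp: dm1_iso_def)
  have fN: "f x \<in> dm1_carrier M" if "x \<in> dm1_carrier N" for x using bij_betwE[OF f(1)] that by blast
  show ?thesis unfolding dm1_iso_def
    by (rule exI[of _ "g \<circ> f"]) (use f g fN in \<open>auto simp: semilinear_on_def intro: bij_betw_trans\<close>)
qed

lemma semilinear_inv_into:
  assumes f: "bij_betw f N M" "semilinear_on id N f" and sub: "fun_vs.subspace N"
  shows "semilinear_on id M (inv_into N f)"
proof -
  let ?g = "inv_into N f"
  have gN: "?g y \<in> N" if "y \<in> M" for y using bij_betwE[OF bij_betw_inv_into[OF f(1)]] that by blast
  have fg: "f (?g y) = y" if "y \<in> M" for y using bij_betw_inv_into_right[OF f(1) that] .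
  have gf: "?g (f x) = x" if "x \<in> N" for x using bij_betw_inv_into_left[OF f(1) that] .
  show ?thesis unfolding semilinear_on_def id_apply
  proof (intro conjI ballI allI)
    fix x y assume xy: "x \<in> M" "y \<in> M"
    have "f (?g x + ?g y) = x + y" using f(2) xy gN fg by (simp add: semilinear_on_def)
    then show "?g (x + y) = ?g x + ?g y" using gf[of "?g x + ?g y"] fun_vs.subspace_add[OF sub] gN xy by simp
  next
    fix c x assume x: "x \<in> M"
    have "f (fscale c (?g x)) = fscale c x" using f(2) x gN fg by (simp add: semilinear_on_def)
    then show "?g (fscale c x) = fscale c (?g x)" using gf[of "fscale c (?g x)"] fun_vs.subspace_scale[OF sub] gN x by simp
  qed
qed

lemma dm1_iso_sym:
  assumes "dm1_iso N M" and sub: "fun_vs.subspace (dm1_carrier N)"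
    and clF: "dm1_F N ` dm1_carrier N \<subseteq> dm1_carrier N" and clV: "dm1_V N ` dm1_carrier N \<subseteq> dm1_carrier N"
  shows "dm1_iso M N"
proof -
  obtain f where f: "bij_betw f (dm1_carrier N) (dm1_carrier M)" "semilinear_on id (dm1_carrier N) f"
     "\<And>x. x \<in> dm1_carrier N \<Longrightarrow> f (dm1_F N x) = dm1_F M (f x)"
     "\<And>x. x \<in> dm1_carrier N \<Longrightarrow> f (dm1_V N x) = dm1_V M (f x)" using assms(1) by (auto simp: dm1_iso_def)
  let ?g = "inv_into (dm1_carrier N) f"
  have g: "bij_betw ?g (dm1_carrier M) (dm1_carrier N)" using f(1) by (rule bij_betw_inv_into)
  have gN: "?g y \<in> dm1_carrier N" if "y \<in> dm1_carrier M" for y using bij_betwE[OF g] that by blast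
  have fg: "f (?g y) = y" if "y \<in> dm1_carrier M" for y using f(1) that by (simp add: bij_betw_inv_into_right)
  have gf: "?g (f x) = x" if "x \<in> dm1_carrier N" for x using f(1) that by (simp add: bij_betw_inv_into_left)
  have "semilinear_on id (dm1_carrier M) ?g" using f(1,2) sub by (rule semilinear_inv_into)
  moreover have "?g (dm1_F M y) = dm1_F N (?g y)" "?g (dm1_V M y) = dm1_V N (?g y)" if y: "y \<in> dm1_carrier M" for y
    using f(3)[OF gN[OF y]] f(4)[OF gN[OF y]] fg[OF y] gf[of "dm1_F N (?g y)"] gf[of "dm1_V N (?g y)"] gN[OF y] clF clV
    by (auto simp: image_subset_iff)
  ultimately show ?thesis unfolding dm1_iso_def using g by (intro exI[where x = ?g]) auto
qed

section \<open>Standard modules and their direct sums\<close>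

text \<open>
  The same labelled permutation with positions counted from 1, as in \<^const>\<open>std_dm1\<close>.
\<close>

definition std_lp :: "bool list \<Rightarrow> nat lp" where
  "std_lp A = ({1..length A}, (\<lambda>i. A ! (i - 1)), (\<lambda>i. Suc (word_perm A (i - 1))))"

lemma std_lp_iso: "std_lp A \<simeq> word_lp A" and word_lp_iso: "word_lp A \<simeq> std_lp A" and lp_ok_std_lp: "lp_ok (std_lp A)"
proof -
  show 1: "word_lp A \<simeq> std_lp A" unfolding word_lp_def std_lp_def
  proof (rule lp_isoI[where f = Suc])
    show "bij_betw Suc {..<length A} {1..length A}"
      by (simp add: bij_betw_def lessThan_atLeast0 image_Suc_atLeastLessThan atLeastLessThanSuc_atLeastAtMost)
  qed auto
  then show "std_lp A \<simeq> word_lp A" using lp_iso_sym lp_ok_word_lp by blast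
  show "lp_ok (std_lp A)" unfolding std_lp_def lp_ok_def prod.case
  proof
    have inj: "inj_on (\<lambda>i. Suc (word_perm A (i - 1))) {1..length A}"
    proof (rule inj_onI)
      fix i j assume ij: "i \<in> {1..length A}" "j \<in> {1..length A}" "Suc (word_perm A (i - 1)) = Suc (word_perm A (j - 1))"
      then have "i - 1 = j - 1" using word_perm_inj[of A] by (auto simp: inj_on_def)
      then show "i = j" using ij by auto
    qed
    moreover have "(\<lambda>i. Suc (word_perm A (i - 1))) ` {1..length A} \<subseteq> {1..length A}"
      using word_perm_less by (auto simp: Suc_le_eq)
    ultimately show "bij_betw (\<lambda>i. Suc (word_perm A (i - 1))) {1..length A} {1..length A}"
      by (simp add: bij_betw_def endo_inj_surj)
  qed simp
qed

lemma zeros_upto_eq: "zeros_upto A i = zeros_before A i"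
  unfolding zeros_upto_def zeros_before_def
  by (rule bij_betw_same_card[of "\<lambda>t. t - 1"], rule bij_betw_byWitness[where f' = Suc]) (auto simp: delta_def)

lemma nth_filter_upt:
  assumes "k < n" "P k"
  shows "filter P [0..<n] ! card {j. j < k \<and> P j} = k" "card {j. j < k \<and> P j} < length (filter P [0..<n])"
proof -
  have "[0..<n] = [0..<k] @ k # [Suc k..<n]" using assms(1)
    by (metis le_add_same_cancel1 less_imp_add_positive less_imp_le_nat upt_add_eq_append upt_conv_Cons zero_le)
  then have f: "filter P [0..<n] = filter P [0..<k] @ k # filter P [Suc k..<n]" using assms(2) by simp
  have "length (filter P [0..<k]) = card {j. j < k \<and> P j}"
    by (simp add: length_filter_conv_card cong: conj_cong)
  then show "filter P [0..<n] ! card {j. j < k \<and> P j} = k" "card {j. j < k \<and> P j} < length (filter P [0..<n])"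
    unfolding f by (metis nth_append_length, simp)
qed

lemma one_index_eq:
  assumes "k < length A" "A ! k"
  shows "one_index A (Suc (ones_before A k)) = Suc k"
proof -
  have "filter (delta A) [1..<length A + 1] = map Suc (filter ((!) A) [0..<length A])"
  proof -
    have "[1..<length A + 1] = map Suc [0..<length A]" by (simp add: map_Suc_upt del: upt_Suc)
    then show ?thesis by (simp only: filter_map o_def delta_def diff_Suc_1)
  qed
  then show ?thesis
    using nth_filter_upt[of k "length A" "(!) A"] assms by (simp add: one_index_def ones_before_def)
qed

lemma std_dm1_agree: "dm1_agree (std_dm1 A) (lp_module (std_lp A))"
proof -
  let ?h = "length A" let ?T = "{1..?h}" let ?d = "\<lambda>i. A ! (i - 1)" let ?p = "\<lambda>i. Suc (word_perm A (i - 1))"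
  let ?v = "zeros_upto A ?h"
  have p: "bij_betw ?p ?T ?T" using lp_ok_std_lp[of A] by (simp add: std_lp_def lp_ok_def)
  have pT: "?p i \<in> ?T" if "i \<in> ?T" for i using bij_betwE[OF p] that by blast
  have p0: "?p i = zeros_upto A i" if "i \<in> ?T" "\<not> ?d i" for i
    using that zeros_before_Suc[of A "i - 1"] by (simp add: zeros_upto_eq word_perm_def)
  have v: "?p i > ?v \<longleftrightarrow> ?d i" if "i \<in> ?T" for i
  proof -
    have "i - 1 < ?h" using that by auto
    then show ?thesis using word_perm_zero_less[of "i - 1" A] by (auto simp: zeros_upto_eq word_perm_def)
  qed
  have o: "one_index A (?p i - ?v) = i" if "i \<in> ?T" "?d i" for i
  proof -
    have "i - 1 < ?h" using that by auto
    then show ?thesis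
      using that one_index_eq[of "i - 1" A] by (simp add: zeros_upto_eq word_perm_def Suc_diff_le)
  qed
  have F: "(\<Sum>i\<in>?T. if delta A i then 0 else fscale (frob (x i)) (unit_fun (zeros_upto A i))) =
     (\<lambda>s. if s \<in> ?T \<and> \<not> ?d (inv_into ?T ?p s) then frob (x (inv_into ?T ?p s)) else 0)" for x :: "nat \<Rightarrow> 'k::field"
  proof
    fix s
    let ?L = "\<Sum>i\<in>?T. (if delta A i then 0 else fscale (frob (x i)) (unit_fun (zeros_upto A i))) s"
    have "?L = (if s \<in> ?T \<and> \<not> ?d (inv_into ?T ?p s) then frob (x (inv_into ?T ?p s)) else 0)"
    proof (cases "s \<in> ?T")
      case True
      let ?r = "inv_into ?T ?p s"
      have r: "?r \<in> ?T" "?p ?r = s"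
        using bspec[OF bij_betwE[OF bij_betw_inv_into[OF p]] True] bij_betw_inv_into_right[OF p True] .
      have "(if delta A i then 0 else fscale (frob (x i)) (unit_fun (zeros_upto A i))) s =
          (if i = ?r then (if ?d i then 0 else frob (x i)) else 0)" if i: "i \<in> ?T" for i
      proof -
        have "?p i = s \<longleftrightarrow> i = ?r" using inj_onD[OF bij_betw_imp_inj_on[OF p] _ i r(1)] r(2) by metis
        then show ?thesis using p0[OF i] by (auto simp: delta_def fscale_def unit_fun_def)
      qed
      then have "?L = (\<Sum>i\<in>?T. if i = ?r then (if ?d i then 0 else frob (x i)) else 0)" by (rule sum.cong[OF refl])
      also have "\<dots> = (if ?d ?r then 0 else frob (x ?r))" using r(1) by (subst sum.delta) auto
      finally show ?thesis using True by simp
    next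
      case False
      have "(if delta A i then 0 else fscale (frob (x i)) (unit_fun (zeros_upto A i))) s = 0" if i: "i \<in> ?T" for i
        using p0[OF i] pT[OF i] False by (auto simp: delta_def fscale_def unit_fun_def)
      then have "?L = 0" by (rule sum.neutral[rule_format])
      then show ?thesis using False by auto
    qed
    then show "(\<Sum>i\<in>?T. if delta A i then 0 else fscale (frob (x i)) (unit_fun (zeros_upto A i))) s =
      (if s \<in> ?T \<and> \<not> ?d (inv_into ?T ?p s) then frob (x (inv_into ?T ?p s)) else 0)"
      by (simp only: sum_fun_eval)
  qed
  have V: "(\<Sum>j\<in>?T. if j > ?v then fscale (frob_inv (x j)) (unit_fun (one_index A (j - ?v))) else 0) =
     (\<lambda>t. if t \<in> ?T \<and> ?d t then frob_inv (x (?p t)) else 0)" for x :: "nat \<Rightarrow> 'k::field"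
  proof
    fix t
    have "(\<Sum>j\<in>?T. if j > ?v then fscale (frob_inv (x j)) (unit_fun (one_index A (j - ?v))) else 0) t =
       (\<Sum>j\<in>?T. (if j > ?v then fscale (frob_inv (x j)) (unit_fun (one_index A (j - ?v))) else 0) t)"
      by (rule sum_fun_eval)
    also have "\<dots> = (\<Sum>i\<in>?T. (if ?p i > ?v then fscale (frob_inv (x (?p i))) (unit_fun (one_index A (?p i - ?v))) else 0) t)"
      by (rule sum.reindex_bij_betw[OF p, symmetric])
    also have "\<dots> = (\<Sum>i\<in>?T. if i = t then (if ?d i then frob_inv (x (?p i)) else 0) else 0)"
      by (intro sum.cong refl) (use v o in \<open>auto simp: fscale_def unit_fun_def\<close>)
    also have "\<dots> = (if t \<in> ?T \<and> ?d t then frob_inv (x (?p t)) else 0)" by (subst sum.delta) auto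
    finally show "(\<Sum>j\<in>?T. if j > ?v then fscale (frob_inv (x j)) (unit_fun (one_index A (j - ?v))) else 0) t =
       (if t \<in> ?T \<and> ?d t then frob_inv (x (?p t)) else 0)" .
  qed
  show ?thesis
    unfolding dm1_agree_def std_dm1_def lp_module_def std_lp_def Let_def prod.case dm1.simps coord_space_def
    using F V by blast
qed

lemma dm1_sum_agree:
  fixes Ns :: "('k::field, 'i) dm1 list" and Ls :: "'i lp list"
  assumes len: "length Ns = length Ls" and ag: "\<And>j. j < length Ls \<Longrightarrow> dm1_agree (Ns ! j) (lp_module (Ls ! j))"
    and ok: "\<And>j. j < length Ls \<Longrightarrow> lp_ok (Ls ! j)"
  shows "dm1_agree (dm1_sum Ns) (lp_module (lp_sum Ls))"
proof -
  let ?T = "{(j, i). j < length Ls \<and> i \<in> fst (Ls ! j)}"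
  let ?p = "\<lambda>(j, i). (j, snd (snd (Ls ! j)) i)"
  have ag': "dm1_carrier (Ns ! j) = coord_space (fst (Ls ! j))"
    "x \<in> coord_space (fst (Ls ! j)) \<Longrightarrow> dm1_F (Ns ! j) x i = (if i \<in> fst (Ls ! j) \<and> \<not> fst (snd (Ls ! j)) (inv_into (fst (Ls ! j)) (snd (snd (Ls ! j))) i)
       then frob (x (inv_into (fst (Ls ! j)) (snd (snd (Ls ! j))) i)) else 0)"
    "x \<in> coord_space (fst (Ls ! j)) \<Longrightarrow> dm1_V (Ns ! j) x i = (if i \<in> fst (Ls ! j) \<and> fst (snd (Ls ! j)) i then frob_inv (x (snd (snd (Ls ! j)) i)) else 0)"
    if "j < length Ls" for j x i
    using ag[OF that] by (auto simp: dm1_agree_def lp_module_def split: prod.splits)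
  have bij: "bij_betw (snd (snd (Ls ! j))) (fst (Ls ! j)) (fst (Ls ! j))" if "j < length Ls" for j
    using ok[OF that] by (auto simp: lp_ok_def split: prod.splits)
  have inv: "inv_into ?T ?p (j, i) = (j, inv_into (fst (Ls ! j)) (snd (snd (Ls ! j))) i)"
    if "j < length Ls" "i \<in> fst (Ls ! j)" for j i
  proof (rule inv_into_f_eq)
    have "lp_ok (lp_sum Ls)" using ok by (intro lp_ok_lp_sum) (metis in_set_conv_nth)
    then show "inj_on ?p ?T" by (simp add: lp_sum_def lp_ok_def bij_betw_def)
    show "(j, inv_into (fst (Ls ! j)) (snd (snd (Ls ! j))) i) \<in> ?T"
      using that bij_betwE[OF bij_betw_inv_into[OF bij[OF that(1)]]] by auto
    show "?p (j, inv_into (fst (Ls ! j)) (snd (snd (Ls ! j))) i) = (j, i)"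
      using bij_betw_inv_into_right[OF bij[OF that(1)] that(2)] by simp
  qed
  have car: "dm1_carrier (dm1_sum Ns) = coord_space ?T"
    using len ag'(1) by (auto simp: dm1_sum_def coord_space_def) (metis linorder_not_le)
  have comp: "(\<lambda>i. x (j, i)) \<in> coord_space (fst (Ls ! j))" if "x \<in> coord_space ?T" "j < length Ls" for x j
    using that by (auto simp: coord_space_def)
  show ?thesis unfolding dm1_agree_def car
  proof (intro conjI ballI)
    show "coord_space ?T = dm1_carrier (lp_module (lp_sum Ls))" by (simp add: lp_module_def lp_sum_def)
    fix x :: "nat \<times> 'i \<Rightarrow> 'k" assume x: "x \<in> coord_space ?T"
    show "dm1_F (dm1_sum Ns) x = dm1_F (lp_module (lp_sum Ls)) x"
    proof (rule ext, clarify)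
      fix j i show "dm1_F (dm1_sum Ns) x (j, i) = dm1_F (lp_module (lp_sum Ls)) x (j, i)"
        using len ag'(2)[OF _ comp[OF x]] inv by (cases "j < length Ls") (auto simp: dm1_sum_def lp_module_def lp_sum_def)
    qed
    show "dm1_V (dm1_sum Ns) x = dm1_V (lp_module (lp_sum Ls)) x"
    proof (rule ext, clarify)
      fix j i show "dm1_V (dm1_sum Ns) x (j, i) = dm1_V (lp_module (lp_sum Ls)) x (j, i)"
        using len ag'(3)[OF _ comp[OF x]] by (cases "j < length Ls") (auto simp: dm1_sum_def lp_module_def lp_sum_def)
    qed
  qed
qed

lemma is_dm1_closed:
  assumes "is_dm1 h N"
  shows "fun_vs.subspace (dm1_carrier N)" "dm1_F N ` dm1_carrier N \<subseteq> dm1_carrier N"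
    "dm1_V N ` dm1_carrier N \<subseteq> dm1_carrier N"
  using assms by (auto simp: is_dm1_def)

lemma dm1_agree_sym: "dm1_agree N M \<Longrightarrow> dm1_agree M N"
  by (auto simp: dm1_agree_def)

text \<open>
  An isomorphism of labelled permutations becomes one of modules by permuting the coordinates.
\<close>

theorem dm1_sum_std:
  assumes ch: "CHAR('k::alg_closed_field) > 0" and iso: "words_lp ws \<simeq> word_lp A"
  shows "dm1_iso (dm1_sum (map std_dm1 ws) :: ('k, nat \<times> nat) dm1) (std_dm1 A)"
    and "is_dm1 (length A) (dm1_sum (map std_dm1 ws) :: ('k, nat \<times> nat) dm1)"
proof -
  let ?L = "lp_sum (map std_lp ws)" let ?N = "dm1_sum (map std_dm1 ws) :: ('k, nat \<times> nat) dm1"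
  have ok: "lp_ok ?L" by (rule lp_ok_lp_sum) (auto simp: lp_ok_std_lp)
  have ag: "dm1_agree ?N (lp_module ?L)"
    by (rule dm1_sum_agree) (auto simp: std_dm1_agree lp_ok_std_lp)
  have "?L \<simeq> words_lp ws" by (rule lp_sum_cong) (auto simp: list_all2_conv_all_nth std_lp_iso)
  from lp_iso_trans[OF this lp_iso_trans[OF iso word_lp_iso]] have LA: "?L \<simeq> std_lp A" .
  obtain T d p where L: "?L = (T, d, p)" by (cases ?L)
  obtain f where "bij_betw f T {1..length A}"
    using LA unfolding L std_lp_def by (rule lp_isoE) blast
  then have "card T = length A" using bij_betw_same_card by fastforce
  then have dm: "is_dm1 (length A) (lp_module ?L :: ('k, nat \<times> nat) dm1)"
    using lp_module_dm1[OF ch] ok unfolding L by metis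
  then show "is_dm1 (length A) ?N" by (rule is_dm1_agree[OF ag])
  have "is_dm1 (card {1..length A}) (lp_module (std_lp A) :: ('k, nat) dm1)"
    using lp_module_dm1[OF ch] lp_ok_std_lp[of A] unfolding std_lp_def by blast
  note dmA = is_dm1_closed[OF is_dm1_agree[OF std_dm1_agree this]]
  show "dm1_iso ?N (std_dm1 A)"
    using dm1_iso_trans[OF dm1_agree_iso[OF ag is_dm1_closed(2,3)[OF dm]]
      dm1_iso_trans[OF lp_module_iso[OF ok LA] dm1_agree_iso[OF dm1_agree_sym[OF std_dm1_agree] dmA(2,3)]]] .
qed

section \<open>Uniqueness of the sequence of a module\<close>

lemma linear_inj_dim:
  fixes f :: "(nat \<Rightarrow> 'k::field) \<Rightarrow> nat \<Rightarrow> 'k"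
  assumes lin: "semilinear_on id (coord_space {1..a}) f" and inj: "inj_on f (coord_space {1..a})"
    and img: "f ` coord_space {1..a} \<subseteq> coord_space {1..b}"
  shows "a \<le> b"
proof -
  let ?W = "coord_space {1..a} :: (nat \<Rightarrow> 'k) set"
  let ?S = "f ` unit_at ` {1..a}"
  have W: "fun_vs.subspace ?W" by (rule subspace_coord_space)
  have e: "unit_at i \<in> ?W" if "i \<in> {1..a}" for i using that by (auto simp: coord_space_def unit_at_def)
  have f0: "f 0 = 0"
  proof -
    have "f (0 + 0) = f 0 + f 0" using lin fun_vs.subspace_0[OF W] unfolding semilinear_on_def by blast
    then show ?thesis by simp
  qed
  \<comment> \<open>A semilinear map is only known to respect sums inside the carrier.\<close>
  have fsum: "f (\<Sum>i\<in>I. fscale (u i) (unit_at i)) = (\<Sum>i\<in>I. fscale (u i) (f (unit_at i)))" if "finite I" "I \<subseteq> {1..a}" for I u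
    using that
  proof (induction I)
    case (insert i I)
    have "fscale (u i) (unit_at i) \<in> ?W" "(\<Sum>i\<in>I. fscale (u i) (unit_at i)) \<in> ?W"
      using insert.prems by (blast intro: fun_vs.subspace_sum[OF W] fun_vs.subspace_scale[OF W] e)+
    then have eq: "f (fscale (u i) (unit_at i) + (\<Sum>i\<in>I. fscale (u i) (unit_at i))) =
        fscale (u i) (f (unit_at i)) + f (\<Sum>i\<in>I. fscale (u i) (unit_at i))"
      using lin e[of i] insert.prems unfolding semilinear_on_def by simp
    have "f (\<Sum>i\<in>I. fscale (u i) (unit_at i)) = (\<Sum>i\<in>I. fscale (u i) (f (unit_at i)))"
      by (rule insert.IH) (use insert.prems in simp)
    then show ?case by (simp only: sum.insert[OF insert.hyps(1,2)] eq)
  qed (simp add: f0)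
  have injS: "inj_on (f \<circ> unit_at) {1..a}"
    by (rule comp_inj_on[OF inj_on_subset[OF inj_unit_at subset_UNIV] inj_on_subset[OF inj]])
       (rule image_subsetI, rule e)
  have "fun_vs.independent ?S"
  proof (rule fun_vs.independent_if_scalars_zero)
    fix u :: "(nat \<Rightarrow> 'k) \<Rightarrow> 'k" and v :: "nat \<Rightarrow> 'k"
    assume z: "(\<Sum>v\<in>?S. fscale (u v) v) = 0" and v: "v \<in> ?S"
    have "(\<Sum>v\<in>?S. fscale (u v) v) = (\<Sum>i\<in>{1..a}. fscale (u (f (unit_at i))) (f (unit_at i)))"
      using sum.reindex[OF injS, of "\<lambda>v. fscale (u v) v"] by (simp add: image_comp)
    also have "\<dots> = f (\<Sum>i\<in>{1..a}. fscale (u (f (unit_at i))) (unit_at i))"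
      by (subst fsum) auto
    finally have "f (\<Sum>i\<in>{1..a}. fscale (u (f (unit_at i))) (unit_at i)) = f 0" using z f0 by simp
    moreover have "(\<Sum>i\<in>{1..a}. fscale (u (f (unit_at i))) (unit_at i)) \<in> ?W"
      by (blast intro: fun_vs.subspace_sum[OF W] fun_vs.subspace_scale[OF W] e)
    ultimately have "(\<Sum>i\<in>{1..a}. fscale (u (f (unit_at i))) (unit_at i)) = 0"
      using inj fun_vs.subspace_0[OF W] by (auto simp: inj_on_def)
    then have s: "(\<lambda>j. if j \<in> {1..a} then u (f (unit_at j)) else 0) = 0"
      using sum_unit_at[of "{1..a}" "\<lambda>i. u (f (unit_at i))"] by simp
    obtain i where "i \<in> {1..a}" "v = f (unit_at i)" using v by auto
    then show "u v = 0" using fun_cong[OF s, of i] by simp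
  qed simp
  moreover have "?S \<subseteq> fun_vs.span (unit_at ` {1..b})"
    using img e by (subst coord_space_basis(2)) auto
  ultimately have "card ?S \<le> card (unit_at ` {1..b} :: (nat \<Rightarrow> 'k) set)"
    using fun_vs.independent_span_bound[of "unit_at ` {1..b}" ?S] by simp
  moreover have "card ?S = a" using card_image[OF injS] by (simp add: image_comp)
  ultimately show ?thesis using coord_space_basis(3)[of "{1..b}", where 'k = 'k] by simp
qed

text \<open>
  The canonical filtration is generated from the zero module and the whole module by \<open>F\<close> and the
  preimage under \<open>V\<close>. In a standard module it consists of spans of initial segments of the basis, and
  these are their dimensions.
\<close>

inductive_set canon_dims :: "bool list \<Rightarrow> nat set" for A where
  zero: "0 \<in> canon_dims A"
| full: "length A \<in> canon_dims A"
| F: "i \<in> canon_dims A \<Longrightarrow> zeros_before A i \<in> canon_dims A"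
| Vinv: "i \<in> canon_dims A \<Longrightarrow> zeros_before A (length A) + ones_before A i \<in> canon_dims A"

lemma canon_dims_le: "i \<in> canon_dims A \<Longrightarrow> i \<le> length A"
proof (induction rule: canon_dims.induct)
  case (F i)
  then show ?case using zeros_ones_before[of A i] by simp
next
  case (Vinv i)
  then show ?case using zeros_ones_before[of A "length A"] ones_before_mono[of i "length A" A] by simp
qed auto

text \<open>
  The zeros and the ones before a position give two counting functions, which describe the images
  under \<open>F\<close> and the preimages under \<open>V\<close>. Across every block between consecutive dimensions at least
  one of them increases. The dimensions are the images under \<open>F\<close> together with the preimages under \<open>V\<close>, so in
  total the two functions have only one value more than there are dimensions. Hence exactly one of them
  increases across each block. The proof measures this by the number \<open>R d\<close> of values of both
  functions up to \<open>d\<close>.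
\<close>

lemma canon_block:
  assumes ij: "i \<in> canon_dims A" "j \<in> canon_dims A" "i < j"
    and gap: "\<And>k. k \<in> canon_dims A \<Longrightarrow> k \<le> i \<or> j \<le> k"
  shows "zeros_before A i = zeros_before A j \<or> ones_before A i = ones_before A j"
proof (rule ccontr)
  assume "\<not> ?thesis"
  then have lt: "zeros_before A i < zeros_before A j" "ones_before A i < ones_before A j"
    using zeros_before_mono[of i j A] ones_before_mono[of i j A] ij by auto
  let ?D = "canon_dims A" let ?z = "zeros_before A" and ?o = "ones_before A" let ?v = "?z (length A)"
  have fin: "finite ?D" by (rule finite_subset[of _ "{..length A}"]) (auto simp: canon_dims_le)
  define R where "R d = card {z \<in> ?z ` ?D. z \<le> ?z d} + card {z \<in> ?o ` ?D. z \<le> ?o d}" for d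
  have Rz: "card {z \<in> ?z ` ?D. z \<le> ?z d} \<le> card {z \<in> ?z ` ?D. z \<le> ?z e}"
    and Ro: "card {z \<in> ?o ` ?D. z \<le> ?o d} \<le> card {z \<in> ?o ` ?D. z \<le> ?o e}" if "d \<le> e" for d e
    using that zeros_before_mono[of d e A] ones_before_mono[of d e A] fin by (auto intro!: card_mono)
  have less: "card {z \<in> S. z \<le> a} < card {z \<in> S. z \<le> b}" if "finite S" "b \<in> S" "a < b" for S and a b :: nat
  proof (rule psubset_card_mono)
    have "b \<in> {z \<in> S. z \<le> b}" "b \<notin> {z \<in> S. z \<le> a}" using that by auto
    moreover have "{z \<in> S. z \<le> a} \<subseteq> {z \<in> S. z \<le> b}" using that by auto
    ultimately show "{z \<in> S. z \<le> a} \<subset> {z \<in> S. z \<le> b}" by blast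
  qed (use that in simp)
  have Rz': "card {z \<in> ?z ` ?D. z \<le> ?z d} < card {z \<in> ?z ` ?D. z \<le> ?z e}" if "e \<in> ?D" "?z d < ?z e" for d e
    using that fin by (intro less) auto
  have Ro': "card {z \<in> ?o ` ?D. z \<le> ?o d} < card {z \<in> ?o ` ?D. z \<le> ?o e}" if "e \<in> ?D" "?o d < ?o e" for d e
    using that fin by (intro less) auto
  have Rmono: "R d < R e" if "e \<in> ?D" "d < e" for d e
  proof -
    have "?z d < ?z e \<or> ?o d < ?o e"
      using that zeros_ones_before[of A d] zeros_ones_before[of A e] by linarith
    then show ?thesis
      using Rz[of d e] Ro[of d e] Rz'[of e d] Ro'[of e d] that unfolding R_def by linarith
  qed
  have injR: "inj_on R ?D" by (rule linorder_inj_onI') (metis Rmono less_irrefl)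
  have low: "2 \<le> R d" if "d \<in> ?D" for d
  proof -
    have "1 \<le> card {z \<in> ?z ` ?D. z \<le> ?z d}" "1 \<le> card {z \<in> ?o ` ?D. z \<le> ?o d}"
      using that fin by (auto simp: Suc_le_eq card_gt_0_iff)
    then show ?thesis unfolding R_def by simp
  qed
  have high: "R d \<le> card (?z ` ?D) + card (?o ` ?D)" for d
    unfolding R_def using fin by (intro add_mono card_mono) auto
  have "?D = ?z ` ?D \<union> (\<lambda>n. ?v + n) ` ?o ` ?D"
  proof
    show "?D \<subseteq> ?z ` ?D \<union> (\<lambda>n. ?v + n) ` ?o ` ?D"
    proof
      fix d assume "d \<in> ?D"
      then show "d \<in> ?z ` ?D \<union> (\<lambda>n. ?v + n) ` ?o ` ?D"
      proof cases
        case zero then show ?thesis using canon_dims.zero[of A] by (intro UnI1 image_eqI[where x = 0]) auto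
      next
        case full
        have "?v + ?o (length A) \<in> (\<lambda>n. ?v + n) ` ?o ` ?D" using canon_dims.full[of A] by blast
        then show ?thesis using full zeros_ones_before[of A "length A"] by simp
      qed auto
    qed
  qed (auto intro: canon_dims.intros)
  moreover have "?z ` ?D \<inter> (\<lambda>n. ?v + n) ` ?o ` ?D = {?v}"
  proof
    show "?z ` ?D \<inter> (\<lambda>n. ?v + n) ` ?o ` ?D \<subseteq> {?v}"
    proof
      fix n assume "n \<in> ?z ` ?D \<inter> (\<lambda>n. ?v + n) ` ?o ` ?D"
      then obtain d where "d \<in> ?D" "n = ?z d" "?v \<le> n" by auto
      then show "n \<in> {?v}" using zeros_before_mono[OF canon_dims_le, of d A A] by simp
    qed
    have "?v \<in> ?z ` ?D" using canon_dims.full by blast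
    moreover have "?v + ?o 0 \<in> (\<lambda>n. ?v + n) ` ?o ` ?D" using canon_dims.zero by blast
    ultimately show "{?v} \<subseteq> ?z ` ?D \<inter> (\<lambda>n. ?v + n) ` ?o ` ?D" by simp
  qed
  ultimately have "card ?D + 1 = card (?z ` ?D) + card ((\<lambda>n. ?v + n) ` ?o ` ?D)"
    using card_Un_Int[of "?z ` ?D" "(\<lambda>n. ?v + n) ` ?o ` ?D"] fin by simp
  also have "card ((\<lambda>n. ?v + n) ` ?o ` ?D) = card (?o ` ?D)" by (rule card_image) simp
  finally have cD: "card ?D + 1 = card (?z ` ?D) + card (?o ` ?D)" .
  have "R ` ?D = {2..card ?D + 1}"
  proof (rule card_subset_eq)
    show "R ` ?D \<subseteq> {2..card ?D + 1}" using low high cD by auto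
    show "card (R ` ?D) = card {2..card ?D + 1}" using injR by (simp add: card_image)
  qed simp
  moreover have "R i + 1 \<in> {2..card ?D + 1}" using low[OF ij(1)] Rmono[OF ij(2,3)] high[of j] cD by auto
  ultimately obtain k where k: "k \<in> ?D" "R k = R i + 1" by (metis imageE)
  have "R j \<ge> R i + 2" unfolding R_def using Rz'[OF ij(2) lt(1)] Ro'[OF ij(2) lt(2)] by simp
  moreover have "R k \<le> R i" if "k \<le> i" using that Rmono[OF ij(1), of k] by (cases "k = i") auto
  moreover have "R j \<le> R k" if "j \<le> k" using that Rmono[OF k(1), of j] by (cases "j = k") auto
  ultimately show False using gap[OF k(1)] k(2) by force
qed

text \<open>
  All labels within a block of the canonical filtration are equal, and the dimensions tell which.
\<close>

lemma word_eqI: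
  assumes len: "length A = length B"
    and eq: "\<And>i. i \<in> canon_dims A \<Longrightarrow> zeros_before A i = zeros_before B i"
  shows "A = B"
proof (rule nth_equalityI[OF len])
  fix k assume k: "k < length A"
  let ?D = "canon_dims A"
  have fin: "finite ?D" by (rule finite_subset[of _ "{..length A}"]) (auto simp: canon_dims_le)
  define i where "i = Max {d \<in> ?D. d \<le> k}"
  define j where "j = Min {d \<in> ?D. k < d}"
  have "i \<in> {d \<in> ?D. d \<le> k}" unfolding i_def by (rule Max_in) (use fin canon_dims.zero[of A] in auto)
  then have i: "i \<in> ?D" "i \<le> k" by auto
  have "j \<in> {d \<in> ?D. k < d}" unfolding j_def by (rule Min_in) (use fin canon_dims.full[of A] k in auto)
  then have j: "j \<in> ?D" "k < j" by auto
  have gap: "d \<le> i \<or> j \<le> d" if "d \<in> ?D" for d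
    using that fin by (cases "d \<le> k") (auto simp: i_def j_def)
  have T: "C ! k" if "zeros_before C i = zeros_before C j" for C
    using zeros_before_less[of k j C] zeros_before_mono[of i k C] i j that by auto
  have F: "\<not> C ! k" if "ones_before C i = ones_before C j" for C
    using ones_before_less[of k j C] ones_before_mono[of i k C] i j that by auto
  have "ones_before A i = ones_before B i" "ones_before A j = ones_before B j"
    using eq[OF i(1)] eq[OF j(1)] zeros_ones_before[of A i] zeros_ones_before[of B i]
      zeros_ones_before[of A j] zeros_ones_before[of B j] by auto
  then show "A ! k = B ! k"
    using canon_block[OF i(1) j(1) _ gap] i j T[of A] T[of B] F[of A] F[of B] eq[OF i(1)] eq[OF j(1)] by auto
qed

text \<open>
  The spans of initial segments of the basis are permuted by \<open>F\<close> and by the preimage under \<open>V\<close>, with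
  the dimensions that occur in \<^const>\<open>canon_dims\<close>.
\<close>

lemma std_flags:
  fixes A :: "bool list"
  assumes ch: "CHAR('k::alg_closed_field) > 0" and i: "i \<le> length A"
  defines "W \<equiv> \<lambda>i. coord_space {1..i} :: (nat \<Rightarrow> 'k) set"
  shows "dm1_F (std_dm1 A) ` W i = W (zeros_before A i)"
    and "{x \<in> W (length A). dm1_V (std_dm1 A) x \<in> W i} = W (zeros_before A (length A) + ones_before A i)"
proof -
  let ?h = "length A" let ?T = "{1..?h}" let ?d = "\<lambda>i. A ! (i - 1)" let ?p = "\<lambda>i. Suc (word_perm A (i - 1))"
  let ?v = "zeros_before A ?h" let ?r = "inv_into ?T ?p"
  have p: "bij_betw ?p ?T ?T" using lp_ok_std_lp[of A] by (simp add: std_lp_def lp_ok_def)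
  have rT: "?r t \<in> ?T" if "t \<in> ?T" for t using bij_betwE[OF bij_betw_inv_into[OF p]] that by blast
  have pr: "?p (?r t) = t" if "t \<in> ?T" for t using bij_betw_inv_into_right[OF p that] .
  have p0: "?p t = zeros_before A t" if "t \<in> ?T" "\<not> ?d t" for t
    using that zeros_before_Suc[of A "t - 1"] by (simp add: word_perm_def)
  have p1: "?p t = ?v + ones_before A t" if "t \<in> ?T" "?d t" for t
    using that ones_before_Suc[of A "t - 1"] by (simp add: word_perm_def)
  have z1: "zeros_before A i < zeros_before A t" if "t \<in> ?T" "\<not> ?d t" "i < t" for t
  proof -
    have "i \<le> t - 1" "t - 1 < t" using that by auto
    then show ?thesis using that zeros_before_less[of "t - 1" t A] zeros_before_mono[of i "t - 1" A] by linarith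
  qed
  have o1: "ones_before A i < ones_before A t" if "t \<in> ?T" "?d t" "i < t" for t
  proof -
    have "i \<le> t - 1" "t - 1 < t" using that by auto
    then show ?thesis using that ones_before_less[of "t - 1" t A] ones_before_mono[of i "t - 1" A] by linarith
  qed
  have zv: "zeros_before A t \<le> ?v" if "t \<le> ?h" for t using zeros_before_mono[OF that] .
  have o2: "1 \<le> ones_before A t" if "t \<in> ?T" "?d t" for t
    using that ones_before_less[of "t - 1" t A] by simp
  have F: "dm1_F (std_dm1 A) x = (\<lambda>s. if s \<in> ?T \<and> \<not> ?d (?r s) then frob (x (?r s)) else 0)"
    and V: "dm1_V (std_dm1 A) x = (\<lambda>t. if t \<in> ?T \<and> ?d t then frob_inv (x (?p t)) else 0)"
    if "x \<in> W ?h" for x :: "nat \<Rightarrow> 'k"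
    using std_dm1_agree[of A] that unfolding dm1_agree_def lp_module_def std_lp_def prod.case dm1.simps W_def by blast+
  have Wsub: "W k \<subseteq> W ?h" if "k \<le> ?h" for k using that by (auto simp: W_def coord_space_def)
  show "dm1_F (std_dm1 A) ` W i = W (zeros_before A i)"
  proof (intro equalityI subsetI)
    fix y assume "y \<in> dm1_F (std_dm1 A) ` W i"
    then obtain x where x: "x \<in> W i" "y = dm1_F (std_dm1 A) x" by blast
    have y: "y = (\<lambda>s. if s \<in> ?T \<and> \<not> ?d (?r s) then frob (x (?r s)) else 0)"
      unfolding x(2) by (rule F) (use x(1) Wsub[OF i] in blast)
    show "y \<in> W (zeros_before A i)" unfolding W_def coord_space_def
    proof (intro CollectI allI impI)
      fix s assume s: "s \<notin> {1..zeros_before A i}"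
      show "y s = 0"
      proof (cases "s \<in> ?T \<and> \<not> ?d (?r s)")
        case True
        then have "s = zeros_before A (?r s)" using p0[OF rT] pr by metis
        then have "zeros_before A i < zeros_before A (?r s)" using s True by auto
        then have "i < ?r s" using zeros_before_mono[of "?r s" i A] by (meson not_le)
        then have "x (?r s) = 0" using x(1) by (auto simp: W_def coord_space_def)
        then show ?thesis using y ch by simp
      qed (use y in auto)
    qed
  next
    fix y assume y: "y \<in> W (zeros_before A i)"
    define x where "x t = (if t \<in> ?T \<and> \<not> ?d t then frob_inv (y (?p t)) else 0)" for t
    have xi: "x \<in> W i" unfolding W_def coord_space_def
    proof (intro CollectI allI impI)
      fix t assume t: "t \<notin> {1..i}"
      show "x t = 0"
      proof (cases "t \<in> ?T \<and> \<not> ?d t")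
        case True
        then have "zeros_before A i < ?p t" using z1[of t] p0[of t] t by auto
        then have "y (?p t) = 0" using y by (auto simp: W_def coord_space_def)
        then show ?thesis using ch by (simp add: x_def)
      qed (auto simp: x_def)
    qed
    have "dm1_F (std_dm1 A) x = y"
    proof
      fix s
      have Fx: "dm1_F (std_dm1 A) x s = (if s \<in> ?T \<and> \<not> ?d (?r s) then frob (x (?r s)) else 0)"
        by (rule fun_cong[OF F]) (use xi Wsub[OF i] in blast)
      show "dm1_F (std_dm1 A) x s = y s"
      proof (cases "s \<in> ?T")
        case False
        then show ?thesis using Fx y zv[OF i] zeros_ones_before[of A ?h] by (auto simp: W_def coord_space_def)
      next
        case True
        show ?thesis
        proof (cases "?d (?r s)")
          case False
          then show ?thesis using Fx True rT[OF True] pr[OF True] ch by (simp add: x_def)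
        next
          case d: True
          then have "s > ?v" using p1[OF rT[OF True] d] pr[OF True] o2[OF rT[OF True] d] by linarith
          then have "y s = 0" using y zv[OF i] by (auto simp: W_def coord_space_def)
          then show ?thesis using Fx d by simp
        qed
      qed
    qed
    then show "y \<in> dm1_F (std_dm1 A) ` W i" using xi by blast
  qed
  show "{x \<in> W ?h. dm1_V (std_dm1 A) x \<in> W i} = W (?v + ones_before A i)"
  proof (intro equalityI subsetI)
    fix x assume "x \<in> {x \<in> W ?h. dm1_V (std_dm1 A) x \<in> W i}"
    then have x: "x \<in> W ?h" "dm1_V (std_dm1 A) x \<in> W i" by auto
    show "x \<in> W (?v + ones_before A i)" unfolding W_def coord_space_def
    proof (intro CollectI allI impI)
      fix s assume s: "s \<notin> {1..?v + ones_before A i}"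
      show "x s = 0"
      proof (cases "s \<in> ?T")
        case True
        have sv: "s > ?v + ones_before A i" using s True by auto
        have d: "?d (?r s)"
        proof (rule ccontr)
          assume "\<not> ?d (?r s)"
          then have "s \<le> ?v" using p0[OF rT[OF True]] pr[OF True] zv[of "?r s"] rT[OF True] by auto
          then show False using sv by simp
        qed
        then have "ones_before A (?r s) > ones_before A i"
          using p1[OF rT[OF True] d] pr[OF True] sv by linarith
        then have "i < ?r s" using ones_before_mono[of "?r s" i A] by (meson not_le)
        then have "dm1_V (std_dm1 A) x (?r s) = 0" using x(2) by (auto simp: W_def coord_space_def)
        then have "frob_inv (x s) = 0" using V[OF x(1)] d rT[OF True] pr[OF True] by simp
        then show ?thesis using ch by simp
      qed (use x(1) in \<open>auto simp: W_def coord_space_def\<close>)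
    qed
  next
    fix x assume x: "x \<in> W (?v + ones_before A i)"
    have "?v + ones_before A i \<le> ?h" using zeros_ones_before[of A ?h] ones_before_mono[OF i, of A] by linarith
    then have xh: "x \<in> W ?h" using x Wsub by blast
    have "dm1_V (std_dm1 A) x \<in> W i" unfolding V[OF xh] unfolding W_def coord_space_def
    proof (intro CollectI allI impI)
      fix t assume t: "t \<notin> {1..i}"
      show "(if t \<in> ?T \<and> ?d t then frob_inv (x (?p t)) else 0) = 0"
      proof (cases "t \<in> ?T \<and> ?d t")
        case True
        then have "?p t > ?v + ones_before A i" using o1[of t] p1[of t] t by auto
        then have "x (?p t) = 0" using x by (auto simp: W_def coord_space_def)
        then show ?thesis using ch by simp
      qed auto
    qed
    then show "x \<in> {x \<in> W ?h. dm1_V (std_dm1 A) x \<in> W i}" using xh by blast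
  qed
qed

text \<open>
  An isomorphism maps the canonical filtration to the canonical filtration. Hence all its dimensions
  agree, and these determine the sequence.
\<close>

theorem std_dm1_unique:
  assumes ch: "CHAR('k::alg_closed_field) > 0"
    and iso: "dm1_iso (std_dm1 A :: ('k, nat) dm1) (std_dm1 B)"
  shows "A = B"
proof -
  let ?W = "\<lambda>i. coord_space {1..i} :: (nat \<Rightarrow> 'k) set"
  have car: "dm1_carrier (std_dm1 C :: ('k, nat) dm1) = ?W (length C)" for C
    by (simp add: std_dm1_def Let_def coord_space_def)
  obtain f where f: "bij_betw f (?W (length A)) (?W (length B))" "semilinear_on id (?W (length A)) f"
    "\<And>x. x \<in> ?W (length A) \<Longrightarrow> f (dm1_F (std_dm1 A) x) = dm1_F (std_dm1 B) (f x)"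
    "\<And>x. x \<in> ?W (length A) \<Longrightarrow> f (dm1_V (std_dm1 A) x) = dm1_V (std_dm1 B) (f x)"
    using iso by (auto simp: dm1_iso_def car)
  have Wmono: "?W i \<subseteq> ?W j" if "i \<le> j" for i j using that by (auto simp: coord_space_def)
  let ?g = "inv_into (?W (length A)) f"
  have g: "bij_betw ?g (?W (length B)) (?W (length A))" using f(1) by (rule bij_betw_inv_into)
  have gW: "?g y \<in> ?W (length A)" if "y \<in> ?W (length B)" for y using bij_betwE[OF g] that by blast
  have fg: "f (?g y) = y" if "y \<in> ?W (length B)" for y using bij_betw_inv_into_right[OF f(1) that] .
  have gf: "?g (f x) = x" if "x \<in> ?W (length A)" for x using bij_betw_inv_into_left[OF f(1) that] .
  have sub: "fun_vs.subspace (?W i)" for i by (rule subspace_coord_space)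
  have lin_sub: "semilinear_on id (?W i) f" if "i \<le> length A" for i
    using f(2) Wmono[OF that] unfolding semilinear_on_def by blast
  have ling: "semilinear_on id (?W (length B)) ?g" using f(1,2) sub by (rule semilinear_inv_into)
  have dim: "i = j" if ij: "i \<le> length A" "j \<le> length B" "f ` ?W i = ?W j" for i j
  proof (rule antisym)
    show "i \<le> j" using linear_inj_dim[OF lin_sub[OF ij(1)], of j] ij(3)
        inj_on_subset[OF bij_betw_imp_inj_on[OF f(1)] Wmono[OF ij(1)]] by simp
    have "?g ` ?W j = ?W i" unfolding ij(3)[symmetric] image_image using gf Wmono[OF ij(1)] by force
    moreover have "semilinear_on id (?W j) ?g" using ling Wmono[OF ij(2)] unfolding semilinear_on_def by blast
    ultimately show "j \<le> i" using linear_inj_dim[of j ?g i]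
        inj_on_subset[OF bij_betw_imp_inj_on[OF g] Wmono[OF ij(2)]] by simp
  qed
  have len: "length A = length B" using dim[of "length A" "length B"] bij_betw_imp_surj_on[OF f(1)] by simp
  have zle: "zeros_before C i \<le> length C" "zeros_before C (length C) + ones_before C i \<le> length C"
    if "i \<le> length C" for C i
    using that zeros_ones_before[of C i] zeros_ones_before[of C "length C"] ones_before_mono[OF that, of C] by auto
  have stepF: "zeros_before A i = zeros_before B i \<and> f ` ?W (zeros_before A i) = ?W (zeros_before A i)"
    if i: "i \<le> length A" "f ` ?W i = ?W i" for i
  proof -
    have iB: "i \<le> length B" using i len by simp
    have "f ` ?W (zeros_before A i) = f ` dm1_F (std_dm1 A) ` ?W i"
      by (simp only: std_flags(1)[OF ch i(1)])
    also have "\<dots> = dm1_F (std_dm1 B) ` f ` ?W i"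
      using f(3) Wmono[OF i(1)] by (auto simp: image_image intro!: image_cong)
    also have "\<dots> = ?W (zeros_before B i)" by (simp only: i(2) std_flags(1)[OF ch iB])
    finally have eq: "f ` ?W (zeros_before A i) = ?W (zeros_before B i)" .
    then have "zeros_before A i = zeros_before B i" by (intro dim zle i iB)
    then show ?thesis using eq by simp
  qed
  have flag: "f ` ?W i = ?W i" if "i \<in> canon_dims A" for i
    using that
  proof (induction rule: canon_dims.induct)
    case zero
    have "?W 0 = {0}" by (auto simp: coord_space_def fun_eq_iff)
    moreover have "f 0 = 0"
    proof -
      have "f (0 + 0) = f 0 + f 0" using f(2) fun_vs.subspace_0[OF sub] unfolding semilinear_on_def by blast
      then show ?thesis by simp
    qed
    ultimately show ?case by (simp only: image_insert image_empty)
  next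
    case full
    then show ?case using bij_betw_imp_surj_on[OF f(1)] len by simp
  next
    case (F i)
    then show ?case using stepF canon_dims_le by blast
  next
    case (Vinv i)
    have i: "i \<le> length A" "i \<le> length B" using canon_dims_le[OF Vinv(1)] len by auto
    let ?n = "\<lambda>C. zeros_before C (length C) + ones_before C i"
    have "f ` ?W (?n A) = f ` {x \<in> ?W (length A). dm1_V (std_dm1 A) x \<in> ?W i}"
      by (simp only: std_flags(2)[OF ch i(1)])
    also have "\<dots> = {y \<in> ?W (length B). dm1_V (std_dm1 B) y \<in> ?W i}"
    proof (intro equalityI subsetI)
      fix y assume "y \<in> f ` {x \<in> ?W (length A). dm1_V (std_dm1 A) x \<in> ?W i}"
      then obtain x where x: "x \<in> ?W (length A)" "dm1_V (std_dm1 A) x \<in> ?W i" "y = f x" by blast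
      then have "dm1_V (std_dm1 B) y \<in> ?W i" using f(4) Vinv.IH by (metis imageI)
      then show "y \<in> {y \<in> ?W (length B). dm1_V (std_dm1 B) y \<in> ?W i}" using x bij_betwE[OF f(1)] by blast
    next
      fix y assume "y \<in> {y \<in> ?W (length B). dm1_V (std_dm1 B) y \<in> ?W i}"
      then have y: "y \<in> ?W (length B)" "dm1_V (std_dm1 B) y \<in> ?W i" by auto
      let ?x = "?g y"
      have x: "?x \<in> ?W (length A)" "f ?x = y" using gW fg y by auto
      then have "f (dm1_V (std_dm1 A) ?x) \<in> f ` ?W i" using f(4) y Vinv.IH by simp
      then obtain w where w: "w \<in> ?W i" "f (dm1_V (std_dm1 A) ?x) = f w" by blast
      moreover have "dm1_V (std_dm1 A) ?x \<in> ?W (length A)"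
        using std_dm1_agree[of A] x(1) unfolding dm1_agree_def lp_module_def std_lp_def prod.case dm1.simps
        by (auto simp: coord_space_def car)
      ultimately have "dm1_V (std_dm1 A) ?x = w"
        using bij_betw_imp_inj_on[OF f(1)] Wmono[OF i(1)] by (meson inj_onD subsetD)
      then show "y \<in> f ` {x \<in> ?W (length A). dm1_V (std_dm1 A) x \<in> ?W i}"
        using w(1) x by (intro image_eqI[where x = ?x]) auto
    qed
    also have "\<dots> = ?W (?n B)" by (simp only: std_flags(2)[OF ch i(2)])
    finally have eq: "f ` ?W (?n A) = ?W (?n B)" .
    then have "?n A = ?n B" by (intro dim zle i)
    then show ?case using eq by simp
  qed
  show ?thesis
    by (rule word_eqI[OF len]) (use stepF canon_dims_le flag in blast)
qed

theorem dm1_seq_eq: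
  assumes ch: "CHAR('k::alg_closed_field) > 0"
    and dm: "is_dm1 h (N :: ('k, 'i) dm1)" and iso: "dm1_iso N (std_dm1 A)"
  shows "dm1_seq N = A"
  unfolding dm1_seq_def
proof (rule the_equality)
  show "dm1_iso N (std_dm1 A)" by (rule iso)
  fix B assume "dm1_iso N (std_dm1 B)"
  from dm1_iso_trans[OF dm1_iso_sym[OF iso is_dm1_closed[OF dm]] this]
  have "dm1_iso (std_dm1 A :: ('k, nat) dm1) (std_dm1 B)" .
  then show "B = A" using std_dm1_unique[OF ch] by metis
qed

section \<open>Slopes\<close>

lemma coprime_pair_height: "coprime_pair s \<Longrightarrow> 0 < real (fst s) + real (snd s)"
proof -
  assume "coprime_pair s"
  then have "fst s \<noteq> 0 \<or> snd s \<noteq> 0" by auto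
  then show ?thesis by (auto simp: add_pos_nonneg add_nonneg_pos)
qed

lemma slope_le_iff:
  assumes "coprime_pair s" "coprime_pair t"
  shows "np_slope s \<le> np_slope t \<longleftrightarrow> 0 \<le> sdet s t"
proof -
  have "0 < real (fst s + snd s)" "0 < real (fst t + snd t)" using coprime_pair_height assms by simp_all
  then have "np_slope s \<le> np_slope t \<longleftrightarrow>
      real (snd s) * real (fst t + snd t) \<le> real (snd t) * real (fst s + snd s)"
    by (simp add: np_slope_def case_prod_beta divide_le_eq le_divide_eq field_simps)
  also have "\<dots> \<longleftrightarrow> real_of_int 0 \<le> real_of_int (sdet s t)" by (simp add: sdet_eq algebra_simps)
  finally show ?thesis by (simp only: of_int_le_iff)
qed

lemma np_list_props: "mset (np_list \<xi>) = \<xi>" "sorted_wrt (\<lambda>p q. np_slope p \<ge> np_slope q) (np_list \<xi>)"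
proof -
  obtain xs where "mset xs = \<xi>" using ex_mset by blast
  then have "mset (sort_key (\<lambda>p. - np_slope p) xs) = \<xi>" by simp
  moreover have "sorted_wrt (\<lambda>p q. np_slope p \<ge> np_slope q) (sort_key (\<lambda>p. - np_slope p) xs)"
    using sorted_sort_key[of "\<lambda>p. - np_slope p" xs] by (simp add: sorted_map)
  ultimately have "\<exists>xs. mset xs = \<xi> \<and> sorted_wrt (\<lambda>p q. np_slope p \<ge> np_slope q) xs" by blast
  from someI_ex[OF this] show "mset (np_list \<xi>) = \<xi>" "sorted_wrt (\<lambda>p q. np_slope p \<ge> np_slope q) (np_list \<xi>)"
    unfolding np_list_def by blast+
qed

section \<open>Polygons as functions\<close>

definition end_point :: "(nat \<times> nat) list \<Rightarrow> real \<times> real" where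
  "end_point ss = ((\<Sum>(m, n)\<leftarrow>ss. real (m + n)), (\<Sum>(m, n)\<leftarrow>ss. real n))"

text \<open>
  The list of segments is ordered by decreasing slopes while the graph starts with the smallest slope,
  so the head of the list is the last segment of the graph.
\<close>

fun polyline :: "(nat \<times> nat) list \<Rightarrow> real \<Rightarrow> real" where
  "polyline [] x = 0"
| "polyline (s # ss) x = (if x \<le> fst (end_point ss) then polyline ss x
     else snd (end_point ss) + (x - fst (end_point ss)) * np_slope s)"

definition polygon_graph :: "(nat \<times> nat) list \<Rightarrow> (real \<times> real) set" where
  "polygon_graph ss = insert (0, 0) (\<Union>j<length ss. closed_segment (end_point (drop (Suc j) ss)) (end_point (drop j ss)))"

lemma end_point_Nil [simp]: "end_point [] = (0, 0)" by (simp add: end_point_def)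

lemma end_point_Cons: "end_point (s # ss) = (real (fst s + snd s) + fst (end_point ss), real (snd s) + snd (end_point ss))"
  by (simp add: end_point_def case_prod_beta)

lemma end_point_nonneg: "0 \<le> fst (end_point ss)" "0 \<le> snd (end_point ss)"
  by (induction ss) (auto simp: end_point_Cons)

lemma polygon_graph_Cons: "polygon_graph (s # ss) = polygon_graph ss \<union> closed_segment (end_point ss) (end_point (s # ss))"
proof -
  have "{..<length (s # ss)} = insert 0 (Suc ` {..<length ss})" by (simp add: lessThan_Suc_eq_insert_0)
  then show ?thesis by (auto simp: polygon_graph_def)
qed

lemma np_graph_eq: "np_graph \<xi> = polygon_graph (np_list \<xi>)"
proof -
  have "size \<xi> = length (np_list \<xi>)" by (metis np_list_props(1) size_mset)
  then show ?thesis by (simp add: np_graph_def polygon_graph_def np_break_def end_point_def)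
qed

lemma polyline_end: "\<forall>s\<in>set ss. coprime_pair s \<Longrightarrow> polyline ss (fst (end_point ss)) = snd (end_point ss)"
proof (cases ss)
  case (Cons s ss')
  assume "\<forall>s\<in>set ss. coprime_pair s"
  then have "0 < real (fst s + snd s)" using coprime_pair_height Cons by simp
  then show ?thesis using Cons by (simp add: end_point_Cons np_slope_def case_prod_beta)
qed simp

lemma polygon_graph_iff:
  assumes "\<forall>s\<in>set ss. coprime_pair s"
  shows "(x, y) \<in> polygon_graph ss \<longleftrightarrow> 0 \<le> x \<and> x \<le> fst (end_point ss) \<and> y = polyline ss x"
  using assms
proof (induction ss)
  case Nil
  then show ?case by (auto simp: polygon_graph_def)
next
  case (Cons s ss)
  let ?H = "fst (end_point ss)" and ?D = "snd (end_point ss)" and ?h = "real (fst s + snd s)" and ?n = "real (snd s)"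
  have h: "0 < ?h" using coprime_pair_height[of s] Cons.prems by simp
  have sl: "np_slope s = ?n / ?h" by (simp add: np_slope_def case_prod_beta)
  have H: "?D = polyline ss ?H" "0 \<le> ?H" using polyline_end[of ss] Cons.prems end_point_nonneg by auto
  have seg: "(x, y) \<in> closed_segment (end_point ss) (end_point (s # ss)) \<longleftrightarrow> ?H \<le> x \<and> x \<le> ?H + ?h \<and> y = ?D + (x - ?H) * np_slope s"
  proof
    assume "(x, y) \<in> closed_segment (end_point ss) (end_point (s # ss))"
    then obtain u where u: "0 \<le> u" "u \<le> 1" "(x, y) = (1 - u) *\<^sub>R end_point ss + u *\<^sub>R end_point (s # ss)"
      by (auto simp: in_segment)
    have x: "x = ?H + u * ?h" and y: "y = ?D + u * ?n"
      using arg_cong[OF u(3), of fst] arg_cong[OF u(3), of snd] by (auto simp: end_point_Cons algebra_simps)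
    have "u * ?h \<le> ?h" "0 \<le> u * ?h" using u h by (simp_all add: mult_left_le_one_le)
    then show "?H \<le> x \<and> x \<le> ?H + ?h \<and> y = ?D + (x - ?H) * np_slope s"
      using x y h by (simp add: sl)
  next
    assume a: "?H \<le> x \<and> x \<le> ?H + ?h \<and> y = ?D + (x - ?H) * np_slope s"
    let ?u = "(x - ?H) / ?h"
    have "0 \<le> ?u" "?u \<le> 1" using a h by (simp_all add: divide_le_eq)
    moreover have "(x, y) = (1 - ?u) *\<^sub>R end_point ss + ?u *\<^sub>R end_point (s # ss)"
    proof -
      have uh: "?u * ?h = x - ?H" and un: "?u * ?n = (x - ?H) * np_slope s" using h by (simp_all add: sl)
      have "(1 - ?u) * ?H + ?u * (?h + ?H) = ?H + ?u * ?h" "(1 - ?u) * ?D + ?u * (?n + ?D) = ?D + ?u * ?n"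
        by (simp_all only: algebra_simps)
      then have "(1 - ?u) * ?H + ?u * (?h + ?H) = x" "(1 - ?u) * ?D + ?u * (?n + ?D) = y"
        unfolding uh un using a by simp_all
      then show ?thesis by (simp only: end_point_Cons prod_eq_iff fst_add snd_add fst_scaleR snd_scaleR fst_conv snd_conv real_scaleR_def)
    qed
    ultimately show "(x, y) \<in> closed_segment (end_point ss) (end_point (s # ss))" by (auto simp: in_segment)
  qed
  have IH: "(x, y) \<in> polygon_graph ss \<longleftrightarrow> 0 \<le> x \<and> x \<le> ?H \<and> y = polyline ss x" using Cons by simp
  have hs: "fst (end_point (s # ss)) = ?H + ?h" by (simp add: end_point_Cons)
  show ?case unfolding polygon_graph_Cons Un_iff IH seg hs polyline.simps
    using H h by (cases "x \<le> ?H"; cases "x = ?H") auto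
qed

lemma np_fun_eq:
  assumes "newton_polygon \<xi>" "0 \<le> x" "x \<le> fst (end_point (np_list \<xi>))"
  shows "np_fun \<xi> x = polyline (np_list \<xi>) x"
proof -
  have "\<forall>s\<in>set (np_list \<xi>). coprime_pair s"
    using assms(1) np_list_props(1)[of \<xi>] unfolding newton_polygon_def by (metis case_prod_beta set_mset_mset)
  then show ?thesis unfolding np_fun_def np_graph_eq using assms(2,3) by (simp add: polygon_graph_iff)
qed

lemma end_point_np_list: "end_point (np_list \<xi>) = (real (np_height \<xi>), real (np_dim \<xi>))"
proof -
  have "end_point ss = (real (np_height (mset ss)), real (np_dim (mset ss)))" for ss
    by (induction ss) (auto simp: end_point_Cons np_height_def np_dim_def case_prod_beta)
  then show ?thesis using np_list_props(1) by metis
qed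

lemma end_point_sum_list: "end_point ss = (real (fst (sum_list ss) + snd (sum_list ss)), real (snd (sum_list ss)))"
  by (induction ss) (auto simp: end_point_Cons)

section \<open>Minima in a direction\<close>

text \<open>
  The minimum of the linear function \<open>sdet w\<close> on the breaking points: in the order of increasing
  slopes the function first decreases and then increases. Its level lines have the slope of \<open>w\<close>.
\<close>

definition dir_min :: "nat \<times> nat \<Rightarrow> (nat \<times> nat) multiset \<Rightarrow> int" where
  "dir_min w \<xi> = (\<Sum>s\<in>#\<xi>. min 0 (sdet w s))"

lemma dir_min_add [simp]: "dir_min w (\<xi> + \<eta>) = dir_min w \<xi> + dir_min w \<eta>"
  and dir_min_empty [simp]: "dir_min w {#} = 0" and dir_min_single [simp]: "dir_min w {#s#} = min 0 (sdet w s)"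
  by (simp_all add: dir_min_def)

lemma dir_min_add_mset: "dir_min w (add_mset s \<xi>) = min 0 (sdet w s) + dir_min w \<xi>"
  by (simp add: dir_min_def)

text \<open>
  The function \<open>sdet w\<close> in the coordinates height and dimension.
\<close>

definition level :: "nat \<times> nat \<Rightarrow> real \<times> real \<Rightarrow> real" where
  "level w p = real (fst w + snd w) * snd p - real (snd w) * fst p"

lemma level_end_point: "level w (end_point ss) = real_of_int (\<Sum>s\<leftarrow>ss. sdet w s)"
  by (induction ss) (auto simp: end_point_Cons level_def sdet_eq algebra_simps)

lemma dir_min_nonpos: "dir_min w \<xi> \<le> 0"
  by (induction \<xi>) (auto simp: dir_min_add_mset)

lemma dir_min_le_sum: "dir_min w (mset ss) \<le> (\<Sum>s\<leftarrow>ss. sdet w s)"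
  by (induction ss) (auto simp: dir_min_add_mset)

lemma level_polyline:
  assumes "\<forall>s\<in>set ss. coprime_pair s" "0 \<le> x" "x \<le> fst (end_point ss)"
  shows "real_of_int (dir_min w (mset ss)) \<le> level w (x, polyline ss x)"
  using assms
proof (induction ss)
  case (Cons s ss)
  let ?H = "fst (end_point ss)" and ?h = "real (fst s + snd s)"
  show ?case
  proof (cases "x \<le> ?H")
    case True
    then have "real_of_int (dir_min w (mset ss)) \<le> level w (x, polyline ss x)" using Cons by simp
    moreover have "real_of_int (min 0 (sdet w s)) \<le> 0" by simp
    ultimately show ?thesis using True by (simp add: dir_min_add_mset)
  next
    case False
    have h: "0 < ?h" using coprime_pair_height[of s] Cons.prems by simp
    let ?u = "(x - ?H) / ?h"
    have lin: "level w (?H + u * ?h, snd (end_point ss) + u * real (snd s)) = level w (end_point ss) + u * real_of_int (sdet w s)" for u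
      by (simp add: level_def sdet_eq algebra_simps)
    have u: "0 \<le> ?u" "?u \<le> 1" using False Cons.prems h by (simp_all add: divide_le_eq end_point_Cons)
    have "x = ?H + ?u * ?h" "(x - ?H) * np_slope s = ?u * real (snd s)"
      using h by (simp_all add: np_slope_def case_prod_beta)
    then have "level w (x, polyline (s # ss) x) = level w (?H + ?u * ?h, snd (end_point ss) + ?u * real (snd s))"
      using False by simp
    also have "\<dots> = level w (end_point ss) + ?u * real_of_int (sdet w s)" by (rule lin)
    finally have "level w (x, polyline (s # ss) x) = level w (end_point ss) + ?u * real_of_int (sdet w s)" .
    moreover have "real_of_int (min 0 (sdet w s)) \<le> ?u * real_of_int (sdet w s)"
    proof (cases "0 \<le> sdet w s")
      case True
      then have "0 \<le> ?u * real_of_int (sdet w s)" using u by (intro mult_nonneg_nonneg) auto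
      then show ?thesis using True by (simp only: min_absorb1 of_int_0)
    next
      case False
      then have "?u * real_of_int (sdet w s) \<ge> 1 * real_of_int (sdet w s)"
        using u by (intro mult_right_mono_neg) auto
      then show ?thesis using False by simp
    qed
    moreover have "real_of_int (dir_min w (mset ss)) \<le> level w (end_point ss)"
      unfolding level_end_point using dir_min_le_sum by (simp only: of_int_le_iff)
    ultimately show ?thesis by (simp add: dir_min_add_mset)
  qed
qed (simp add: level_def)

lemma dir_min_attained:
  assumes "\<forall>s\<in>set ss. coprime_pair s" "sorted_wrt (\<lambda>p q. np_slope p \<ge> np_slope q) ss"
  shows "\<exists>j. dir_min w (mset ss) = (\<Sum>s\<leftarrow>drop j ss. sdet w s)"
  using assms
proof (induction ss)
  case (Cons s ss)
  show ?case
  proof (cases "0 \<le> sdet w s")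
    case True
    obtain j where "dir_min w (mset ss) = (\<Sum>s\<leftarrow>drop j ss. sdet w s)" using Cons by auto
    then show ?thesis using True by (intro exI[where x = "Suc j"]) (simp add: dir_min_add_mset)
  next
    case False
    have "sdet w t < 0" if "t \<in> set ss" for t
    proof (rule ccontr)
      assume "\<not> sdet w t < 0"
      moreover have "0 \<le> sdet t s" using Cons.prems that slope_le_iff by auto
      ultimately have "0 \<le> sdet w s" using Cons.prems that by (intro sdet_trans[of w t s]) (auto dest: coprime_pair_nonzero)
      then show False using False by simp
    qed
    then have "dir_min w (mset ss) = (\<Sum>s\<leftarrow>ss. sdet w s)"
      by (induction ss) (auto simp: dir_min_add_mset)
    then show ?thesis using False by (intro exI[where x = 0]) (simp add: dir_min_add_mset)
  qed
qed simp

lemma polyline_drop: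
  assumes "\<forall>s\<in>set ss. coprime_pair s"
  shows "polyline ss (fst (end_point (drop j ss))) = snd (end_point (drop j ss)) \<and> fst (end_point (drop j ss)) \<le> fst (end_point ss)"
  using assms
proof (induction ss arbitrary: j)
  case (Cons s ss)
  show ?case
  proof (cases j)
    case 0
    then show ?thesis using polyline_end[OF Cons.prems] by simp
  next
    case (Suc i)
    then show ?thesis using Cons.IH[of i] Cons.prems by (simp add: end_point_Cons)
  qed
qed simp

text \<open>
  At the breaking point of \<open>\<zeta>\<close> where the minimum is attained, \<open>\<xi>\<close> lies below or on it, and \<open>\<xi>\<close> nowhere falls
  below its own minimum.
\<close>

lemma np_prec_dir_min:
  assumes np: "newton_polygon \<zeta>" "newton_polygon \<xi>" and prec: "np_prec \<zeta> \<xi>"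
  shows "dir_min w \<xi> \<le> dir_min w \<zeta>"
proof -
  let ?Z = "np_list \<zeta>" and ?X = "np_list \<xi>"
  have m: "mset ?Z = \<zeta>" "mset ?X = \<xi>" by (simp_all add: np_list_props)
  have coprime_pair: "\<forall>s\<in>set ?Z. coprime_pair s" "\<forall>s\<in>set ?X. coprime_pair s"
    using np m unfolding newton_polygon_def by (metis case_prod_beta set_mset_mset)+
  obtain j where j: "dir_min w (mset ?Z) = (\<Sum>s\<leftarrow>drop j ?Z. sdet w s)"
    using dir_min_attained[OF coprime_pair(1) np_list_props(2)] by blast
  let ?x = "fst (end_point (drop j ?Z))"
  have H: "fst (end_point ?Z) = fst (end_point ?X)" using prec by (simp add: np_prec_def end_point_np_list)
  have x: "0 \<le> ?x" "?x \<le> fst (end_point ?Z)" "polyline ?Z ?x = snd (end_point (drop j ?Z))"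
    using end_point_nonneg polyline_drop[OF coprime_pair(1), of j] by auto
  then have "?x \<in> {0..real (np_height \<xi>)}" using H by (simp add: end_point_np_list)
  then have "np_fun \<xi> ?x \<le> np_fun \<zeta> ?x" using prec by (simp add: np_prec_def)
  then have "polyline ?X ?x \<le> polyline ?Z ?x"
    using np_fun_eq[OF np(1) x(1,2)] np_fun_eq[OF np(2) x(1)] x(2) H by simp
  then have "level w (?x, polyline ?X ?x) \<le> level w (?x, polyline ?Z ?x)"
    by (simp add: level_def mult_left_mono)
  also have "\<dots> = level w (end_point (drop j ?Z))" using x(3) by (simp add: level_def)
  also have "\<dots> = real_of_int (dir_min w \<zeta>)" using j m by (simp only: level_end_point)
  finally have "real_of_int (dir_min w \<xi>) \<le> real_of_int (dir_min w \<zeta>)"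
    using level_polyline[OF coprime_pair(2) x(1), of w] x(2) H m by simp
  then show ?thesis by simp
qed

section \<open>Areas\<close>

text \<open>
  On each segment the summands form an arithmetic progression, because the breaking points are
  integral. The determinants account for the area by which the graph deviates from its chord.
\<close>

lemma polyline_sum:
  assumes "\<forall>s\<in>set ss. coprime_pair s"
  shows "2 * (\<Sum>i = 1..fst (sum_list ss) + snd (sum_list ss). polyline ss (real i)) =
    snd (end_point ss) * fst (end_point ss) + snd (end_point ss) + real_of_int (det_sum ss)"
  using assms
proof (induction ss)
  case (Cons s ss)
  let ?H = "fst (sum_list ss) + snd (sum_list ss)" and ?k = "fst s + snd s"
  have k: "0 < real ?k" using coprime_pair_height[of s] Cons.prems by simp
  have gauss: "(\<Sum>i = 1..k. real i) = real k * (real k + 1) / 2" for k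
    by (induction k) (auto simp: field_simps)
  have H: "fst (end_point ss) = real ?H" by (simp add: end_point_sum_list)
  have "(\<Sum>i = 1..?H + ?k. polyline (s # ss) (real i)) =
     (\<Sum>i = 1..?H. polyline (s # ss) (real i)) + (\<Sum>i = ?H + 1..?H + ?k. polyline (s # ss) (real i))"
    by (rule sum.ub_add_nat) simp
  also have "(\<Sum>i = 1..?H. polyline (s # ss) (real i)) = (\<Sum>i = 1..?H. polyline ss (real i))"
    by (intro sum.cong) (auto simp: H simp flip: of_nat_add)
  also have "(\<Sum>i = ?H + 1..?H + ?k. polyline (s # ss) (real i)) = (\<Sum>i = 1..?k. polyline (s # ss) (real (i + ?H)))"
    using sum.shift_bounds_cl_nat_ivl[of "\<lambda>i. polyline (s # ss) (real i)" 1 ?H ?k] by (simp add: add.commute)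
  also have "\<dots> = (\<Sum>i = 1..?k. snd (end_point ss) + real i * np_slope s)"
    by (intro sum.cong) (auto simp: H)
  also have "\<dots> = real ?k * snd (end_point ss) + (\<Sum>i = 1..?k. real i) * np_slope s"
    by (simp add: sum.distrib sum_distrib_right)
  also have "(\<Sum>i = 1..?k. real i) = real ?k * (real ?k + 1) / 2"
    by (rule gauss)
  also have "real ?k * (real ?k + 1) / 2 * np_slope s = real (snd s) * (real ?k + 1) / 2"
  proof -
    have "a * (a + 1) / 2 * (n / a) = n * (a + 1) / 2" if "0 < a" for a n :: real
      using that by (simp add: field_simps)
    moreover have "np_slope s = real (snd s) / real ?k" by (simp add: np_slope_def case_prod_beta)
    ultimately show ?thesis using k by presburger
  qed
  finally have "2 * (\<Sum>i = 1..?H + ?k. polyline (s # ss) (real i)) =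
     2 * (\<Sum>i = 1..?H. polyline ss (real i)) + 2 * real ?k * snd (end_point ss) + real (snd s) * (real ?k + 1)"
    by (simp add: field_simps)
  also have "2 * (\<Sum>i = 1..?H. polyline ss (real i)) = snd (end_point ss) * fst (end_point ss) + snd (end_point ss) + real_of_int (det_sum ss)"
    using Cons by simp
  finally have "2 * (\<Sum>i = 1..?H + ?k. polyline (s # ss) (real i)) = snd (end_point ss) * fst (end_point ss) + snd (end_point ss) +
     real_of_int (det_sum ss) + 2 * real ?k * snd (end_point ss) + real (snd s) * (real ?k + 1)" .
  also have "\<dots> = snd (end_point (s # ss)) * fst (end_point (s # ss)) + snd (end_point (s # ss)) + real_of_int (det_sum (s # ss))"
    by (simp add: end_point_sum_list sdet_eq algebra_simps)
  finally show ?case by (simp add: add_ac)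
qed simp

text \<open>
  The sum is over ordered pairs, so that every pair of segments counts twice.
\<close>

definition det_total :: "(nat \<times> nat) multiset \<Rightarrow> int" where
  "det_total \<xi> = (\<Sum>s\<in>#\<xi>. \<Sum>t\<in>#\<xi>. \<bar>sdet s t\<bar>)"

definition det_cross :: "(nat \<times> nat) multiset \<Rightarrow> (nat \<times> nat) multiset \<Rightarrow> int" where
  "det_cross \<xi> \<eta> = (\<Sum>s\<in>#\<xi>. \<Sum>t\<in>#\<eta>. \<bar>sdet s t\<bar>)"

lemma det_cross_sym: "det_cross \<xi> \<eta> = det_cross \<eta> \<xi>"
proof -
  have a: "det_cross \<xi> (add_mset t \<eta>) = det_cross \<xi> {#t#} + det_cross \<xi> \<eta>"
    "det_cross (add_mset t \<eta>) \<xi> = det_cross {#t#} \<xi> + det_cross \<eta> \<xi>" for t \<xi> \<eta>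
    by (simp_all add: det_cross_def sum_mset.distrib)
  have "\<bar>sdet s t\<bar> = \<bar>sdet t s\<bar>" for s t using sdet_anti[of s t] by simp
  then have b: "det_cross \<xi> {#t#} = det_cross {#t#} \<xi>" for t by (simp add: det_cross_def)
  show ?thesis
  proof (induction \<eta>)
    case (add t \<eta>)
    then show ?case using a(1)[of \<xi> t \<eta>] a(2)[of t \<eta> \<xi>] b[of t] by linarith
  qed (simp add: det_cross_def)
qed

lemma det_total_add: "det_total (\<xi> + \<eta>) = det_total \<xi> + det_total \<eta> + 2 * det_cross \<xi> \<eta>"
proof -
  have "det_total (\<xi> + \<eta>) = det_total \<xi> + det_cross \<xi> \<eta> + det_cross \<eta> \<xi> + det_total \<eta>"
    by (simp add: det_total_def det_cross_def sum_mset.distrib)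
  then show ?thesis using det_cross_sym[of \<eta> \<xi>] by simp
qed

lemma sum_mset_int_nonneg: "(\<And>s. 0 \<le> f s) \<Longrightarrow> 0 \<le> (\<Sum>s\<in>#\<xi>. f s :: int)"
  by (induction \<xi>) auto

lemma det_total_nonneg: "0 \<le> det_total \<xi>"
  unfolding det_total_def by (intro sum_mset_int_nonneg) auto

lemma sdet_sum_list: "sdet s (sum_list ss) = (\<Sum>t\<leftarrow>ss. sdet s t)"
  by (induction ss) auto

lemma det_cross_single_list: "det_cross {#s#} (mset ss) = (\<Sum>t\<leftarrow>ss. \<bar>sdet s t\<bar>)"
  by (simp add: det_cross_def flip: sum_mset_sum_list)

lemma det_total_sorted:
  "sorted_wrt (\<lambda>s t. 0 \<le> sdet s t) ss \<Longrightarrow> det_total (mset ss) = 2 * det_sum ss"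
  "sorted_wrt (\<lambda>s t. sdet s t \<le> 0) ss \<Longrightarrow> det_total (mset ss) = - 2 * det_sum ss"
proof -
  have single: "det_total {#s#} = 0" for s by (simp add: det_total_def)
  have add: "det_total (mset (s # ss)) = det_total (mset ss) + 2 * det_cross {#s#} (mset ss)" for s ss
    using det_total_add[of "{#s#}" "mset ss"] single by simp
  show "sorted_wrt (\<lambda>s t. 0 \<le> sdet s t) ss \<Longrightarrow> det_total (mset ss) = 2 * det_sum ss"
  proof (induction ss)
    case (Cons s ss)
    have "(\<Sum>t\<leftarrow>ss. \<bar>sdet s t\<bar>) = (\<Sum>t\<leftarrow>ss. sdet s t)"
      using Cons.prems by (intro arg_cong[where f = sum_list] map_cong) auto
    then show ?case using Cons add[of s ss] by (simp add: det_cross_single_list sdet_sum_list)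
  qed (simp add: det_total_def)
  show "sorted_wrt (\<lambda>s t. sdet s t \<le> 0) ss \<Longrightarrow> det_total (mset ss) = - 2 * det_sum ss"
  proof (induction ss)
    case (Cons s ss)
    have "(\<Sum>t\<leftarrow>ss. \<bar>sdet s t\<bar>) = (\<Sum>t\<leftarrow>ss. - sdet s t)"
      using Cons.prems by (intro arg_cong[where f = sum_list] map_cong) auto
    also have "\<dots> = - (\<Sum>t\<leftarrow>ss. sdet s t)" by (simp add: uminus_sum_list_map o_def)
    finally show ?case using Cons add[of s ss] by (simp add: det_cross_single_list sdet_sum_list)
  qed (simp add: det_total_def)
qed

lemma np_c_eq:
  assumes np: "newton_polygon \<zeta>" "newton_polygon \<xi>" and prec: "np_prec \<zeta> \<xi>"
  shows "2 * np_c \<zeta> \<xi> = real_of_int (det_total \<xi> - det_total \<zeta>)"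
proof -
  have hd: "np_height \<zeta> = np_height \<xi>" "np_dim \<zeta> = np_dim \<xi>" using prec by (simp_all add: np_prec_def)
  have sum: "2 * (\<Sum>i = 1..np_height \<eta>. np_fun \<eta> (real i)) =
      real (np_dim \<eta>) * real (np_height \<eta>) + real (np_dim \<eta>) - real_of_int (det_total \<eta>) / 2"
    if np: "newton_polygon \<eta>" for \<eta>
  proof -
    let ?L = "np_list \<eta>"
    have m: "mset ?L = \<eta>" by (simp add: np_list_props)
    have coprime_pair: "\<forall>s\<in>set ?L. coprime_pair s"
      using np m unfolding newton_polygon_def by (metis case_prod_beta set_mset_mset)
    have "sorted_wrt (\<lambda>s t. sdet s t \<le> 0) ?L"
    proof (rule sorted_wrt_mono_rel[OF _ np_list_props(2)])
      fix s t assume "s \<in> set ?L" "t \<in> set ?L" "np_slope t \<le> np_slope s"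
      then have "0 \<le> sdet t s" using coprime_pair slope_le_iff by blast
      then show "sdet s t \<le> 0" using sdet_anti[of s t] by simp
    qed
    from det_total_sorted(2)[OF this] have p: "det_total \<eta> = - 2 * det_sum ?L" using m by simp
    have h: "np_height \<eta> = fst (sum_list ?L) + snd (sum_list ?L)"
      using end_point_np_list[of \<eta>] end_point_sum_list[of ?L] by (simp del: of_nat_add)
    have "(\<Sum>i = 1..np_height \<eta>. np_fun \<eta> (real i)) = (\<Sum>i = 1..np_height \<eta>. polyline ?L (real i))"
      by (intro sum.cong refl np_fun_eq[OF np]) (auto simp: end_point_np_list)
    then show ?thesis using polyline_sum[OF coprime_pair] p by (simp add: end_point_np_list flip: h)
  qed
  show ?thesis
    using sum[OF np(1)] sum[OF np(2)] hd
    by (simp add: np_c_def sum_subtractf)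
qed

section \<open>From polygon to polygon\<close>

lemma sum_mset_sdet: "sdet s (sum_mset \<xi>) = (\<Sum>t\<in>#\<xi>. sdet s t)"
  by (induction \<xi>) auto

lemma int_pair_sum: "idet u (int_pair (sum_mset \<xi>)) = (\<Sum>t\<in>#\<xi>. idet u (int_pair t))"
  by (induction \<xi>) (auto simp: int_pair_add, simp add: int_pair_def idet_def)

lemma dir_min_le_sdet: "\<theta> \<subseteq># \<xi> \<Longrightarrow> dir_min w \<xi> \<le> (\<Sum>t\<in>#\<theta>. sdet w t)"
proof -
  assume "\<theta> \<subseteq># \<xi>"
  then obtain \<eta> where "\<xi> = \<theta> + \<eta>" by (auto simp: mset_subset_eq_exists_conv)
  moreover have "dir_min w \<theta> \<le> (\<Sum>t\<in>#\<theta>. sdet w t)" by (induction \<theta>) (auto simp: dir_min_add_mset)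
  moreover have "dir_min w \<eta> \<le> 0" by (rule dir_min_nonpos)
  ultimately show ?thesis by simp
qed

lemma dir_min_filter: "dir_min w \<xi> = (\<Sum>t\<in>#filter_mset (\<lambda>t. sdet w t < 0) \<xi>. sdet w t)"
  by (induction \<xi>) (auto simp: dir_min_add_mset)

lemma dir_min_eq_0: "(\<And>t. t \<in># \<xi> \<Longrightarrow> 0 \<le> sdet w t) \<Longrightarrow> dir_min w \<xi> = 0"
  by (induction \<xi>) (auto simp: dir_min_add_mset)

lemma dir_min_eq_0_iff: "dir_min w \<xi> = 0 \<longleftrightarrow> (\<forall>t\<in>#\<xi>. 0 \<le> sdet w t)"
proof (induction \<xi>)
  case (add t \<xi>)
  have "dir_min w \<xi> \<le> 0" by (rule dir_min_nonpos)
  then show ?case using add by (auto simp: dir_min_add_mset min_def split: if_splits)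
qed simp

lemma dir_min_superadd: "dir_min w (mset as) \<le> min 0 (sdet w (sum_list as))"
  using dir_min_le_sum[of w as] dir_min_nonpos[of w "mset as"] by (simp add: sdet_sum_list)

text \<open>
  In a direction \<open>w\<close> between \<open>x\<close> and \<open>y\<close>, let \<open>q\<close> lead from the first corner of \<open>\<xi>\<close> to the lowest breaking
  point of \<open>\<zeta>\<close>. It is a lattice vector in the cone at the corner, and it is not zero: either the breaking
  point is the origin, or it lies strictly above the line through the segments \<open>x\<close>. Hence
  \<open>fan_support\<close> applies. In all other directions the refinement does not raise the minimum.
\<close>

lemma refined_above:
  assumes xi: "\<xi> = replicate_mset (Suc c) x + add_mset y \<eta>"
    and y: "0 < sdet x y" and low: "\<And>s. s \<in># \<eta> \<Longrightarrow> 0 \<le> sdet y s" and coprime_pair: "\<And>s. s \<in># \<xi> \<Longrightarrow> coprime_pair s" "coprime_pair w"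
    and above: "\<And>w. coprime_pair w \<Longrightarrow> dir_min w \<xi> \<le> dir_min w \<zeta>" and off: "\<And>z. z \<in># \<zeta> \<Longrightarrow> 0 < sdet x z"
    and fan: "fan x as y"
  shows "dir_min w (replicate_mset c x + mset as + \<eta>) \<le> dir_min w \<zeta>"
proof (cases "0 < sdet x w \<and> 0 < sdet w y")
  case False
  have "dir_min w (mset as) \<le> min 0 (sdet w x) + min 0 (sdet w y)"
  proof -
    have "\<not> (sdet w x < 0 \<and> 0 < sdet w y)" using False sdet_anti[of w x] by auto
    moreover have "\<not> (0 < sdet w x \<and> sdet w y < 0)"
    proof
      assume a: "0 < sdet w x \<and> sdet w y < 0"
      have "0 \<le> sdet w y" by (rule sdet_trans[of w x y]) (use a y in auto)
      then show False using a by simp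
    qed
    moreover have "dir_min w (mset as) \<le> min 0 (sdet w (x + y))"
      using dir_min_superadd[of w as] fan_sum[OF fan] by simp
    ultimately show ?thesis by (auto simp: min_def split: if_splits)
  qed
  then have "dir_min w (replicate_mset c x + mset as + \<eta>) \<le> dir_min w \<xi>"
    by (simp add: xi dir_min_add_mset)
  then show ?thesis using above[OF coprime_pair(2)] by simp
next
  case True
  let ?\<theta> = "filter_mset (\<lambda>t. sdet w t < 0) \<zeta>"
  \<comment> \<open>The lowest breaking point of \<open>\<zeta>\<close> in the direction \<open>w\<close>, seen from the first corner of \<open>\<xi>\<close>.\<close>
  define q where "q = int_pair (sum_mset ?\<theta>) - int_pair (sum_mset (replicate_mset (Suc c) x))"
  have copy: "coprime_pair y" "coprime_pair x" using coprime_pair xi by auto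
  have dq: "idet (int_pair s) q = (\<Sum>t\<in>#?\<theta>. sdet s t) - (int c + 1) * sdet s x" for s
  proof -
    have "idet (int_pair s) q = idet (int_pair s) (int_pair (sum_mset ?\<theta>)) - idet (int_pair s) (int_pair (sum_mset (replicate_mset (Suc c) x)))"
      by (simp add: q_def idet_def algebra_simps)
    also have "\<dots> = (\<Sum>t\<in>#?\<theta>. sdet s t) - (\<Sum>t\<in>#replicate_mset (Suc c) x. sdet s t)"
      by (simp only: int_pair_sum sdet_def)
    finally show ?thesis by (simp add: algebra_simps)
  qed
  have "0 \<le> (\<Sum>t\<in>#?\<theta>. sdet x t)"
    using off by (intro sum_mset_mono[of ?\<theta> "\<lambda>_. 0" "sdet x", simplified]) (auto intro: less_imp_le)
  then have qx: "0 \<le> idet (int_pair x) q" unfolding dq by simp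
  have "dir_min y \<xi> = (int c + 1) * sdet y x"
    using dir_min_eq_0[of \<eta> y] low y sdet_anti[of y x] by (simp add: xi dir_min_add_mset dir_min_def[of y "replicate_mset c x"] algebra_simps)
  then have "(int c + 1) * sdet y x \<le> (\<Sum>t\<in>#?\<theta>. sdet y t)"
    using above[OF copy(1)] dir_min_le_sdet[of ?\<theta> \<zeta> y] by simp
  then have qy: "0 \<le> idet (int_pair y) q" unfolding dq by simp
  have q0: "q \<noteq> 0"
  proof (cases "?\<theta> = {#}")
    case True
    have "idet (int_pair w) q = - (int c + 1) * sdet w x" unfolding dq True by (simp add: algebra_simps)
    moreover have "sdet w x < 0" using \<open>0 < sdet x w \<and> 0 < sdet w y\<close> sdet_anti[of w x] by simp
    ultimately have "idet (int_pair w) q \<noteq> 0" by simp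
    then show ?thesis by (auto simp: idet_def)
  next
    case False
    then obtain t where t: "t \<in># ?\<theta>" by blast
    have "0 < (\<Sum>t\<in>#?\<theta>. sdet x t)"
    proof -
      have "?\<theta> = add_mset t (?\<theta> - {#t#})" using t by simp
      then have "(\<Sum>t\<in>#?\<theta>. sdet x t) = sdet x t + (\<Sum>t\<in>#?\<theta> - {#t#}. sdet x t)" by (metis image_mset_add_mset sum_mset.insert)
      moreover have "0 \<le> (\<Sum>t\<in>#?\<theta> - {#t#}. sdet x t)"
        using off by (intro sum_mset_mono[of "?\<theta> - {#t#}" "\<lambda>_. 0" "sdet x", simplified]) (auto dest!: in_diffD intro: less_imp_le)
      moreover have "0 < sdet x t" using off t by simp
      ultimately show ?thesis by simp
    qed
    then have "idet (int_pair x) q \<noteq> 0" unfolding dq by simp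
    then show ?thesis by (auto simp: idet_def)
  qed
  have sup: "(\<Sum>a\<leftarrow>as. min 0 (sdet w a)) = dir_min w (mset as)"
    by (simp add: dir_min_def flip: sum_mset_sum_list)
  have "idet (int_pair w) q \<ge> idet (int_pair x) (int_pair w) + (\<Sum>a\<leftarrow>as. min 0 (idet (int_pair w) (int_pair a)))"
    by (rule fan_support[OF fan q0 qx qy]) (use True in \<open>simp_all add: sdet_def\<close>)
  then have "(\<Sum>t\<in>#?\<theta>. sdet w t) - (int c + 1) * sdet w x \<ge> sdet x w + dir_min w (mset as)"
    unfolding dq sdet_def[symmetric] sup .
  then have "dir_min w \<zeta> \<ge> int c * sdet w x + dir_min w (mset as)"
    using dir_min_filter[of w \<zeta>] sdet_anti[of w x] by (simp add: algebra_simps)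
  moreover have "dir_min w (replicate_mset c x) = int c * sdet w x"
    using True sdet_anti[of w x] by (simp add: dir_min_def)
  moreover have "dir_min w \<eta> = 0"
  proof (rule dir_min_eq_0)
    fix t assume "t \<in># \<eta>"
    then show "0 \<le> sdet w t" using sdet_trans[of w y t] True low copy(1) coprime_pair_nonzero by auto
  qed
  ultimately show ?thesis by simp
qed

text \<open>
  The slopes of \<open>as\<close> lie between those of \<open>x\<close> and \<open>y\<close> while the slope of \<open>s\<close> does not, so all
  determinants have the same sign and add up to the one with \<open>x + y\<close>.
\<close>

lemma det_cross_refined:
  assumes "s = x \<or> 0 \<le> sdet y s" "0 < sdet x y" "coprime_pair x" "coprime_pair y" "fan x as y" "\<forall>a\<in>set as. coprime_pair a \<and> 0 \<le> sdet x a \<and> 0 \<le> sdet a y"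
  shows "det_cross {#s#} (mset as) = \<bar>sdet s x\<bar> + \<bar>sdet s y\<bar>"
proof -
  have "det_cross {#s#} (mset as) = \<bar>sdet s (sum_list as)\<bar> \<and> \<bar>sdet s (x + y)\<bar> = \<bar>sdet s x\<bar> + \<bar>sdet s y\<bar>"
  proof (cases "s = x")
    case True
    have "(\<Sum>t\<leftarrow>as. \<bar>sdet s t\<bar>) = (\<Sum>t\<leftarrow>as. sdet s t)"
      using assms True by (intro arg_cong[where f = sum_list] map_cong) auto
    moreover have "0 \<le> (\<Sum>t\<leftarrow>as. sdet s t)" using assms True by (intro sum_list_nonneg) auto
    ultimately show ?thesis using True assms(2) by (simp add: det_cross_single_list sdet_sum_list)
  next
    case False
    then have ys: "0 \<le> sdet y s" using assms(1) by simp
    have neg: "sdet s t \<le> 0" if "t \<in> set as" for t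
      using sdet_trans[of t y s] ys assms(4,6) that sdet_anti[of s t] coprime_pair_nonzero by force
    have "sdet s x \<le> 0" using sdet_trans[of x y s] ys assms(2,4) sdet_anti[of s x] coprime_pair_nonzero by force
    moreover have "sdet s y \<le> 0" using ys sdet_anti[of s y] by simp
    moreover have "(\<Sum>t\<leftarrow>as. \<bar>sdet s t\<bar>) = (\<Sum>t\<leftarrow>as. - sdet s t)"
      using neg by (intro arg_cong[where f = sum_list] map_cong) auto
    moreover have "(\<Sum>t\<leftarrow>as. sdet s t) \<le> 0" using neg by (intro sum_list_nonpos) auto
    moreover have "(\<Sum>t\<leftarrow>as. - sdet s t) = - (\<Sum>t\<leftarrow>as. sdet s t)" by (simp add: uminus_sum_list_map o_def)
    ultimately show ?thesis by (simp add: det_cross_single_list sdet_sum_list)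
  qed
  then show ?thesis using fan_sum[OF assms(5)] by simp
qed

lemma lowest_slope:
  assumes "\<xi> \<noteq> {#}" "\<And>s. s \<in># \<xi> \<Longrightarrow> coprime_pair s"
  obtains x where "x \<in># \<xi>" "\<And>s. s \<in># \<xi> \<Longrightarrow> 0 \<le> sdet x s"
proof -
  have fin: "finite (set_mset \<xi>)" "set_mset \<xi> \<noteq> {}" using assms(1) by auto
  obtain x where x: "x \<in># \<xi>" "np_slope x = Min (np_slope ` set_mset \<xi>)"
    using Min_in[of "np_slope ` set_mset \<xi>"] fin by (metis (no_types, lifting) finite_imageI image_iff image_is_empty)
  have "np_slope x \<le> np_slope s" if "s \<in># \<xi>" for s using x(2) fin that by simp
  then show ?thesis using that[OF x(1)] slope_le_iff assms(2) x(1) by blast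
qed

lemma sdet_0_eq:
  assumes "coprime_pair s" "coprime_pair t" "sdet s t = 0"
  shows "s = t"
proof -
  have eq: "fst s * snd t = snd s * fst t"
    using assms(3) by (simp add: sdet_eq flip: of_nat_mult)
  have "fst s dvd fst t" "fst t dvd fst s" "snd s dvd snd t" "snd t dvd snd s"
    using assms(1,2) eq by (metis coprime_dvd_mult_left_iff coprime_dvd_mult_right_iff dvd_triv_left dvd_triv_right coprime_commute)+
  then show ?thesis by (simp add: prod_eq_iff dvd_antisym)
qed

text \<open>
  Let \<open>x\<close> be the lowest slope of \<open>\<xi>\<close>. If \<open>x\<close> also occurs in \<open>\<zeta>\<close>, it is the lowest slope there too and
  contributes the same amount to both totals; it is removed from both. Otherwise \<open>x\<close> and the next
  slope \<open>y\<close> are replaced by a refining path, which lowers the total by twice the length of the path.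
\<close>

theorem polygon_chain:
  assumes "\<And>s. s \<in># \<zeta> \<Longrightarrow> coprime_pair s" "\<And>s. s \<in># \<xi> \<Longrightarrow> coprime_pair s" "sum_mset \<zeta> = sum_mset \<xi>"
    "\<And>w. coprime_pair w \<Longrightarrow> dir_min w \<xi> \<le> dir_min w \<zeta>"
  shows "\<exists>k xs ys. mset xs = \<zeta> \<and> mset ys = \<xi> \<and> wsteps k (map minimal_seq xs) (map minimal_seq ys) \<and>
    2 * int k = det_total \<xi> - det_total \<zeta> \<and> (k = 0 \<longrightarrow> \<zeta> = \<xi>)"
  using assms
proof (induction "(nat (det_total \<xi>), size \<xi>)" arbitrary: \<zeta> \<xi> rule: wf_induct_rule[OF wf_lex_prod[OF wf_less_than wf_less_than]])
  case (1 \<xi> \<zeta>)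
  show ?case
  proof (cases "\<xi> = {#}")
    case True
    have "\<zeta> = {#}"
    proof (rule ccontr)
      assume "\<zeta> \<noteq> {#}"
      then obtain s \<zeta>' where s: "\<zeta> = add_mset s \<zeta>'" by (meson multiset_cases)
      then have "s + sum_mset \<zeta>' = 0" using "1.prems"(3) True by simp
      then have "s = 0" by (simp add: prod_eq_iff)
      then show False using "1.prems"(1) s coprime_pair_nonzero by auto
    qed
    then show ?thesis using True by (intro exI[where x = 0] exI[where x = "[]"]) (auto intro: wsteps_0 lp_iso_refl)
  next
    case False
    obtain x where x: "x \<in># \<xi>" and xlow: "\<And>s. s \<in># \<xi> \<Longrightarrow> 0 \<le> sdet x s"
      using lowest_slope[OF False] "1.prems"(2) by blast
    have copx: "coprime_pair x" using x "1.prems"(2) by blast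
    have "dir_min x \<xi> = 0" using dir_min_eq_0 xlow by blast
    then have "dir_min x \<zeta> = 0" using "1.prems"(4)[OF copx] dir_min_nonpos[of x \<zeta>] by simp
    then have zlow: "\<And>z. z \<in># \<zeta> \<Longrightarrow> 0 \<le> sdet x z" using dir_min_eq_0_iff by blast
    show ?thesis
    proof (cases "x \<in># \<zeta>")
      case True
      obtain \<zeta>' where z: "\<zeta> = add_mset x \<zeta>'" using True by (metis insert_DiffM)
      obtain \<xi>' where xi: "\<xi> = add_mset x \<xi>'" using x by (metis insert_DiffM)
      have sdet: "det_cross {#x#} \<theta> = sdet x (sum_mset \<theta>)" if "\<And>s. s \<in># \<theta> \<Longrightarrow> 0 \<le> sdet x s" for \<theta>
        using that by (induction \<theta>) (auto simp: det_cross_def)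
      have sum: "sum_mset \<zeta>' = sum_mset \<xi>'" using "1.prems"(3) by (simp add: z xi)
      have pz: "det_total \<zeta> = det_total \<zeta>' + 2 * sdet x (sum_mset \<zeta>')" and px: "det_total \<xi> = det_total \<xi>' + 2 * sdet x (sum_mset \<xi>')"
        using det_total_add[of "{#x#}" \<zeta>'] det_total_add[of "{#x#}" \<xi>'] sdet[of \<zeta>'] sdet[of \<xi>'] zlow xlow
        by (simp_all add: z xi det_total_def[of "{#x#}"])
      have "0 \<le> det_cross {#x#} \<xi>'" unfolding det_cross_def by (intro sum_mset_int_nonneg) simp
      then have "0 \<le> sdet x (sum_mset \<xi>')" using sdet[of \<xi>'] xlow by (simp add: xi)
      then have less: "((nat (det_total \<xi>'), size \<xi>'), (nat (det_total \<xi>), size \<xi>)) \<in> less_than <*lex*> less_than"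
        using px det_total_nonneg[of \<xi>'] by (auto simp: xi)
      have "\<exists>k xs ys. mset xs = \<zeta>' \<and> mset ys = \<xi>' \<and> wsteps k (map minimal_seq xs) (map minimal_seq ys) \<and>
          2 * int k = det_total \<xi>' - det_total \<zeta>' \<and> (k = 0 \<longrightarrow> \<zeta>' = \<xi>')"
        using "1.prems" by (intro "1.hyps"[OF less]) (auto simp: z xi sum dir_min_add_mset)
      then obtain k xs ys where k: "mset xs = \<zeta>'" "mset ys = \<xi>'" "wsteps k (map minimal_seq xs) (map minimal_seq ys)"
          "2 * int k = det_total \<xi>' - det_total \<zeta>'" "k = 0 \<longrightarrow> \<zeta>' = \<xi>'" by blast
      have "wsteps k ([minimal_seq x] @ map minimal_seq xs) ([minimal_seq x] @ map minimal_seq ys)"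
        using k(3) by (rule wsteps_append)
      then show ?thesis using k px pz sum
        by (intro exI[where x = k] exI[where x = "x # xs"] exI[where x = "x # ys"]) (auto simp: z xi)
    next
      case notin: False
      have off: "0 < sdet x z" if "z \<in># \<zeta>" for z
        using zlow[OF that] sdet_0_eq[OF copx "1.prems"(1)[OF that]] notin that by force
      define \<rho> where "\<rho> = filter_mset (\<lambda>s. s \<noteq> x) \<xi>"
      have xi: "\<xi> = replicate_mset (count \<xi> x) x + \<rho>"
        unfolding \<rho>_def by (rule multiset_eqI) auto
      obtain c where c: "count \<xi> x = Suc c" using x by (metis count_eq_zero_iff not0_implies_Suc)
      have "\<rho> \<noteq> {#}"
      proof
        assume "\<rho> = {#}"
        have rep: "sdet x (sum_mset (replicate_mset n x)) = 0" for n by (induction n) auto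
        have "\<xi> = replicate_mset (Suc c) x + \<rho>" using xi unfolding c .
        then have "sdet x (sum_mset \<xi>) = sdet x (sum_mset (replicate_mset (Suc c) x + \<rho>))" by (rule arg_cong)
        also have "\<dots> = 0" using \<open>\<rho> = {#}\<close> rep by (simp only: add.right_neutral)
        finally have "sdet x (sum_mset \<xi>) = 0" .
        then have z: "(\<Sum>z\<in>#\<zeta>. sdet x z) = 0" using "1.prems"(3) sum_mset_sdet by metis
        have "\<zeta> = {#}"
        proof (rule ccontr)
          assume "\<zeta> \<noteq> {#}"
          then obtain s \<zeta>' where s: "\<zeta> = add_mset s \<zeta>'" by (meson multiset_cases)
          have "0 \<le> (\<Sum>z\<in>#\<zeta>'. sdet x z)" using dir_min_le_sdet[of \<zeta>' \<zeta>' x] dir_min_eq_0[of \<zeta>' x] zlow s by simp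
          then show False using z off[of s] s by simp
        qed
        then have s0: "sum_mset \<xi> = 0" using "1.prems"(3) by simp
        obtain \<xi>' where "\<xi> = add_mset x \<xi>'" using x by (metis insert_DiffM)
        then have "x + sum_mset \<xi>' = 0" using s0 by simp
        then have "x = 0" by (simp add: prod_eq_iff)
        then show False using copx coprime_pair_nonzero by blast
      qed
      moreover have rho: "s \<in># \<xi>" "s \<noteq> x" if "s \<in># \<rho>" for s using that by (auto simp: \<rho>_def)
      ultimately obtain y where y: "y \<in># \<rho>" and ylow: "\<And>s. s \<in># \<rho> \<Longrightarrow> 0 \<le> sdet y s"
        using lowest_slope[of \<rho>] "1.prems"(2) by blast
      obtain \<eta> where eta: "\<rho> = add_mset y \<eta>" using y by (metis insert_DiffM)
      have copy: "coprime_pair y" using y rho "1.prems"(2) by blast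
      have xy: "0 < sdet x y" using xlow[OF rho(1)[OF y]] sdet_0_eq[OF copx copy] rho(2)[OF y] by force
      have xi': "\<xi> = replicate_mset (Suc c) x + add_mset y \<eta>" using xi c eta by simp
      obtain as where "refines x y as" using refines_exists[OF copx copy] xy by auto
      then have fan: "fan x as y" and srt: "sorted_wrt (\<lambda>s t. 0 \<le> sdet s t) as"
        and asc: "\<forall>s\<in>set as. coprime_pair s \<and> 0 \<le> sdet x s \<and> 0 \<le> sdet s y"
        and st: "wsteps (length as) (map minimal_seq as) [minimal_seq x, minimal_seq y]"
        unfolding refines_def by auto
      let ?R = "replicate_mset c x + \<eta>" let ?\<xi> = "?R + mset as"
      have xiR: "\<xi> = ?R + {#x, y#}" by (simp add: xi')
      have Rlow: "s = x \<or> 0 \<le> sdet y s" if "s \<in># ?R" for s using that ylow[of s] by (auto simp: eta split: if_splits)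
      have det_cross: "det_cross \<theta> (mset as) = det_cross \<theta> {#x, y#}" if "\<And>s. s \<in># \<theta> \<Longrightarrow> s = x \<or> 0 \<le> sdet y s" for \<theta>
        using that
      proof (induction \<theta>)
        case (add s \<theta>)
        have "det_cross {#s#} (mset as) = \<bar>sdet s x\<bar> + \<bar>sdet s y\<bar>"
          by (rule det_cross_refined[OF _ xy copx copy fan asc]) (use add.prems in auto)
        then show ?case using add by (simp add: det_cross_def)
      qed (simp add: det_cross_def)
      have pas: "det_total (mset as) = 2 * (sdet x y - int (length as))"
        using det_total_sorted(1)[OF srt] fan_length[OF fan] by simp
      have pxy: "det_total {#x, y#} = 2 * sdet x y"
        using xy sdet_anti[of y x] by (simp add: det_total_def)
      have cross_R: "det_cross ?R (mset as) = det_cross ?R {#x, y#}" by (rule det_cross) (rule Rlow)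
      have diff: "det_total \<xi> - det_total ?\<xi> = 2 * int (length as)"
        unfolding xiR det_total_add cross_R pas pxy by simp
      have len: "0 < length as" using fan by (cases rule: fan.cases) auto
      have less: "((nat (det_total ?\<xi>), size ?\<xi>), (nat (det_total \<xi>), size \<xi>)) \<in> less_than <*lex*> less_than"
      proof -
        have "det_total ?\<xi> < det_total \<xi>" using diff len by linarith
        then have "nat (det_total ?\<xi>) < nat (det_total \<xi>)" using det_total_nonneg[of ?\<xi>] by linarith
        then show ?thesis by simp
      qed
      have "\<exists>k xs ys. mset xs = \<zeta> \<and> mset ys = ?\<xi> \<and> wsteps k (map minimal_seq xs) (map minimal_seq ys) \<and>
          2 * int k = det_total ?\<xi> - det_total \<zeta> \<and> (k = 0 \<longrightarrow> \<zeta> = ?\<xi>)"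
      proof (rule "1.hyps"[OF less "1.prems"(1)])
        show "coprime_pair s" if "s \<in># ?\<xi>" for s using that asc copx "1.prems"(2) xi' by (auto split: if_splits)
        have "sum_mset (mset as) = x + y" using fan_sum[OF fan] by (simp add: sum_mset_sum_list)
        then show "sum_mset \<zeta> = sum_mset ?\<xi>" unfolding "1.prems"(3) xiR by (simp add: ac_simps)
        show "dir_min w ?\<xi> \<le> dir_min w \<zeta>" if "coprime_pair w" for w
          using refined_above[OF xi' xy _ "1.prems"(2) that "1.prems"(4) off fan] ylow eta by (simp add: ac_simps)
      qed
      then obtain k xs ys where k: "mset xs = \<zeta>" "mset ys = ?\<xi>" "wsteps k (map minimal_seq xs) (map minimal_seq ys)"
          "2 * int k = det_total ?\<xi> - det_total \<zeta>" by blast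
      obtain rs where rs: "mset rs = ?R" using ex_mset by blast
      have "wsteps (length as) (map minimal_seq rs @ map minimal_seq as) (map minimal_seq rs @ [minimal_seq x, minimal_seq y])"
        using st by (rule wsteps_append)
      then have "wsteps (length as) (map minimal_seq ys) (map minimal_seq (rs @ [x, y]))"
      proof (rule wsteps_iso[rotated])
        have "mset ys = mset (rs @ as)" using k rs by simp
        then have "mset (map word_lp (map minimal_seq ys)) = mset (map word_lp (map minimal_seq rs @ map minimal_seq as))"
          by (metis map_append mset_map)
        then show "words_lp (map minimal_seq ys) \<simeq> words_lp (map minimal_seq rs @ map minimal_seq as)" by (rule lp_sum_mset)
      qed (simp add: lp_iso_refl)
      from wsteps_trans[OF k(3) this] show ?thesis
        using k(1,4) diff len rs xiR
        by (intro exI[where x = "k + length as"] exI[where x = xs] exI[where x = "rs @ [x, y]"]) auto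
    qed
  qed
qed

section \<open>The chain of modules\<close>

lemma card_words_lp: "card (fst (words_lp ws)) = sum_list (map length ws)"
proof -
  have "fst (words_lp ws) = Sigma {..<length ws} (\<lambda>j. {..<length (ws ! j)})"
    by (auto simp: lp_sum_def word_lp_def)
  then show ?thesis by (simp add: sum_list_sum_nth lessThan_atLeast0)
qed

lemma lp_iso_card: "L \<simeq> M \<Longrightarrow> card (fst L) = card (fst M)"
  unfolding lp_iso_def by (auto split: prod.splits intro: bij_betw_same_card)

text \<open>
  The sequence of the direct sum of the standard modules of \<open>ws\<close>.
\<close>

definition word_of :: "bool list list \<Rightarrow> bool list" where
  "word_of ws = (SOME A. words_lp ws \<simeq> word_lp A)"

lemma word_of: "words_lp ws \<simeq> word_lp (word_of ws)"
  unfolding word_of_def using words_lp_iso_exists by (rule someI_ex)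

lemma length_word_of: "length (word_of ws) = card (fst (words_lp ws))"
  using lp_iso_card[OF word_of[of ws]] by (simp add: word_lp_def)

lemma wstep_card: "wstep us ws \<Longrightarrow> card (fst (words_lp us)) = card (fst (words_lp ws))"
proof -
  assume "wstep us ws"
  then obtain ps Q Q' where q: "words_lp ws \<simeq> words_lp (ps @ [Q])" "words_lp us \<simeq> words_lp (ps @ [Q'])" "exchange_01 Q Q'"
    by (auto simp: wstep_def)
  have "length Q = length Q'" using q(3) by (auto simp: exchange_01_def)
  then have "card (fst (words_lp (ps @ [Q']))) = card (fst (words_lp (ps @ [Q])))"
    unfolding card_words_lp by simp
  then show ?thesis using lp_iso_card[OF q(1)] lp_iso_card[OF q(2)] by simp
qed

lemma dm1_seq_sum:
  assumes "CHAR('k::alg_closed_field) > 0" "words_lp ws \<simeq> word_lp A"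
  shows "dm1_seq (dm1_sum (map std_dm1 ws) :: ('k, nat \<times> nat) dm1) = A"
  using dm1_seq_eq[OF assms(1) dm1_sum_std(2)[OF assms] dm1_sum_std(1)[OF assms]] .

text \<open>
  The common part \<open>ps\<close> is itself a standard module, so that the direct sum of two sequences suffices.
\<close>

lemma wstep_seq_step:
  assumes ch: "CHAR('k::alg_closed_field) > 0" and step: "wstep us ws"
  shows "seq_step TYPE('k) (word_of us) (word_of ws)"
proof -
  obtain ps Q Q' where q: "words_lp ws \<simeq> words_lp (ps @ [Q])" "words_lp us \<simeq> words_lp (ps @ [Q'])" "exchange_01 Q Q'"
    using step by (auto simp: wstep_def)
  let ?P = "word_of ps"
  have P: "words_lp [?P] \<simeq> words_lp ps"
    by (rule lp_iso_trans[OF words_lp_single lp_iso_sym[OF lp_ok_words_lp word_of]])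
  have sum: "seq_oplus TYPE('k) ?P R = word_of vs" if "words_lp vs \<simeq> words_lp (ps @ [R])" for R vs
  proof -
    have "words_lp ([?P] @ [R]) \<simeq> words_lp (ps @ [R])" using P lp_iso_refl by (rule words_lp_append)
    from lp_iso_trans[OF this lp_iso_trans[OF words_lp_iso_sym[OF that] word_of]]
    have "words_lp [?P, R] \<simeq> word_lp (word_of vs)" by simp
    from dm1_seq_sum[OF ch this] show ?thesis by (simp add: seq_oplus_def)
  qed
  show ?thesis unfolding seq_step_def using sum[OF q(1)] sum[OF q(2)] q(3) by metis
qed

theorem theorem5p1:
  fixes \<zeta> \<xi> :: "(nat \<times> nat) multiset" and h :: nat
  assumes "CHAR('k::alg_closed_field) > 0"
    and "newton_polygon \<zeta>" and "newton_polygon \<xi>"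
    and "np_height \<zeta> = h" and "np_height \<xi> = h"
    and "np_prec \<zeta> \<xi>"
  shows "\<exists>(c :: nat) (M :: nat \<Rightarrow> ('k, nat \<times> nat) dm1) (A :: nat \<Rightarrow> bool list).
    real c = np_c \<zeta> \<xi> \<and>
    M 0 = minimal_dm1 \<zeta> \<and> M c = minimal_dm1 \<xi> \<and>
    (\<forall>i \<le> c. is_dm1 h (M i)) \<and>
    (\<forall>i \<le> c. A i = dm1_seq (M i) \<and> length (A i) = h) \<and>
    (\<forall>i < c. seq_less TYPE('k) (A i) (A (Suc i)))"
proof -
  note ch = assms(1)
  have coprime_pair: "coprime_pair s" if "newton_polygon \<eta>" "s \<in># \<eta>" for s \<eta>
    using that by (auto simp: newton_polygon_def case_prod_beta)
  have hd: "(fst (sum_mset \<eta>) + snd (sum_mset \<eta>) = np_height \<eta>) \<and> snd (sum_mset \<eta>) = np_dim \<eta>" for \<eta>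
    by (induction \<eta>) (auto simp: np_height_def np_dim_def case_prod_beta)
  have sum: "sum_mset \<zeta> = sum_mset \<xi>"
    using hd[of \<zeta>] hd[of \<xi>] assms(6) by (auto simp: np_prec_def prod_eq_iff)
  obtain c xs ys where c: "mset xs = \<zeta>" "mset ys = \<xi>"
    "wsteps c (map minimal_seq xs) (map minimal_seq ys)" "2 * int c = det_total \<xi> - det_total \<zeta>" "c = 0 \<longrightarrow> \<zeta> = \<xi>"
    using polygon_chain[OF coprime_pair[OF assms(2)] coprime_pair[OF assms(3)] sum np_prec_dir_min[OF assms(2,3,6)]] by blast
  obtain S where S: "S 0 = map minimal_seq xs" "words_lp (S c) \<simeq> words_lp (map minimal_seq ys)"
    "\<And>i. i < c \<Longrightarrow> wstep (S i) (S (Suc i))"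
    using c(3) by (auto simp: wsteps_def)
  have np: "words_lp (map minimal_seq (np_list \<eta>)) \<simeq> words_lp (map minimal_seq zs)" if "mset zs = \<eta>" for \<eta> zs
    using that np_list_props(1)[of \<eta>] by (intro lp_sum_mset) (metis mset_map)
  \<comment> \<open>The end points of the chain have to be the given direct sums themselves, in the given order.\<close>
  define ws where "ws i = (if i = 0 then map minimal_seq (np_list \<zeta>)
      else if i = c then map minimal_seq (np_list \<xi>) else [word_of (S i)])" for i
  define A where "A i = word_of (S i)" for i
  define M where "M i = (dm1_sum (map std_dm1 (ws i)) :: ('k, nat \<times> nat) dm1)" for i
  have iso: "words_lp (ws i) \<simeq> word_lp (A i)" for i
  proof -
    have "words_lp (ws i) \<simeq> words_lp (S i)"
    proof -
      consider "i = 0" | "i \<noteq> 0" "i = c" | "i \<noteq> 0" "i \<noteq> c" by blast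
      then show ?thesis
      proof cases
        case 1
        then show ?thesis using np[OF c(1)] S(1) by (simp only: ws_def if_True refl)
      next
        case 2
        then show ?thesis using lp_iso_trans[OF np[OF c(2)] words_lp_iso_sym[OF S(2)]]
          by (simp only: ws_def if_True if_False refl)
      next
        case 3
        then show ?thesis using lp_iso_trans[OF words_lp_single lp_iso_sym[OF lp_ok_words_lp word_of[of "S i"]]]
          by (simp only: ws_def if_False)
      qed
    qed
    from lp_iso_trans[OF this word_of] show ?thesis by (simp add: A_def)
  qed
  have M: "M 0 = minimal_dm1 \<zeta>" "M c = minimal_dm1 \<xi>"
    using c(5) by (auto simp: M_def ws_def minimal_dm1_def o_def)
  have "card (fst (words_lp (S i))) = h" if "i \<le> c" for i
    using that
  proof (induction i)
    case 0
    have "sum_list (map length (map minimal_seq zs)) = np_height (mset zs)" for zs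
      by (induction zs) (auto simp: np_height_def case_prod_beta minimal_seq_def)
    then show ?case using assms(4) c(1) S(1) by (simp only: card_words_lp)
  next
    case (Suc i)
    then show ?case using wstep_card[OF S(3)[of i]] by simp
  qed
  then have len: "length (A i) = h" if "i \<le> c" for i
    using that by (simp add: A_def length_word_of)
  have "real c = np_c \<zeta> \<xi>"
  proof -
    have "2 * np_c \<zeta> \<xi> = real_of_int (2 * int c)" using np_c_eq[OF assms(2,3,6)] c(4) by simp
    then show ?thesis by simp
  qed
  moreover have "is_dm1 h (M i)" if "i \<le> c" for i
    using dm1_sum_std(2)[OF ch iso[of i]] len[OF that] by (simp add: M_def)
  moreover have "A i = dm1_seq (M i)" for i
    using dm1_seq_sum[OF ch iso[of i]] by (simp add: M_def)
  moreover have "seq_less TYPE('k) (A i) (A (Suc i))" if "i < c" for i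
    unfolding seq_less_def
  proof (intro exI conjI)
    let ?S = "\<lambda>j :: nat. if j = 0 then A i else A (Suc i)"
    show "(1 :: nat) \<le> 1" "?S 0 = A i" "?S 1 = A (Suc i)" by simp_all
    show "\<forall>j\<le>1. length (?S j) = length (A (Suc i))" using len that by simp
    show "\<forall>j\<in>{1..1}. seq_step TYPE('k) (?S (j - 1)) (?S j)"
      using wstep_seq_step[OF ch S(3)[OF that]] by (simp add: A_def)
  qed
  ultimately show ?thesis using M len by (intro exI[where x = c] exI[where x = M] exI[where x = A]) simp
qed

end
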